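(* Type checking and type reconstruction are decidable for $\Delta^{CD}_{\equiv}$, $\Delta^{CDV}_{\equiv}$, $\Delta^{CDS}_{\equiv}$, $\Delta^{BCD}_{\equiv}$, $\Delta^{CD}_{=_\beta}$, $\Delta^{CDV}_{=_\beta}$ and $\Delta^{CDV}_{=_{\beta\eta}}$, and are undecidable for $\Delta^{CDS}_{=_\beta}$, $\Delta^{BCD}_{=_\beta}$ and $\Delta^{BCD}_{=_{\beta\eta}}$.
   Context: Type atoms: a set $\mathbb{A}$ of symbols; $\omega$ denotes a distinguished atom (the universal type). $\mathbb{A}_\infty=\{\mathtt a_i\mid i\in\mathbb N\}$ with each $\mathtt a_i\neq\omega$, and $\mathbb{A}^\omega_\infty=\mathbb{A}_\infty\cup\{\omega\}$. Intersection types over $\mathbb A$: $\sigma::= a\mid\sigma\to\sigma\mid\sigma\cap\sigma$ ($a\in\mathbb A$). An intersection type theory $\mathcal T$ over $\mathbb A$ is a set of inequalities $\sigma\le\tau$ (written $\sigma\le_{\mathcal T}\tau$) closed under (refl) $\sigma\le\sigma$; (incl) $\sigma\cap\tau\le\sigma$ and $\sigma\cap\tau\le\tau$; (glb) $\rho\le\sigma$ and $\rho\le\tau$ imply $\rho\le\sigma\cap\tau$; (trans) $\sigma\le\tau$ and $\tau\le\rho$ imply $\sigma\le\rho$. Additional axioms/rules: $(\omega_{top})$ $\sigma\le\omega$; $(\omega_{\to})$ $\omega\le\sigma\to\omega$; $(\to\cap)$ $(\sigma\to\tau)\cap(\sigma\to\rho)\le\sigma\to(\tau\cap\rho)$; $(\to)$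 $\sigma_2\le\sigma_1$ and $\tau_1\le\tau_2$ imply $\sigma_1\to\tau_1\le\sigma_2\to\tau_2$. $\mathcal T_{CD}$ = smallest type theory over $\mathbb A_\infty$; $\mathcal T_{CDS}$ = smallest over $\mathbb A^\omega_\infty$ containing $(\omega_{top})$; $\mathcal T_{CDV}$ = smallest over $\mathbb A_\infty$ closed under $(\to)$ and $(\to\cap)$; $\mathcal T_{BCD}$ = smallest over $\mathbb A^\omega_\infty$ closed under $(\to),(\to\cap),(\omega_{top}),(\omega_\to)$. We abbreviate these as CD, CDS, CDV, BCD. $\Delta$-terms: $\Delta::=u_\Delta\mid x\mid\lambda x{:}\sigma.\Delta\mid\Delta\,\Delta\mid\langle\Delta,\Delta\rangle\mid pr_1\Delta\mid pr_2\Delta\mid\Delta^\sigma$, where for every (not necessarily typable) $\Delta$-term $\Delta$ there is a constant $u_\Delta$. The essence $\|\Delta\|$ is the pure $\lambda$-term defined by $\|x\|=x$, $\|u_\Delta\|=\|\Delta\|$, $\|\Delta^\sigma\|=\|\Delta\|$, $\|\lambda x{:}\sigma.\Delta\|=\lambda x.\|\Delta\|$, $\|\Delta_1\Delta_2\|=\|\Delta_1\|\,\|\Delta_2\|$, $\|\langle\Delta_1,\Delta_2\rangle\|=\|\Delta_1\|$, $\|pr_i\Delta\|=\|\Delta\|$. Let $\mathcal R$ be one of $\equiv$ (syntactic identity up to $\alpha$), $=_\beta$, $=_{\beta\eta}$ on pure $\lambda$-terms. A basis $B$ is a finite set of declarations $x{:}\sigma$ with distinct variables. The typed system $\Delta^{\mathcal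 T}_{\mathcal R}$ derives $B\vdash^{\mathcal T}_{\mathcal R}\Delta:\sigma$ by: (top) $B\vdash u_\Delta:\omega$ if $\omega\in\mathbb A$; (ax) $B\vdash x:\sigma$ if $x{:}\sigma\in B$; ($\to$I) from $B,x{:}\sigma\vdash\Delta:\tau$ infer $B\vdash\lambda x{:}\sigma.\Delta:\sigma\to\tau$; ($\to$E) from $B\vdash\Delta_1:\sigma\to\tau$ and $B\vdash\Delta_2:\sigma$ infer $B\vdash\Delta_1\Delta_2:\tau$; ($\cap$I) from $B\vdash\Delta_1:\sigma$, $B\vdash\Delta_2:\tau$ and $\|\Delta_1\|\mathrel{\mathcal R}\|\Delta_2\|$ infer $B\vdash\langle\Delta_1,\Delta_2\rangle:\sigma\cap\tau$; ($\cap$E$_1$) from $B\vdash\Delta:\sigma\cap\tau$ infer $B\vdash pr_1\Delta:\sigma$; ($\cap$E$_2$) from $B\vdash\Delta:\sigma\cap\tau$ infer $B\vdash pr_2\Delta:\tau$; ($\le_{\mathcal T}$) from $B\vdash\Delta:\sigma$ and $\sigma\le_{\mathcal T}\tau$ infer $B\vdash\Delta^\tau:\tau$. We write $\Delta^{CD}_{\mathcal R}$ for $\Delta^{\mathcal T_{CD}}_{\mathcal R}$, etc. Type checking for a system: the problem, given $B$, $\Delta$, $\sigma$, of deciding whether $B\vdash^{\mathcal T}_{\mathcal R}\Delta:\sigma$. Type reconstruction: the problem, given $B$ and $\Delta$, of deciding whether some $\sigma$ with $B\vdash^{\mathcal T}_{\mathcal R}\Delta:\sigma$ exists and, if so, computing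 it. *)

theory Defs
  imports Main "HOL-Library.Nat_Bijection"
begin

datatype recf = Z | S | Id nat | Cn recf "recf list" | Pr recf recf | Mn recf

inductive eval :: "recf \<Rightarrow> nat list \<Rightarrow> nat \<Rightarrow> bool" where
  ev_Z: "eval Z xs 0"
| ev_S: "eval S (x # xs) (Suc x)"
| ev_Id: "i < length xs \<Longrightarrow> eval (Id i) xs (xs ! i)"
| ev_Cn: "length ys = length gs \<Longrightarrow> (\<forall>i < length gs. eval (gs ! i) xs (ys ! i))
           \<Longrightarrow> eval f ys z \<Longrightarrow> eval (Cn f gs) xs z"
| ev_Pr0: "eval f xs y \<Longrightarrow> eval (Pr f g) (0 # xs) y"
| ev_PrS: "eval (Pr f g) (n # xs) y \<Longrightarrow> eval g (n # y # xs) z \<Longrightarrow> eval (Pr f g) (Suc n # xs) z"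
| ev_Mn: "eval f (n # xs) 0 \<Longrightarrow> (\<forall>m < n. \<exists>y. eval f (m # xs) y \<and> y \<noteq> 0) \<Longrightarrow> eval (Mn f) xs n"

datatype atom = Omega | At nat

datatype ty = Atom atom | Arr ty ty | Inter ty ty

datatype tth = CD | CDS | CDV | BCD

definition has_omega :: "tth \<Rightarrow> bool" where
  "has_omega T \<longleftrightarrow> T = CDS \<or> T = BCD"

definition has_arrow_rules :: "tth \<Rightarrow> bool" where
  "has_arrow_rules T \<longleftrightarrow> T = CDV \<or> T = BCD"

fun wf_ty :: "tth \<Rightarrow> ty \<Rightarrow> bool" where
  "wf_ty T (Atom Omega) = has_omega T"
| "wf_ty T (Atom (At i)) = True"
| "wf_ty T (Arr s t) = (wf_ty T s \<and> wf_ty T t)"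
| "wf_ty T (Inter s t) = (wf_ty T s \<and> wf_ty T t)"

abbreviation om :: ty where "om \<equiv> Atom Omega"

inductive leq :: "tth \<Rightarrow> ty \<Rightarrow> ty \<Rightarrow> bool" where
  refl: "wf_ty T s \<Longrightarrow> leq T s s"
| incl1: "wf_ty T s \<Longrightarrow> wf_ty T t \<Longrightarrow> leq T (Inter s t) s"
| incl2: "wf_ty T s \<Longrightarrow> wf_ty T t \<Longrightarrow> leq T (Inter s t) t"
| glb: "leq T r s \<Longrightarrow> leq T r t \<Longrightarrow> leq T r (Inter s t)"
| trans: "leq T s t \<Longrightarrow> leq T t r \<Longrightarrow> leq T s r"
| omega_top: "has_omega T \<Longrightarrow> wf_ty T s \<Longrightarrow> leq T s om"
| omega_arr: "T = BCD \<Longrightarrow> wf_ty T s \<Longrightarrow> leq T om (Arr s om)"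
| arr_inter: "has_arrow_rules T \<Longrightarrow> wf_ty T s \<Longrightarrow> wf_ty T t \<Longrightarrow> wf_ty T r \<Longrightarrow>
              leq T (Inter (Arr s t) (Arr s r)) (Arr s (Inter t r))"
| arr: "has_arrow_rules T \<Longrightarrow> leq T s2 s1 \<Longrightarrow> leq T t1 t2 \<Longrightarrow> leq T (Arr s1 t1) (Arr s2 t2)"

datatype lterm = FV nat | BV nat | Abs lterm | App lterm lterm

fun lift :: "lterm \<Rightarrow> nat \<Rightarrow> lterm" where
  "lift (FV x) k = FV x"
| "lift (BV i) k = (if i < k then BV i else BV (Suc i))"
| "lift (Abs s) k = Abs (lift s (Suc k))"
| "lift (App s t) k = App (lift s k) (lift t k)"

fun subst :: "lterm \<Rightarrow> lterm \<Rightarrow> nat \<Rightarrow> lterm" where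
  "subst (FV x) t k = FV x"
| "subst (BV i) t k = (if k < i then BV (i - 1) else if i = k then t else BV i)"
| "subst (Abs s) t k = Abs (subst s (lift t 0) (Suc k))"
| "subst (App s u) t k = App (subst s t k) (subst u t k)"

fun loose :: "lterm \<Rightarrow> nat \<Rightarrow> bool" where
  "loose (FV x) k = False"
| "loose (BV i) k = (i = k)"
| "loose (Abs s) k = loose s (Suc k)"
| "loose (App s t) k = (loose s k \<or> loose t k)"

inductive beta :: "lterm \<Rightarrow> lterm \<Rightarrow> bool" where
  b_redex: "beta (App (Abs s) t) (subst s t 0)"
| b_appL: "beta s t \<Longrightarrow> beta (App s u) (App t u)"
| b_appR: "beta s t \<Longrightarrow> beta (App u s) (App u t)"
| b_abs: "beta s t \<Longrightarrow> beta (Abs s) (Abs t)"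

inductive eta :: "lterm \<Rightarrow> lterm \<Rightarrow> bool" where
  e_redex: "\<not> loose s 0 \<Longrightarrow> eta (Abs (App s (BV 0))) (subst s (BV 0) 0)"
| e_appL: "eta s t \<Longrightarrow> eta (App s u) (App t u)"
| e_appR: "eta s t \<Longrightarrow> eta (App u s) (App u t)"
| e_abs: "eta s t \<Longrightarrow> eta (Abs s) (Abs t)"

datatype eqrel = Syn | Beta | BetaEta

fun rel_holds :: "eqrel \<Rightarrow> lterm \<Rightarrow> lterm \<Rightarrow> bool" where
  "rel_holds Syn M N = (M = N)"   \<comment> \<open>identity of de Bruijn terms = alpha-identity\<close>
| "rel_holds Beta M N = equivclp beta M N"
| "rel_holds BetaEta M N = equivclp (sup beta eta) M N"

datatype dterm = U dterm | Var nat | Lam nat ty dterm | Ap dterm dterm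
  | Pair dterm dterm | Pr1 dterm | Pr2 dterm | Coer dterm ty

fun abst :: "nat \<Rightarrow> nat \<Rightarrow> lterm \<Rightarrow> lterm" where
  "abst x k (FV y) = (if x = y then BV k else FV y)"
| "abst x k (BV i) = BV i"
| "abst x k (Abs s) = Abs (abst x (Suc k) s)"
| "abst x k (App s t) = App (abst x k s) (abst x k t)"

fun ess :: "dterm \<Rightarrow> lterm" where
  "ess (U D) = ess D"
| "ess (Var x) = FV x"
| "ess (Lam x s D) = Abs (abst x 0 (ess D))"
| "ess (Ap D1 D2) = App (ess D1) (ess D2)"
| "ess (Pair D1 D2) = ess D1"
| "ess (Pr1 D) = ess D"
| "ess (Pr2 D) = ess D"
| "ess (Coer D s) = ess D"

type_synonym basis = "(nat \<times> ty) list"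

inductive typing :: "tth \<Rightarrow> eqrel \<Rightarrow> basis \<Rightarrow> dterm \<Rightarrow> ty \<Rightarrow> bool" where
  t_top: "has_omega T \<Longrightarrow> typing T R B (U D) om"
| t_ax: "map_of B x = Some s \<Longrightarrow> typing T R B (Var x) s"
| t_absI: "wf_ty T s \<Longrightarrow> typing T R ((x, s) # B) D t \<Longrightarrow> typing T R B (Lam x s D) (Arr s t)"
| t_appE: "typing T R B D1 (Arr s t) \<Longrightarrow> typing T R B D2 s \<Longrightarrow> typing T R B (Ap D1 D2) t"
| t_interI: "typing T R B D1 s \<Longrightarrow> typing T R B D2 t \<Longrightarrow> rel_holds R (ess D1) (ess D2) \<Longrightarrow>
             typing T R B (Pair D1 D2) (Inter s t)"
| t_interE1: "typing T R B D (Inter s t) \<Longrightarrow> typing T R B (Pr1 D) s"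
| t_interE2: "typing T R B D (Inter s t) \<Longrightarrow> typing T R B (Pr2 D) t"
| t_leq: "typing T R B D s \<Longrightarrow> leq T s t \<Longrightarrow> typing T R B (Coer D t) t"

definition valid_basis :: "tth \<Rightarrow> basis \<Rightarrow> bool" where
  "valid_basis T B \<longleftrightarrow> distinct (map fst B) \<and> (\<forall>(x, s) \<in> set B. wf_ty T s)"

fun enc_atom :: "atom \<Rightarrow> nat" where
  "enc_atom Omega = 0"
| "enc_atom (At i) = Suc i"

fun enc_ty :: "ty \<Rightarrow> nat" where
  "enc_ty (Atom a) = prod_encode (0, enc_atom a)"
| "enc_ty (Arr s t) = prod_encode (1, prod_encode (enc_ty s, enc_ty t))"
| "enc_ty (Inter s t) = prod_encode (2, prod_encode (enc_ty s, enc_ty t))"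

fun enc_dterm :: "dterm \<Rightarrow> nat" where
  "enc_dterm (U D) = prod_encode (0, enc_dterm D)"
| "enc_dterm (Var x) = prod_encode (1, x)"
| "enc_dterm (Lam x s D) = prod_encode (2, prod_encode (x, prod_encode (enc_ty s, enc_dterm D)))"
| "enc_dterm (Ap D1 D2) = prod_encode (3, prod_encode (enc_dterm D1, enc_dterm D2))"
| "enc_dterm (Pair D1 D2) = prod_encode (4, prod_encode (enc_dterm D1, enc_dterm D2))"
| "enc_dterm (Pr1 D) = prod_encode (5, enc_dterm D)"
| "enc_dterm (Pr2 D) = prod_encode (6, enc_dterm D)"
| "enc_dterm (Coer D s) = prod_encode (7, prod_encode (enc_dterm D, enc_ty s))"

fun enc_basis :: "basis \<Rightarrow> nat" where
  "enc_basis [] = 0"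
| "enc_basis ((x, s) # B) = Suc (prod_encode (prod_encode (x, enc_ty s), enc_basis B))"

definition type_checking_decidable :: "tth \<Rightarrow> eqrel \<Rightarrow> bool" where
  "type_checking_decidable T R \<longleftrightarrow>
     (\<exists>f. \<forall>B D s. valid_basis T B \<longrightarrow>
        eval f [prod_encode (enc_basis B, prod_encode (enc_dterm D, enc_ty s))]
             (if typing T R B D s then 1 else 0))"

definition type_reconstruction_decidable :: "tth \<Rightarrow> eqrel \<Rightarrow> bool" where
  "type_reconstruction_decidable T R \<longleftrightarrow>
     (\<exists>f g. \<forall>B D. valid_basis T B \<longrightarrow>
        eval f [prod_encode (enc_basis B, enc_dterm D)] (if (\<exists>s. typing T R B D s) then 1 else 0) \<and>
        ((\<exists>s. typing T R B D s) \<longrightarrow>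
           (\<exists>s. eval g [prod_encode (enc_basis B, enc_dterm D)] (enc_ty s) \<and> typing T R B D s)))"

end

theory Submission
  imports Defs "HOL-Library.Confluence"
begin

text \<open>Terms are Church-style, so a type is read off by recursion once the subtype relation is
  decidable; what remains are finitely many conversion problems between essences.
  Without \<open>\<omega>\<close>, essences of typable terms are normalising (also when intersection introduction
  only asks for convertible essences, since reducibility candidates can be chosen closed under
  conversion), so comparing normal forms decides them. With \<open>\<omega>\<close>, the term
  \<open>\<langle>u\<^sub>D, u\<^sub>E\<rangle>\<close> is typable iff the arbitrary pure terms \<open>\<parallel>D\<parallel>\<close> and \<open>\<parallel>E\<parallel>\<close> are convertible,
  and convertibility is undecidable by diagonalisation.\<close>

section \<open>Computable functions on encoded types\<close>

text \<open>One dividing line, \<open>R = Syn \<or> \<not> has_omega T\<close> against its negation,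
  settles all ten systems. Two obstacles shape the positive side. A decision procedure is a
  \<open>recf\<close> program that must answer on untypable terms as well, whereas the search for a
  normal form may diverge on an essence that has none. The search is therefore run in stages and
  stops as soon as one side condition is refuted or all are confirmed; it terminates because an
  innermost failing pair has typable components, whose essences normalise, so its failure is found.
  Moreover \<open>recf\<close> offers recursion on numbers only, while the procedure recurses over
  trees in several arguments; a stack machine driven by minimisation simulates all such recursions
  uniformly. On the negative side the assumed decider is used as a program in two ways: it is
  composed with coding functions, and it is represented by a pure term to which the diagonal
  argument applies.\<close>

lemma eval_comp1: "eval g xs y \<Longrightarrow> eval f [y] z \<Longrightarrow> eval (Cn f [g]) xs z"
  by (rule ev_Cn[where ys = "[y]"]) auto

lemma eval_comp2:
  "eval g1 xs y1 \<Longrightarrow> eval g2 xs y2 \<Longrightarrow> eval f [y1, y2] z \<Longrightarrow> eval (Cn f [g1, g2]) xs z"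
  by (rule ev_Cn[where ys = "[y1, y2]"]) (auto simp: less_Suc_eq nth_Cons split: nat.splits)

lemma eval_comp3:
  "eval g1 xs y1 \<Longrightarrow> eval g2 xs y2 \<Longrightarrow> eval g3 xs y3 \<Longrightarrow> eval f [y1, y2, y3] z \<Longrightarrow>
   eval (Cn f [g1, g2, g3]) xs z"
  by (rule ev_Cn[where ys = "[y1, y2, y3]"]) (auto simp: less_Suc_eq nth_Cons split: nat.splits)

lemma eval_Id: "i < length xs \<Longrightarrow> y = xs ! i \<Longrightarrow> eval (Id i) xs y"
  by (simp add: ev_Id)

lemma eval_Id0: "eval (Id 0) (x # xs) x"
  and eval_Id1: "eval (Id 1) (x # y # xs) y"
  and eval_Id2: "eval (Id 2) (x # y # z # xs) z"
  by (simp_all add: eval_Id)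

lemmas eval_rules = eval_Id0 eval_Id1 eval_Id2 eval_comp1 eval_comp2 ev_S

lemma ex_eval_const: "\<exists>r. \<forall>xs. eval r xs n"
  by (induction n) (blast intro: ev_Z ev_S eval_comp1)+

text \<open>In the step function of \<open>Pr\<close>, argument 0 is the predecessor, argument 1 the
  recursive value, and the parameters start at 2.\<close>

definition add_recf :: recf where
  "add_recf = Pr (Id 0) (Cn S [Id 1])"

lemma eval_add_recf: "eval add_recf [n, p] (n + p)"
proof (induction n)
  case 0
  then show ?case unfolding add_recf_def by (auto intro!: ev_Pr0 eval_Id)
next
  case (Suc n)
  then show ?case unfolding add_recf_def
    by (auto intro!: ev_PrS eval_comp1 eval_Id ev_S)
qed

definition pred_recf :: recf where
  "pred_recf = Pr Z (Id 0)"

lemma eval_pred_recf: "eval pred_recf [n] (n - 1)"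
proof (induction n)
  case (Suc n)
  then show ?case unfolding pred_recf_def by (auto intro!: ev_PrS eval_Id)
qed (auto simp: pred_recf_def intro!: ev_Pr0 ev_Z)

text \<open>The recursion peels off the subtrahend, which therefore comes as the first
  argument.\<close>

definition sub_recf :: recf where
  "sub_recf = Pr (Id 0) (Cn pred_recf [Id 1])"

lemma eval_sub_recf: "eval sub_recf [n, p] (p - n)"
proof (induction n)
  case 0
  then show ?case unfolding sub_recf_def by (auto intro!: ev_Pr0 eval_Id)
next
  case (Suc n)
  have "eval pred_recf [p - n] (p - Suc n)"
    using eval_pred_recf[of "p - n"] by simp
  with Suc show ?case unfolding sub_recf_def
    by (auto intro!: ev_PrS eval_comp1[of _ _ "p - n"] eval_Id)
qed

definition triangle_recf :: recf where
  "triangle_recf = Pr Z (Cn S [Cn add_recf [Id 0, Id 1]])"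

lemma eval_triangle_recf: "eval triangle_recf [n] (triangle n)"
proof (induction n)
  case 0
  then show ?case unfolding triangle_recf_def by (auto intro!: ev_Pr0 ev_Z)
next
  case (Suc n)
  have "eval (Cn S [Cn add_recf [Id 0, Id 1]]) [n, triangle n] (Suc (n + triangle n))"
    by (rule eval_rules eval_add_recf)+
  with Suc show ?case unfolding triangle_recf_def
    by (auto intro!: ev_PrS simp: add.commute)
qed

definition pair_recf :: recf where
  "pair_recf = Cn add_recf [Cn triangle_recf [add_recf], Id 0]"

lemma eval_pair_recf: "eval pair_recf [m, n] (prod_encode (m, n))"
  unfolding pair_recf_def prod_encode_def prod.case
  by (rule eval_rules eval_add_recf eval_triangle_recf)+

text \<open>Since \<open>prod_encode (a, b) = triangle (a + b) + a\<close>, the sum \<open>a + b\<close> is the least \<open>s\<close>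
  with \<open>prod_encode (a, b) < triangle (Suc s)\<close>.\<close>

definition diagonal_recf :: recf where
  "diagonal_recf = Mn (Cn sub_recf [Cn triangle_recf [Cn S [Id 0]], Cn S [Id 1]])"

lemma triangle_mono: "m \<le> n \<Longrightarrow> triangle m \<le> triangle n"
  by (induction n) (auto simp: le_Suc_eq)

lemma eval_diagonal_recf: "eval diagonal_recf [prod_encode (a, b)] (a + b)"
proof -
  let ?n = "prod_encode (a, b)"
  \<comment> \<open>\<open>Suc ?n - triangle (Suc s)\<close> is 0 exactly if
    \<open>?n < triangle (Suc s)\<close>, which turns the inequality into the zero test that
    \<open>Mn\<close> performs.\<close>
  have step: "eval (Cn sub_recf [Cn triangle_recf [Cn S [Id 0]], Cn S [Id 1]]) [s, ?n]
      (Suc ?n - triangle (Suc s))" for s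
    by (rule eval_rules eval_sub_recf eval_triangle_recf)+
  have "Suc ?n - triangle (Suc s) \<noteq> 0" if "s < a + b" for s
  proof -
    have "triangle (Suc s) \<le> triangle (a + b)" using that by (intro triangle_mono) simp
    then show ?thesis by (simp add: prod_encode_def)
  qed
  moreover have "Suc ?n - triangle (Suc (a + b)) = 0" by (simp add: prod_encode_def)
  ultimately show ?thesis unfolding diagonal_recf_def using step by (metis ev_Mn)
qed

definition fst_recf :: recf where
  "fst_recf = Cn sub_recf [Cn triangle_recf [diagonal_recf], Id 0]"

lemma eval_fst_recf: "eval fst_recf [prod_encode (a, b)] a"
proof -
  have "eval fst_recf [prod_encode (a, b)] (prod_encode (a, b) - triangle (a + b))"
    unfolding fst_recf_def
    by (rule eval_rules eval_sub_recf eval_triangle_recf eval_diagonal_recf)+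
  then show ?thesis by (simp add: prod_encode_def)
qed

definition snd_recf :: recf where
  "snd_recf = Cn sub_recf [fst_recf, diagonal_recf]"

lemma eval_snd_recf: "eval snd_recf [prod_encode (a, b)] b"
proof -
  have "eval snd_recf [prod_encode (a, b)] (a + b - a)"
    unfolding snd_recf_def
    by (rule eval_rules eval_sub_recf eval_fst_recf eval_diagonal_recf)+
  then show ?thesis by simp
qed

text \<open>A primitive recursion that ignores its recursive value is a case distinction. Both
  branches are evaluated, so it serves total functions only.\<close>

definition if_recf :: recf where
  "if_recf = Pr (Id 1) (Id 2)"

lemma eval_if_recf: "eval if_recf [c, a, b] (if c = 0 then b else a)"
proof (induction c)
  case 0
  then show ?case unfolding if_recf_def by (auto intro!: ev_Pr0 eval_Id)
next
  case (Suc c)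
  then show ?case unfolding if_recf_def by (auto intro!: ev_PrS eval_Id)
qed

section \<open>Computability of total functions between coded types\<close>

class encodable =
  fixes enc :: "'a \<Rightarrow> nat"
  assumes inj_enc: "inj enc"

lemma enc_eq_iff [simp]: "enc x = enc y \<longleftrightarrow> x = y"
  using inj_enc by (auto dest: injD)

instantiation nat :: encodable
begin
definition enc_nat :: "nat \<Rightarrow> nat" where [simp]: "enc_nat n = n"
instance by standard (simp add: inj_def)
end

instantiation bool :: encodable
begin
definition enc_bool :: "bool \<Rightarrow> nat" where [simp]: "enc_bool b = (if b then 1 else 0)"
instance by standard (simp add: inj_def)
end

instantiation prod :: (encodable, encodable) encodable
begin
definition enc_prod :: "'a \<times> 'b \<Rightarrow> nat" where [simp]: "enc_prod p = prod_encode (enc (fst p), enc (snd p))"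
instance by standard (auto simp: inj_def)
end

instantiation option :: (encodable) encodable
begin
definition enc_option :: "'a option \<Rightarrow> nat" where
  "enc_option x = (case x of None \<Rightarrow> 0 | Some y \<Rightarrow> Suc (enc y))"
instance by standard (auto simp: inj_def enc_option_def split: option.splits)
end

instantiation list :: (encodable) encodable
begin
fun enc_list :: "'a list \<Rightarrow> nat" where
  "enc_list [] = 0"
| "enc_list (x # xs) = Suc (prod_encode (enc x, enc_list xs))"
instance
proof
  have "enc xs = enc ys \<Longrightarrow> xs = ys" for xs ys :: "'a list"
    by (induction xs arbitrary: ys) (case_tac ys; simp)+
  then show "inj (enc :: 'a list \<Rightarrow> nat)" by (simp add: inj_def)
qed
end

text \<open>A program is only held to its values on codes, so codes need not exhaust the numbers.
  Several arguments are passed as one tuple.\<close>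

definition computable :: "('a::encodable \<Rightarrow> 'b::encodable) \<Rightarrow> bool" where
  "computable f \<longleftrightarrow> (\<exists>r. \<forall>x. eval r [enc x] (enc (f x)))"

text \<open>The rules are stated for expressions in a context variable \<open>x\<close>, so that
  computability of a composite expression follows by decomposing it along its syntax.\<close>

named_theorems computable_intros

lemma computable_comp: "computable f \<Longrightarrow> computable g \<Longrightarrow> computable (\<lambda>x. f (g x))"
  unfolding computable_def by (meson eval_comp1)

lemma computable_id [computable_intros]: "computable (\<lambda>x. x)"
  unfolding computable_def by (rule exI[of _ "Id 0"]) (auto intro: eval_Id)

lemma computable_const [computable_intros]: "computable (\<lambda>x. c)"
  unfolding computable_def using ex_eval_const by meson

lemma computable_Pair [computable_intros]:
  "computable f \<Longrightarrow> computable g \<Longrightarrow> computable (\<lambda>x. (f x, g x))"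
  unfolding computable_def by (simp, meson eval_comp2 eval_pair_recf)

lemma computable_fst [computable_intros]: "computable f \<Longrightarrow> computable (\<lambda>x. fst (f x))"
  unfolding computable_def by (simp, meson eval_comp1 eval_fst_recf)

lemma computable_snd [computable_intros]: "computable f \<Longrightarrow> computable (\<lambda>x. snd (f x))"
  unfolding computable_def by (simp, meson eval_comp1 eval_snd_recf)

lemma computable_prod_encode [computable_intros]:
  "computable f \<Longrightarrow> computable g \<Longrightarrow> computable (\<lambda>x. prod_encode (f x, g x))"
  unfolding computable_def by (simp, meson eval_comp2 eval_pair_recf)

lemma computable_prod_decode [computable_intros]:
  assumes "computable f" shows "computable (\<lambda>x. prod_decode (f x))"
proof -
  have "computable prod_decode"
    unfolding computable_def by (rule exI[of _ "Id 0"]) (auto intro!: eval_Id)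
  then show ?thesis using assms by (rule computable_comp)
qed

lemma computable_if [computable_intros]:
  assumes "computable c" "computable f" "computable g"
  shows "computable (\<lambda>x. if c x then f x else g x)"
proof -
  obtain rc rf rg where r: "\<And>x. eval rc [enc x] (enc (c x))" "\<And>x. eval rf [enc x] (enc (f x))"
    "\<And>x. eval rg [enc x] (enc (g x))"
    using assms unfolding computable_def by blast
  have "eval (Cn if_recf [rc, rf, rg]) [enc x] (enc (if c x then f x else g x))" for x
    using eval_comp3[OF r(1)[of x] r(2)[of x] r(3)[of x] eval_if_recf] by (cases "c x") auto
  then show ?thesis unfolding computable_def by blast
qed

lemma computable_Suc [computable_intros]: "computable f \<Longrightarrow> computable (\<lambda>x. Suc (f x))"
  unfolding computable_def by (simp, meson eval_comp1 ev_S)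

lemma computable_diff [computable_intros]:
  "computable f \<Longrightarrow> computable g \<Longrightarrow> computable (\<lambda>x. f x - (g x :: nat))"
  unfolding computable_def by (simp, meson eval_comp2 eval_sub_recf)

lemma computable_add [computable_intros]:
  "computable f \<Longrightarrow> computable g \<Longrightarrow> computable (\<lambda>x. f x + (g x :: nat))"
  unfolding computable_def by (simp, meson eval_comp2 eval_add_recf)

text \<open>Constructors and selectors act on codes by arithmetic, so for them no recursion is
  required.\<close>

lemma computable_by_code:
  fixes g :: "nat \<Rightarrow> nat"
  assumes "computable g" "\<And>x. enc (f x) = g (enc x)"
  shows "computable f"
  using assms unfolding computable_def by auto

lemma computable_nat_zero: "computable (\<lambda>n::nat. n = 0)"
proof -
  obtain z o1 where z: "\<And>xs. eval z xs 0" and o1: "\<And>xs. eval o1 xs 1"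
    using ex_eval_const by blast
  have "eval (Cn if_recf [Id 0, z, o1]) [n] (if n = 0 then 1 else 0)" for n
    by (rule eval_comp3[OF eval_Id0 z o1 eval_if_recf])
  then have "\<forall>n::nat. eval (Cn if_recf [Id 0, z, o1]) [enc n] (enc (n = 0))"
    by simp
  then show ?thesis unfolding computable_def by blast
qed

lemma computable_conj [computable_intros]:
  assumes "computable f" "computable g"
  shows "computable (\<lambda>x. f x \<and> g x)"
proof -
  have "computable (\<lambda>x. if f x then g x else False)"
    by (intro computable_intros assms)
  then show ?thesis by (rule back_subst[of computable]) auto
qed

lemma computable_not [computable_intros]:
  assumes "computable f" shows "computable (\<lambda>x. \<not> f x)"
proof -
  have "computable (\<lambda>x. if f x then False else True)"
    by (intro computable_intros assms)
  then show ?thesis by (rule back_subst[of computable]) auto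
qed

lemma computable_disj [computable_intros]:
  assumes "computable f" "computable g"
  shows "computable (\<lambda>x. f x \<or> g x)"
proof -
  have "computable (\<lambda>x. if f x then True else g x)"
    by (intro computable_intros assms)
  then show ?thesis by (rule back_subst[of computable]) auto
qed

text \<open>Codes are injective, and two numbers agree iff both truncated differences
  vanish.\<close>

lemma computable_eq [computable_intros]:
  fixes f g :: "'a::encodable \<Rightarrow> 'b::encodable"
  assumes "computable f" "computable g"
  shows "computable (\<lambda>x. f x = g x)"
proof -
  have "computable (\<lambda>x. enc (f x))" "computable (\<lambda>x. enc (g x))"
    using assms unfolding computable_def by simp_all
  then have "computable (\<lambda>x. (enc (f x) - enc (g x)) + (enc (g x) - enc (f x)) = 0)"
    by (intro computable_comp[OF computable_nat_zero] computable_intros)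
  moreover have "(enc (f x) - enc (g x)) + (enc (g x) - enc (f x)) = 0 \<longleftrightarrow> f x = g x" for x
    by (metis add_is_0 diff_is_0_eq diff_self_eq_0 enc_eq_iff le_antisym)
  ultimately show ?thesis by simp
qed

lemma computable_less [computable_intros]:
  assumes "computable f" "computable g"
  shows "computable (\<lambda>x. f x < (g x :: nat))"
proof -
  have "computable (\<lambda>x. \<not> (g x - f x = 0))" by (intro computable_intros assms)
  then show ?thesis by (simp add: not_le)
qed

lemma computable_rec_nat [computable_intros]:
  assumes "computable h" "computable f" "computable (\<lambda>p. g (fst p) (fst (snd p)) (snd (snd p)))"
  shows "computable (\<lambda>x. rec_nat (f x) (\<lambda>n y. g x n y) (h x))"
proof -
  obtain rh rf rg where r: "\<And>x. eval rh [enc x] (h x)" "\<And>x. eval rf [enc x] (enc (f x))"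
    "\<And>x n y. eval rg [prod_encode (enc x, prod_encode (n, enc y))] (enc (g x n y))"
    using assms unfolding computable_def by (simp, metis fst_conv snd_conv)
  let ?g = "Cn rg [Cn pair_recf [Id 2, Cn pair_recf [Id 0, Id 1]]]"
  have "eval (Pr rf ?g) [n, enc x] (enc (rec_nat (f x) (\<lambda>n y. g x n y) n))" for n x
  proof (induction n)
    case 0
    then show ?case using r(2) by (auto intro: ev_Pr0)
  next
    case (Suc n)
    have "eval ?g [n, enc (rec_nat (f x) (\<lambda>n y. g x n y) n), enc x]
      (enc (g x n (rec_nat (f x) (\<lambda>n y. g x n y) n)))"
      by (rule eval_rules eval_pair_recf r(3))+
    with Suc show ?case by (auto intro: ev_PrS)
  qed
  then have "eval (Cn (Pr rf ?g) [rh, Id 0]) [enc x] (enc (rec_nat (f x) (\<lambda>n y. g x n y) (h x)))" for x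
    by (intro eval_comp2[OF r(1)]) (auto intro: eval_Id)
  then show ?thesis unfolding computable_def by blast
qed

lemma computable_Least:
  assumes "computable (\<lambda>p. P (fst p) (snd p))" "\<And>x. \<exists>n. P x n"
  shows "computable (\<lambda>x. LEAST n::nat. P x n)"
proof -
  \<comment> \<open>\<open>Mn\<close> looks for the value 0, which codes \<open>False\<close>; hence
    the negation.\<close>
  have "computable (\<lambda>p. \<not> P (fst p) (snd p))" by (intro computable_intros assms)
  then obtain r where r: "\<And>x n. eval r [prod_encode (enc x, n)] (if P x n then 0 else 1)"
    unfolding computable_def by (simp, metis fst_conv snd_conv)
  let ?r = "Cn r [Cn pair_recf [Id 1, Id 0]]"
  have r': "eval ?r [n, enc x] (if P x n then 0 else 1)" for x n
    by (rule eval_rules eval_pair_recf r)+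
  have "eval (Mn ?r) [enc x] (LEAST n. P x n)" for x
  proof (rule ev_Mn)
    have "P x (LEAST n. P x n)" by (rule LeastI_ex[OF assms(2)])
    then show "eval ?r [LEAST n. P x n, enc x] 0" using r'[of _ x] by metis
    show "\<forall>m<LEAST n. P x n. \<exists>y. eval ?r [m, enc x] y \<and> y \<noteq> 0"
      using r'[of _ x] not_less_Least by (metis one_neq_zero)
  qed
  then show ?thesis unfolding computable_def enc_nat_def by blast
qed

text \<open>A while loop: the least stopping time is found by minimisation, and the iteration up to
  it is a primitive recursion.\<close>

lemma computable_iterate:
  fixes step :: "'a::encodable \<Rightarrow> 'a"
  assumes "computable step" "computable stop" "computable init"
    and "\<And>x. \<exists>n. stop ((step ^^ n) (init x))"
  shows "computable (\<lambda>x. (step ^^ (LEAST n. stop ((step ^^ n) (init x)))) (init x))"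
proof -
  have eq: "(step ^^ n) y = rec_nat y (\<lambda>_ z. step z) n" for n y
    by (induction n) auto
  show ?thesis unfolding eq
    by (intro computable_intros computable_comp[OF assms(1)] computable_Least
        computable_comp[OF assms(2)] computable_comp[OF assms(3)] assms(4)[unfolded eq])
qed

lemma computable_case_option [computable_intros]:
  fixes d :: "'a::encodable \<Rightarrow> 'b::encodable option"
  assumes "computable f" "computable (\<lambda>p. g (fst p) (snd p))" "computable d"
  shows "computable (\<lambda>x. case d x of None \<Rightarrow> f x | Some y \<Rightarrow> g x y)"
proof -
  define sel :: "'b option \<Rightarrow> 'b" where "sel = (\<lambda>o'. case o' of None \<Rightarrow> undefined | Some y \<Rightarrow> y)"
  have "computable sel"
  proof (rule computable_by_code)
    show "computable (\<lambda>n::nat. if n = 0 then enc (undefined :: 'b) else n - 1)"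
      by (intro computable_intros)
  qed (auto simp: sel_def enc_option_def split: option.split)
  then have "computable (\<lambda>x. if d x = None then f x else g x (sel (d x)))"
    using computable_comp[OF assms(2), of "\<lambda>x. (x, sel (d x))"]
    by (intro computable_intros assms) (simp add: computable_intros computable_comp assms)
  moreover have "(if d x = None then f x else g x (sel (d x))) =
      (case d x of None \<Rightarrow> f x | Some y \<Rightarrow> g x y)" for x
    by (auto simp: sel_def split: option.split)
  ultimately show ?thesis by simp
qed

lemma computable_Some [computable_intros]:
  assumes "computable f" shows "computable (\<lambda>x. Some (f x))"
proof -
  have "computable (Some :: 'b \<Rightarrow> _)"
    by (rule computable_by_code[where g = Suc]) (auto intro: computable_intros simp: enc_option_def)
  then show ?thesis using assms by (rule computable_comp)
qed

lemma computable_Cons [computable_intros]: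
  assumes "computable f" "computable g" shows "computable (\<lambda>x. f x # g x)"
proof -
  have "computable (\<lambda>p. fst p # snd p :: 'b list)"
    by (rule computable_by_code[where g = Suc]) (auto intro: computable_intros)
  from computable_comp[OF this, of "\<lambda>x. (f x, g x)"] show ?thesis
    by (simp add: computable_Pair assms)
qed

lemma computable_case_list [computable_intros]:
  fixes d :: "'a::encodable \<Rightarrow> 'b::encodable list"
  assumes "computable f" "computable (\<lambda>p. g (fst p) (fst (snd p)) (snd (snd p)))" "computable d"
  shows "computable (\<lambda>x. case d x of [] \<Rightarrow> f x | y # ys \<Rightarrow> g x y ys)"
proof -
  define sel :: "'b list \<Rightarrow> ('b \<times> 'b list) option"
    where "sel = (\<lambda>l. case l of [] \<Rightarrow> None | y # ys \<Rightarrow> Some (y, ys))"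
  \<comment> \<open>A list and the option of its head and tail have the same code, so
    \<open>sel\<close> is the identity on codes.\<close>
  have "computable sel"
    by (rule computable_by_code[where g = "\<lambda>x. x"])
      (auto simp: sel_def enc_option_def intro: computable_intros split: list.split)
  then have "computable (\<lambda>x. case sel (d x) of None \<Rightarrow> f x | Some p \<Rightarrow> g x (fst p) (snd p))"
    by (intro computable_intros assms computable_comp[OF \<open>computable sel\<close>])
  moreover have "(case sel (d x) of None \<Rightarrow> f x | Some p \<Rightarrow> g x (fst p) (snd p)) =
      (case d x of [] \<Rightarrow> f x | y # ys \<Rightarrow> g x y ys)" for x
    by (auto simp: sel_def split: list.split)
  ultimately show ?thesis by simp
qed

text \<open>Recursion with two recursive calls per step, run on a machine whose state consists of a stack
  of pending tasks and a stack of values. A task \<open>(True, x)\<close> asks for the value at \<open>x\<close>; a task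
  \<open>(False, x)\<close> combines the two topmost values.\<close>

definition machine_step ::
  "('a \<Rightarrow> ('a \<times> 'a) option) \<Rightarrow> ('a \<Rightarrow> 'b) \<Rightarrow> ('a \<Rightarrow> 'b \<Rightarrow> 'b \<Rightarrow> 'b) \<Rightarrow>
   (bool \<times> 'a) list \<times> 'b list \<Rightarrow> (bool \<times> 'a) list \<times> 'b list" where
  "machine_step calls base comb st =
     (case fst st of [] \<Rightarrow> st
      | t # ts \<Rightarrow>
          if fst t then
            (case calls (snd t) of
               None \<Rightarrow> (ts, base (snd t) # snd st)
             | Some p \<Rightarrow> ((True, fst p) # (True, snd p) # (False, snd t) # ts, snd st))
          else
            (case snd st of [] \<Rightarrow> st
             | v2 # vs \<Rightarrow> (case vs of [] \<Rightarrow> st | v1 # vs' \<Rightarrow> (ts, comb (snd t) v1 v2 # vs'))))"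

text \<open>The measure \<open>m\<close> serves only to show that the machine halts. A function with
  a single recursive call passes the same argument twice; running time is of no concern.\<close>

lemma computable_recursion:
  fixes f :: "'a::encodable \<Rightarrow> 'b::encodable" and m :: "'a \<Rightarrow> nat"
  assumes calls: "computable calls" and base: "computable base"
    and comb: "computable (\<lambda>p. comb (fst p) (fst (snd p)) (snd (snd p)))"
    and dec: "\<And>x y z. calls x = Some (y, z) \<Longrightarrow> m y < m x \<and> m z < m x"
    and None: "\<And>x. calls x = None \<Longrightarrow> f x = base x"
    and Some: "\<And>x y z. calls x = Some (y, z) \<Longrightarrow> f x = comb x (f y) (f z)"
  shows "computable f"
proof -
  let ?step = "machine_step calls base comb"
  have run: "\<exists>n. (?step ^^ n) ((True, x) # ts, vs) = (ts, f x # vs)" for x ts vs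
  proof (induction x arbitrary: ts vs rule: measure_induct_rule[of m])
    case (less x)
    show ?case
    proof (cases "calls x")
      case N: None
      then have "(?step ^^ 1) ((True, x) # ts, vs) = (ts, f x # vs)"
        by (simp add: machine_step_def None)
      then show ?thesis by blast
    next
      case S: (Some p)
      obtain y z where p: "p = (y, z)" by fastforce
      with S have yz: "calls x = Some (y, z)" by simp
      obtain n1 where n1: "(?step ^^ n1) ((True, y) # (True, z) # (False, x) # ts, vs) =
          ((True, z) # (False, x) # ts, f y # vs)"
        using less dec[OF yz] by blast
      obtain n2 where n2: "(?step ^^ n2) ((True, z) # (False, x) # ts, f y # vs) =
          ((False, x) # ts, f z # f y # vs)"
        using less dec[OF yz] by blast
      \<comment> \<open>The value at \<open>z\<close> is computed last and lies on top, so
        \<open>comb\<close> receives the deeper entry first.\<close>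
      have s1: "?step ((True, x) # ts, vs) = ((True, y) # (True, z) # (False, x) # ts, vs)"
        and s2: "?step ((False, x) # ts, f z # f y # vs) = (ts, f x # vs)"
        using yz by (simp_all add: machine_step_def Some)
      have "(?step ^^ (1 + (n2 + (n1 + 1)))) ((True, x) # ts, vs) =
          ?step ((?step ^^ n2) ((?step ^^ n1) (?step ((True, x) # ts, vs))))"
        by (simp only: funpow_add o_apply funpow.simps One_nat_def id_apply)
      also have "\<dots> = (ts, f x # vs)"
        by (simp only: s1 n1 n2 s2)
      finally show ?thesis by blast
    qed
  qed
  let ?init = "\<lambda>x. ([(True, x)], []) :: (bool \<times> 'a) list \<times> 'b list"
  let ?stop = "\<lambda>st :: (bool \<times> 'a) list \<times> 'b list. fst st = []"
  let ?final = "\<lambda>x. (?step ^^ (LEAST n. ?stop ((?step ^^ n) (?init x)))) (?init x)"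
  have comb': "computable (\<lambda>x. comb (a x) (b x) (c x))"
    if "computable a" "computable b" "computable c" for a b c
    using computable_comp[OF comb, of "\<lambda>x. (a x, b x, c x)"] that by (simp add: computable_Pair)
  have step: "computable ?step"
    unfolding machine_step_def
    by (intro computable_intros computable_comp[OF calls] computable_comp[OF base] comb')
  \<comment> \<open>The least stopping time might be smaller than the length of the run; once the
    task stack is empty the machine no longer moves, so both states agree.\<close>
  have final: "?final x = ([], [f x])" for x
  proof -
    obtain n where n: "(?step ^^ n) (?init x) = ([], [f x])"
      using run[of x "[]" "[]"] by blast
    let ?k = "LEAST n. ?stop ((?step ^^ n) (?init x))"
    have stop: "?stop (?final x)" and k: "?k \<le> n"
      using n by (auto intro: LeastI[of "\<lambda>n. ?stop ((?step ^^ n) (?init x))" n] Least_le)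
    have "(?step ^^ j) (?final x) = ?final x" for j
      using stop by (induction j) (simp_all add: machine_step_def)
    moreover have "(?step ^^ n) (?init x) = (?step ^^ (n - ?k)) (?final x)"
      using fun_cong[OF funpow_add[of "n - ?k" ?k ?step], of "?init x"] k
      by (simp only: le_add_diff_inverse2 o_apply)
    ultimately show ?thesis using n by simp
  qed
  have "computable (\<lambda>x. case snd (?final x) of [] \<Rightarrow> base x | v # _ \<Rightarrow> v)"
  proof (intro computable_intros base computable_iterate step)
    show "\<exists>n. ?stop ((?step ^^ n) (?init x))" for x
      using run[of x "[]" "[]"] by (metis fst_conv)
  qed
  then show ?thesis unfolding final by simp
qed


section \<open>Computable functions on lists\<close>

lemma computable_foldl [computable_intros]:
  fixes l :: "'x::encodable \<Rightarrow> 'b::encodable list" and a :: "'x \<Rightarrow> 'c::encodable"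
  assumes h: "computable (\<lambda>p. h (fst p) (fst (snd p)) (snd (snd p)))"
    and a: "computable a" and l: "computable l"
  shows "computable (\<lambda>x. foldl (\<lambda>acc y. h x acc y) (a x) (l x))"
proof -
  define F :: "'x \<times> 'c \<times> 'b list \<Rightarrow> 'c" where "F p = foldl (h (fst p)) (fst (snd p)) (snd (snd p))" for p
  have h': "computable (\<lambda>x. h (u x) (v x) (w x))"
    if "computable u" "computable v" "computable w" for u v and w :: "'d::encodable \<Rightarrow> 'b"
    using computable_comp[OF h, of "\<lambda>x. (u x, v x, w x)"] that by (simp add: computable_Pair)
  define calls :: "'x \<times> 'c \<times> 'b list \<Rightarrow> (('x \<times> 'c \<times> 'b list) \<times> ('x \<times> 'c \<times> 'b list)) option"
    where "calls p = (case snd (snd p) of [] \<Rightarrow> None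
      | y # ys \<Rightarrow> Some ((fst p, h (fst p) (fst (snd p)) y, ys), (fst p, h (fst p) (fst (snd p)) y, ys)))"
    for p
  have "computable F"
  proof (rule computable_recursion[where calls = calls and base = "\<lambda>p. fst (snd p)"
        and comb = "\<lambda>_ v _. v" and m = "\<lambda>p. length (snd (snd p))"])
    show "computable calls" unfolding calls_def by (intro computable_intros h')
  qed (auto simp: calls_def F_def intro!: computable_intros split: list.splits)
  from computable_comp[OF this, of "\<lambda>x. (x, a x, l x)"] show ?thesis
    by (simp add: F_def computable_intros a l)
qed

lemma computable_rev [computable_intros]:
  assumes "computable l" shows "computable (\<lambda>x. rev (l x))"
proof -
  have "computable (\<lambda>x. foldl (\<lambda>acc y. y # acc) [] (l x))"
    by (intro computable_intros assms)
  then show ?thesis by (simp add: foldl_conv_fold rev_conv_fold)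
qed

lemma computable_append [computable_intros]:
  assumes "computable l" "computable k" shows "computable (\<lambda>x. l x @ k x)"
proof -
  have "computable (\<lambda>x. foldl (\<lambda>acc y. y # acc) (k x) (rev (l x)))"
    by (intro computable_intros assms)
  then show ?thesis by (simp add: foldl_conv_fold fold_Cons_rev)
qed

lemma computable_map [computable_intros]:
  assumes "computable (\<lambda>p. f (fst p) (snd p))" "computable l"
  shows "computable (\<lambda>x. map (\<lambda>y. f x y) (l x))"
proof -
  have "foldl (\<lambda>acc y. f x y # acc) acc ys = rev (map (f x) ys) @ acc" for x acc ys
    by (induction ys arbitrary: acc) auto
  moreover have "computable (\<lambda>x. rev (foldl (\<lambda>acc y. f x y # acc) [] (l x)))"
    using computable_comp[OF assms(1), of "\<lambda>p. (fst p, snd (snd p))"]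
    by (intro computable_intros assms) (simp add: computable_intros)
  ultimately show ?thesis by simp
qed

lemma computable_concat [computable_intros]:
  assumes "computable l" shows "computable (\<lambda>x. concat (l x))"
proof -
  have "foldl (@) acc ys = acc @ concat ys" for acc and ys :: "'b list list"
    by (induction ys arbitrary: acc) auto
  moreover have "computable (\<lambda>x. foldl (\<lambda>acc y. acc @ y) [] (l x))"
    by (intro computable_intros assms)
  ultimately show ?thesis by simp
qed

lemma computable_filter [computable_intros]:
  assumes "computable (\<lambda>p. f (fst p) (snd p))" "computable l"
  shows "computable (\<lambda>x. filter (\<lambda>y. f x y) (l x))"
proof -
  have "filter (f x) ys = concat (map (\<lambda>y. if f x y then [y] else []) ys)" for x ys
    by (induction ys) auto
  moreover have "computable (\<lambda>x. concat (map (\<lambda>y. if f x y then [y] else []) (l x)))"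
    by (intro computable_intros assms)
  ultimately show ?thesis by simp
qed

lemma computable_list_all [computable_intros]:
  assumes "computable (\<lambda>p. f (fst p) (snd p))" "computable l"
  shows "computable (\<lambda>x. list_all (\<lambda>y. f x y) (l x))"
proof -
  have "list_all (f x) ys \<longleftrightarrow> filter (\<lambda>y. \<not> f x y) ys = []" for x ys
    by (auto simp: filter_empty_conv list_all_iff)
  moreover have "computable (\<lambda>x. filter (\<lambda>y. \<not> f x y) (l x) = [])"
    by (intro computable_intros assms)
  ultimately show ?thesis by simp
qed

lemma computable_list_ex [computable_intros]:
  assumes "computable (\<lambda>p. f (fst p) (snd p))" "computable l"
  shows "computable (\<lambda>x. list_ex (\<lambda>y. f x y) (l x))"
proof -
  have "list_ex (f x) ys \<longleftrightarrow> \<not> list_all (\<lambda>y. \<not> f x y) ys" for x ys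
    by (auto simp: list_ex_iff list_all_iff)
  moreover have "computable (\<lambda>x. \<not> list_all (\<lambda>y. \<not> f x y) (l x))"
    by (intro computable_intros assms)
  ultimately show ?thesis by simp
qed

lemma computable_map_of [computable_intros]:
  assumes "computable l" "computable k"
  shows "computable (\<lambda>x. map_of (l x) (k x))"
proof -
  have "map_of ys y = (case filter (\<lambda>p. fst p = y) ys of [] \<Rightarrow> None | p # _ \<Rightarrow> Some (snd p))"
    for ys :: "('b \<times> 'c) list" and y
    by (induction ys) (auto split: list.split)
  moreover have "computable (\<lambda>x. case filter (\<lambda>p. fst p = k x) (l x) of
      [] \<Rightarrow> None | p # _ \<Rightarrow> Some (snd p))"
    by (intro computable_intros computable_comp[OF assms(2)] assms)
  ultimately show ?thesis by simp
qed


section \<open>Types and terms as encoded data\<close>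

text \<open>A constructor is encoded as a tag paired with the code of its arguments.\<close>

lemma computable_tagged:
  fixes d :: "'d::encodable \<Rightarrow> 'p::encodable option"
  assumes "\<And>x. enc (d x) = (if fst (prod_decode (enc x)) = k then Suc (snd (prod_decode (enc x))) else 0)"
  shows "computable d"
proof (rule computable_by_code)
  show "computable (\<lambda>n. if fst (prod_decode n) = k then Suc (snd (prod_decode n)) else 0)"
    by (intro computable_intros)
qed (rule assms)

instantiation atom :: encodable
begin
definition enc_atom_inst [simp]: "enc = enc_atom"
instance
proof
  have "enc_atom a = enc_atom b \<Longrightarrow> a = b" for a b
    by (cases a; cases b; simp)
  then show "inj (enc :: atom \<Rightarrow> nat)" by (simp add: inj_def)
qed
end

instantiation ty :: encodable
begin
definition enc_ty_inst [simp]: "enc = enc_ty"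
instance
proof
  have "enc_ty a = enc_ty b \<Longrightarrow> a = b" for a b
    using enc_eq_iff[where 'a = atom]
    by (induction a arbitrary: b) (case_tac b; simp; fail)+
  then show "inj (enc :: ty \<Rightarrow> nat)" by (simp add: inj_def)
qed
end

instantiation dterm :: encodable
begin
definition enc_dterm_inst [simp]: "enc = enc_dterm"
instance
proof
  have "enc_dterm a = enc_dterm b \<Longrightarrow> a = b" for a b
    using enc_eq_iff[where 'a = ty]
    by (induction a arbitrary: b) (case_tac b; simp; fail)+
  then show "inj (enc :: dterm \<Rightarrow> nat)" by (simp add: inj_def)
qed
end

text \<open>The statement fixes codes for types and typed terms only. Pure terms occur as
  intermediate results, so their coding is a free choice.\<close>

fun enc_lterm :: "lterm \<Rightarrow> nat" where
  "enc_lterm (FV x) = prod_encode (0, x)"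
| "enc_lterm (BV i) = prod_encode (1, i)"
| "enc_lterm (Abs s) = prod_encode (2, enc_lterm s)"
| "enc_lterm (App s t) = prod_encode (3, prod_encode (enc_lterm s, enc_lterm t))"

instantiation lterm :: encodable
begin
definition enc_lterm_inst [simp]: "enc = enc_lterm"
instance
proof
  have "enc_lterm a = enc_lterm b \<Longrightarrow> a = b" for a b
    by (induction a arbitrary: b) (case_tac b; simp; fail)+
  then show "inj (enc :: lterm \<Rightarrow> nat)" by (simp add: inj_def)
qed
end


section \<open>Constructors and case distinctions on codes\<close>

lemma computable_Arr [computable_intros]:
  assumes "computable f" "computable g" shows "computable (\<lambda>x. Arr (f x) (g x))"
proof -
  have "computable (\<lambda>p. Arr (fst p) (snd p))"
    by (rule computable_by_code[where g = "\<lambda>n. prod_encode (1, n)"]) (auto intro: computable_intros)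
  from computable_comp[OF this, of "\<lambda>x. (f x, g x)"] show ?thesis
    by (simp add: computable_Pair assms)
qed

lemma computable_Inter [computable_intros]:
  assumes "computable f" "computable g" shows "computable (\<lambda>x. Inter (f x) (g x))"
proof -
  have "computable (\<lambda>p. Inter (fst p) (snd p))"
    by (rule computable_by_code[where g = "\<lambda>n. prod_encode (2, n)"]) (auto intro: computable_intros)
  from computable_comp[OF this, of "\<lambda>x. (f x, g x)"] show ?thesis
    by (simp add: computable_Pair assms)
qed

text \<open>One partial selector per constructor is tried after the other; each merely compares the
  tag. The final \<open>undefined\<close> cannot be reached.\<close>

lemma computable_case_ty [computable_intros]:
  assumes "computable (\<lambda>p. f (fst p) (snd p))"
    "computable (\<lambda>p. g (fst p) (fst (snd p)) (snd (snd p)))"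
    "computable (\<lambda>p. h (fst p) (fst (snd p)) (snd (snd p)))" "computable d"
  shows "computable (\<lambda>x. case d x of Atom a \<Rightarrow> f x a | Arr s t \<Rightarrow> g x s t | Inter s t \<Rightarrow> h x s t)"
proof -
  define d0 where "d0 = (\<lambda>t. case t of Atom a \<Rightarrow> Some a | _ \<Rightarrow> None)"
  define d1 where "d1 = (\<lambda>t. case t of Arr a b \<Rightarrow> Some (a, b) | _ \<Rightarrow> None)"
  define d2 where "d2 = (\<lambda>t. case t of Inter a b \<Rightarrow> Some (a, b) | _ \<Rightarrow> None)"
  have d: "computable d0" "computable d1" "computable d2"
    by (rule computable_tagged[where k = 0] computable_tagged[where k = 1] computable_tagged[where k = 2];
        simp add: d0_def d1_def d2_def enc_option_def split: ty.split)+
  have "computable (\<lambda>x. case d0 (d x) of Some a \<Rightarrow> f x a | None \<Rightarrow>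
      case d1 (d x) of Some p \<Rightarrow> g x (fst p) (snd p) | None \<Rightarrow>
      case d2 (d x) of Some p \<Rightarrow> h x (fst p) (snd p) | None \<Rightarrow> undefined)"
    by (intro computable_intros assms d[THEN computable_comp])
  moreover have "(case d0 t of Some a \<Rightarrow> f x a | None \<Rightarrow>
      case d1 t of Some p \<Rightarrow> g x (fst p) (snd p) | None \<Rightarrow>
      case d2 t of Some p \<Rightarrow> h x (fst p) (snd p) | None \<Rightarrow> undefined) =
    (case t of Atom a \<Rightarrow> f x a | Arr s t \<Rightarrow> g x s t | Inter s t \<Rightarrow> h x s t)" for t x
    by (auto simp: d0_def d1_def d2_def split: ty.split)
  ultimately show ?thesis by simp
qed

lemma computable_U [computable_intros]:
  assumes "computable f" shows "computable (\<lambda>x. U (f x))"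
proof -
  have "computable U"
    by (rule computable_by_code[where g = "\<lambda>n. prod_encode (0, n)"]) (auto intro: computable_intros)
  then show ?thesis using assms by (rule computable_comp)
qed

lemma computable_Lam [computable_intros]:
  assumes "computable f" "computable g" "computable h"
  shows "computable (\<lambda>x. Lam (f x) (g x) (h x))"
proof -
  have "computable (\<lambda>p. Lam (fst p) (fst (snd p)) (snd (snd p)))"
    by (rule computable_by_code[where g = "\<lambda>n. prod_encode (2, n)"]) (auto intro: computable_intros)
  from computable_comp[OF this, of "\<lambda>x. (f x, g x, h x)"] show ?thesis
    by (simp add: computable_Pair assms)
qed

lemma computable_Ap [computable_intros]:
  assumes "computable f" "computable g" shows "computable (\<lambda>x. Ap (f x) (g x))"
proof -
  have "computable (\<lambda>p. Ap (fst p) (snd p))"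
    by (rule computable_by_code[where g = "\<lambda>n. prod_encode (3, n)"]) (auto intro: computable_intros)
  from computable_comp[OF this, of "\<lambda>x. (f x, g x)"] show ?thesis
    by (simp add: computable_Pair assms)
qed

lemma computable_dterm_Pair [computable_intros]:
  assumes "computable f" "computable g" shows "computable (\<lambda>x. dterm.Pair (f x) (g x))"
proof -
  have "computable (\<lambda>p. dterm.Pair (fst p) (snd p))"
    by (rule computable_by_code[where g = "\<lambda>n. prod_encode (4, n)"]) (auto intro: computable_intros)
  from computable_comp[OF this, of "\<lambda>x. (f x, g x)"] show ?thesis
    by (simp add: computable_Pair assms)
qed

lemma computable_case_dterm [computable_intros]:
  assumes "computable (\<lambda>p. f0 (fst p) (snd p))" "computable (\<lambda>p. f1 (fst p) (snd p))"
    "computable (\<lambda>p. f2 (fst p) (fst (snd p)) (fst (snd (snd p))) (snd (snd (snd p))))"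
    "computable (\<lambda>p. f3 (fst p) (fst (snd p)) (snd (snd p)))"
    "computable (\<lambda>p. f4 (fst p) (fst (snd p)) (snd (snd p)))"
    "computable (\<lambda>p. f5 (fst p) (snd p))" "computable (\<lambda>p. f6 (fst p) (snd p))"
    "computable (\<lambda>p. f7 (fst p) (fst (snd p)) (snd (snd p)))" "computable d"
  shows "computable (\<lambda>x. case d x of U D \<Rightarrow> f0 x D | Var y \<Rightarrow> f1 x y | Lam y s D \<Rightarrow> f2 x y s D
    | Ap D E \<Rightarrow> f3 x D E | dterm.Pair D E \<Rightarrow> f4 x D E | Pr1 D \<Rightarrow> f5 x D | Pr2 D \<Rightarrow> f6 x D
    | Coer D s \<Rightarrow> f7 x D s)"
proof -
  define d0 where "d0 = (\<lambda>t. case t of U D \<Rightarrow> Some D | _ \<Rightarrow> None)"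
  define d1 where "d1 = (\<lambda>t. case t of Var y \<Rightarrow> Some y | _ \<Rightarrow> None)"
  define d2 where "d2 = (\<lambda>t. case t of Lam y s D \<Rightarrow> Some (y, s, D) | _ \<Rightarrow> None)"
  define d3 where "d3 = (\<lambda>t. case t of Ap D E \<Rightarrow> Some (D, E) | _ \<Rightarrow> None)"
  define d4 where "d4 = (\<lambda>t. case t of dterm.Pair D E \<Rightarrow> Some (D, E) | _ \<Rightarrow> None)"
  define d5 where "d5 = (\<lambda>t. case t of Pr1 D \<Rightarrow> Some D | _ \<Rightarrow> None)"
  define d6 where "d6 = (\<lambda>t. case t of Pr2 D \<Rightarrow> Some D | _ \<Rightarrow> None)"
  define d7 where "d7 = (\<lambda>t. case t of Coer D s \<Rightarrow> Some (D, s) | _ \<Rightarrow> None)"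
  note d_defs = d0_def d1_def d2_def d3_def d4_def d5_def d6_def d7_def
  have d: "computable d0" "computable d1" "computable d2" "computable d3" "computable d4"
    "computable d5" "computable d6" "computable d7"
    by (rule computable_tagged[where k = 0], simp add: d_defs enc_option_def split: dterm.split,
        rule computable_tagged[where k = 1], simp add: d_defs enc_option_def split: dterm.split,
        rule computable_tagged[where k = 2], simp add: d_defs enc_option_def split: dterm.split,
        rule computable_tagged[where k = 3], simp add: d_defs enc_option_def split: dterm.split,
        rule computable_tagged[where k = 4], simp add: d_defs enc_option_def split: dterm.split,
        rule computable_tagged[where k = 5], simp add: d_defs enc_option_def split: dterm.split,
        rule computable_tagged[where k = 6], simp add: d_defs enc_option_def split: dterm.split,
        rule computable_tagged[where k = 7], simp add: d_defs enc_option_def split: dterm.split)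
  let ?case = "\<lambda>x t. case d0 t of Some D \<Rightarrow> f0 x D | None \<Rightarrow>
      case d1 t of Some y \<Rightarrow> f1 x y | None \<Rightarrow>
      case d2 t of Some p \<Rightarrow> f2 x (fst p) (fst (snd p)) (snd (snd p)) | None \<Rightarrow>
      case d3 t of Some p \<Rightarrow> f3 x (fst p) (snd p) | None \<Rightarrow>
      case d4 t of Some p \<Rightarrow> f4 x (fst p) (snd p) | None \<Rightarrow>
      case d5 t of Some D \<Rightarrow> f5 x D | None \<Rightarrow>
      case d6 t of Some D \<Rightarrow> f6 x D | None \<Rightarrow>
      case d7 t of Some p \<Rightarrow> f7 x (fst p) (snd p) | None \<Rightarrow> undefined"
  have "computable (\<lambda>x. ?case x (d x))"
    by (intro computable_intros assms d[THEN computable_comp])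
  moreover have "?case x t =
     (case t of U D \<Rightarrow> f0 x D | Var y \<Rightarrow> f1 x y | Lam y s D \<Rightarrow> f2 x y s D
    | Ap D E \<Rightarrow> f3 x D E | dterm.Pair D E \<Rightarrow> f4 x D E | Pr1 D \<Rightarrow> f5 x D | Pr2 D \<Rightarrow> f6 x D
    | Coer D s \<Rightarrow> f7 x D s)" for t x
    by (cases t) (simp_all add: d_defs)
  ultimately show ?thesis by simp
qed

lemma computable_FV [computable_intros]:
  assumes "computable f" shows "computable (\<lambda>x. FV (f x))"
proof -
  have "computable FV"
    by (rule computable_by_code[where g = "\<lambda>n. prod_encode (0, n)"]) (auto intro: computable_intros)
  then show ?thesis using assms by (rule computable_comp)
qed

lemma computable_BV [computable_intros]:
  assumes "computable f" shows "computable (\<lambda>x. BV (f x))"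
proof -
  have "computable BV"
    by (rule computable_by_code[where g = "\<lambda>n. prod_encode (1, n)"]) (auto intro: computable_intros)
  then show ?thesis using assms by (rule computable_comp)
qed

lemma computable_Abs [computable_intros]:
  assumes "computable f" shows "computable (\<lambda>x. Abs (f x))"
proof -
  have "computable Abs"
    by (rule computable_by_code[where g = "\<lambda>n. prod_encode (2, n)"]) (auto intro: computable_intros)
  then show ?thesis using assms by (rule computable_comp)
qed

lemma computable_App [computable_intros]:
  assumes "computable f" "computable g" shows "computable (\<lambda>x. App (f x) (g x))"
proof -
  have "computable (\<lambda>p. App (fst p) (snd p))"
    by (rule computable_by_code[where g = "\<lambda>n. prod_encode (3, n)"]) (auto intro: computable_intros)
  from computable_comp[OF this, of "\<lambda>x. (f x, g x)"] show ?thesis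
    by (simp add: computable_Pair assms)
qed

lemma computable_case_lterm [computable_intros]:
  assumes "computable (\<lambda>p. f0 (fst p) (snd p))" "computable (\<lambda>p. f1 (fst p) (snd p))"
    "computable (\<lambda>p. f2 (fst p) (snd p))"
    "computable (\<lambda>p. f3 (fst p) (fst (snd p)) (snd (snd p)))" "computable d"
  shows "computable (\<lambda>x. case d x of FV y \<Rightarrow> f0 x y | BV i \<Rightarrow> f1 x i | Abs s \<Rightarrow> f2 x s
    | App s t \<Rightarrow> f3 x s t)"
proof -
  define d0 where "d0 = (\<lambda>t. case t of FV y \<Rightarrow> Some y | _ \<Rightarrow> None)"
  define d1 where "d1 = (\<lambda>t. case t of BV i \<Rightarrow> Some i | _ \<Rightarrow> None)"
  define d2 where "d2 = (\<lambda>t. case t of Abs s \<Rightarrow> Some s | _ \<Rightarrow> None)"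
  define d3 where "d3 = (\<lambda>t. case t of App s t \<Rightarrow> Some (s, t) | _ \<Rightarrow> None)"
  note d_defs = d0_def d1_def d2_def d3_def
  have d: "computable d0" "computable d1" "computable d2" "computable d3"
    by (rule computable_tagged[where k = 0], simp add: d_defs enc_option_def split: lterm.split,
        rule computable_tagged[where k = 1], simp add: d_defs enc_option_def split: lterm.split,
        rule computable_tagged[where k = 2], simp add: d_defs enc_option_def split: lterm.split,
        rule computable_tagged[where k = 3], simp add: d_defs enc_option_def split: lterm.split)
  let ?case = "\<lambda>x t. case d0 t of Some y \<Rightarrow> f0 x y | None \<Rightarrow>
      case d1 t of Some i \<Rightarrow> f1 x i | None \<Rightarrow>
      case d2 t of Some s \<Rightarrow> f2 x s | None \<Rightarrow>
      case d3 t of Some p \<Rightarrow> f3 x (fst p) (snd p) | None \<Rightarrow> undefined"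
  have "computable (\<lambda>x. ?case x (d x))"
    by (intro computable_intros assms d[THEN computable_comp])
  moreover have "?case x t = (case t of FV y \<Rightarrow> f0 x y | BV i \<Rightarrow> f1 x i | Abs s \<Rightarrow> f2 x s
    | App s t \<Rightarrow> f3 x s t)" for t x
    by (cases t) (simp_all add: d_defs)
  ultimately show ?thesis by simp
qed

lemma enc_basis_eq: "enc_basis B = enc B"
  by (induction B rule: enc_basis.induct) simp_all


section \<open>Lifting and substitution\<close>

lemma lift_lift: "i \<le> k \<Longrightarrow> lift (lift t i) (Suc k) = lift (lift t k) i"
  by (induction t arbitrary: i k) auto

lemma subst_lift [simp]: "subst (lift t k) s k = t"
  by (induction t arbitrary: s k) auto

lemma lift_inject [simp]: "lift s k = lift t k \<longleftrightarrow> s = t"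
  by (metis subst_lift)

lemma lift_subst: "j \<le> i \<Longrightarrow> lift (subst t s j) i = subst (lift t (Suc i)) (lift s i) j"
  by (induction t arbitrary: i j s) (auto simp: lift_lift)

lemma lift_subst_le: "i \<le> j \<Longrightarrow> lift (subst t s j) i = subst (lift t i) (lift s i) (Suc j)"
  by (induction t arbitrary: i j s) (auto simp: lift_lift)

lemma subst_subst:
  "i \<le> j \<Longrightarrow> subst (subst t (lift v i) (Suc j)) (subst u v j) i = subst (subst t u i) v j"
  by (induction t arbitrary: i j u v) (auto simp: lift_lift[symmetric] lift_subst_le)

lemma lift_eq_Abs: "lift s k = Abs r \<longleftrightarrow> (\<exists>s'. s = Abs s' \<and> lift s' (Suc k) = r)"
  by (cases s) auto

lemma lift_eq_App: "lift s k = App r t \<longleftrightarrow> (\<exists>s1 s2. s = App s1 s2 \<and> lift s1 k = r \<and> lift s2 k = t)"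
  by (cases s) auto

lemma lift_eq_BV: "i < k \<Longrightarrow> lift s k = BV i \<longleftrightarrow> s = BV i"
  by (cases s) auto

lemma subst_FV_eq_Abs: "subst s (FV x) k = Abs r \<longleftrightarrow> (\<exists>s'. s = Abs s' \<and> subst s' (FV x) (Suc k) = r)"
  by (cases s) auto

lemma subst_FV_eq_App:
  "subst s (FV x) k = App r t \<longleftrightarrow> (\<exists>s1 s2. s = App s1 s2 \<and> subst s1 (FV x) k = r \<and> subst s2 (FV x) k = t)"
  by (cases s) auto

lemma subst_FV_eq_BV: "i < k \<Longrightarrow> subst s (FV x) k = BV i \<longleftrightarrow> s = BV i"
  by (cases s) auto

lemma loose_lift_same [simp]: "\<not> loose (lift s k) k"
  by (induction s arbitrary: k) auto

lemma loose_lift_less: "j < k \<Longrightarrow> loose (lift s k) j \<longleftrightarrow> loose s j"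
  by (induction s arbitrary: j k) auto

lemma loose_subst_FV_less: "j < k \<Longrightarrow> loose (subst s (FV x) k) j \<longleftrightarrow> loose s j"
  by (induction s arbitrary: j k) auto

text \<open>Turns the side condition of \<open>eta\<close> into an equation: a term without loose
  index \<open>k\<close> is a lift at \<open>k\<close>, and any substitution for \<open>k\<close>
  recovers the term that was lifted.\<close>

lemma not_loose_imp_lift: "\<not> loose s k \<Longrightarrow> lift (subst s u k) k = s"
  by (induction s arbitrary: u k) auto

section \<open>Reduction steps under lifting and substitution, and their inversion\<close>

inductive_cases beta_FVE: "beta (FV x) t"
inductive_cases beta_BVE: "beta (BV i) t"
inductive_cases beta_AbsE: "beta (Abs s) t"

lemma beta_AppE:
  assumes "beta (App s u) t"
  obtains (redex) p where "s = Abs p" "t = subst p u 0" | (left) s' where "t = App s' u" "beta s s'"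
    | (right) u' where "t = App s u'" "beta u u'"
  using assms by cases auto

inductive_cases eta_FVE: "eta (FV x) t"
inductive_cases eta_BVE: "eta (BV i) t"

lemma eta_AppE:
  assumes "eta (App s u) t"
  obtains (left) s' where "t = App s' u" "eta s s'" | (right) u' where "t = App s u'" "eta u u'"
  using assms by cases auto

lemma eta_redex: "eta (Abs (App (lift p 0) (BV 0))) p"
  using e_redex[of "lift p 0"] by simp

lemma eta_AbsE:
  assumes "eta (Abs s) t"
  obtains (redex) "s = App (lift t 0) (BV 0)" | (abs) s' where "t = Abs s'" "eta s s'"
  using assms
proof cases
  case (e_redex r)
  then show ?thesis using redex not_loose_imp_lift[of r 0 "BV 0"] by simp
qed (auto intro: abs)

lemma beta_lift: "beta s t \<Longrightarrow> beta (lift s k) (lift t k)"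
  by (induction arbitrary: k rule: beta.induct) (auto simp: lift_subst intro: beta.intros)

lemma eta_lift: "eta s t \<Longrightarrow> eta (lift s k) (lift t k)"
proof (induction arbitrary: k rule: eta.induct)
  case (e_redex s)
  then show ?case
    using eta_redex[of "lift (subst s (BV 0) 0) k"] not_loose_imp_lift[of s 0 "BV 0"]
    by (simp add: lift_lift[symmetric])
qed (auto intro: eta.intros)

lemma beta_subst: "beta s t \<Longrightarrow> beta (subst s u k) (subst t u k)"
  by (induction arbitrary: u k rule: beta.induct) (auto simp: subst_subst[symmetric] intro: beta.intros)

lemma eta_subst: "eta s t \<Longrightarrow> eta (subst s u k) (subst t u k)"
proof (induction arbitrary: u k rule: eta.induct)
  case (e_redex s)
  then show ?case
    using eta_redex[of "subst (subst s (BV 0) 0) u k"] not_loose_imp_lift[of s 0 "BV 0"]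
    by (simp add: lift_subst_le)
qed (auto intro: eta.intros)

text \<open>Lifting creates no redexes, so the function part of an eta redex is still a lift after a
  step inside it.\<close>

lemma beta_lift_inv: "beta (lift s k) t \<Longrightarrow> \<exists>t'. t = lift t' k \<and> beta s t'"
proof (induction s arbitrary: k t)
  case (Abs s)
  from Abs.prems obtain r where "t = Abs r" "beta (lift s (Suc k)) r"
    by (auto elim: beta_AbsE)
  with Abs.IH show ?case by (metis b_abs lift.simps(3))
next
  case (App s1 s2)
  from App.prems have "beta (App (lift s1 k) (lift s2 k)) t" by simp
  then show ?case
  proof (cases rule: beta_AppE)
    case (redex p)
    then obtain p' where "s1 = Abs p'" "p = lift p' (Suc k)" by (auto simp: lift_eq_Abs)
    with redex show ?thesis by (metis lift_subst b_redex zero_le)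
  next
    case (left r)
    with App.IH(1) show ?thesis by (metis b_appL lift.simps(4))
  next
    case (right r)
    with App.IH(2) show ?thesis by (metis b_appR lift.simps(4))
  qed
qed (auto elim: beta_FVE beta_BVE split: if_splits)

lemma eta_lift_inv: "eta (lift s k) t \<Longrightarrow> \<exists>t'. t = lift t' k \<and> eta s t'"
proof (induction s arbitrary: k t)
  case (Abs s)
  from Abs.prems have "eta (Abs (lift s (Suc k))) t" by simp
  then show ?case
  proof (cases rule: eta_AbsE)
    case redex
    then obtain q where q: "s = App q (BV 0)" "lift q (Suc k) = lift t 0"
      by (auto simp: lift_eq_App lift_eq_BV)
    \<comment> \<open>Lifting \<open>q\<close> at \<open>Suc k\<close> gives
      \<open>lift t 0\<close>, so index 0 is absent from \<open>q\<close> already: the eta redex was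
      present before lifting.\<close>
    then have "\<not> loose q 0" by (metis loose_lift_less loose_lift_same zero_less_Suc)
    then obtain q' where q': "q = lift q' 0" by (metis not_loose_imp_lift)
    with q have "t = lift q' k" by (simp add: lift_lift)
    with q q' show ?thesis using eta_redex by blast
  next
    case (abs r)
    with Abs.IH show ?thesis by (metis e_abs lift.simps(3))
  qed
next
  case (App s1 s2)
  from App.prems have "eta (App (lift s1 k) (lift s2 k)) t" by simp
  then show ?case
  proof (cases rule: eta_AppE)
    case (left r)
    with App.IH(1) show ?thesis by (metis e_appL lift.simps(4))
  next
    case (right r)
    with App.IH(2) show ?thesis by (metis e_appR lift.simps(4))
  qed
qed (auto elim: eta_FVE eta_BVE split: if_splits)

text \<open>Replacing an index by a variable creates no redexes, which fails for arbitrary terms in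
  place of the variable. Normal forms of such an instance can thus be pulled back to the open
  body.\<close>

lemma beta_subst_FV_inv: "beta (subst s (FV x) k) t \<Longrightarrow> \<exists>t'. t = subst t' (FV x) k \<and> beta s t'"
proof (induction s arbitrary: k t)
  case (Abs s)
  from Abs.prems obtain r where "t = Abs r" "beta (subst s (FV x) (Suc k)) r"
    by (auto elim: beta_AbsE)
  with Abs.IH show ?case by (metis b_abs lift.simps(1) subst.simps(3))
next
  case (App s1 s2)
  from App.prems have "beta (App (subst s1 (FV x) k) (subst s2 (FV x) k)) t" by simp
  then show ?case
  proof (cases rule: beta_AppE)
    case (redex p)
    then obtain p' where "s1 = Abs p'" "p = subst p' (FV x) (Suc k)" by (metis subst_FV_eq_Abs)
    with redex show ?thesis
      using subst_subst[of 0 k p' "FV x" s2] b_redex[of p' s2] by auto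
  next
    case (left r)
    with App.IH(1) show ?thesis by (metis b_appL subst.simps(4))
  next
    case (right r)
    with App.IH(2) show ?thesis by (metis b_appR subst.simps(4))
  qed
qed (auto elim: beta_FVE beta_BVE split: if_splits)

lemma eta_subst_FV_inv: "eta (subst s (FV x) k) t \<Longrightarrow> \<exists>t'. t = subst t' (FV x) k \<and> eta s t'"
proof (induction s arbitrary: k t)
  case (Abs s)
  from Abs.prems have "eta (Abs (subst s (FV x) (Suc k))) t" by simp
  then show ?case
  proof (cases rule: eta_AbsE)
    case redex
    then obtain q where q: "s = App q (BV 0)" "subst q (FV x) (Suc k) = lift t 0"
      by (auto simp: subst_FV_eq_App subst_FV_eq_BV)
    then have "\<not> loose q 0" by (metis loose_subst_FV_less loose_lift_same zero_less_Suc)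
    then obtain q' where q': "q = lift q' 0" by (metis not_loose_imp_lift)
    with q have "lift (subst q' (FV x) k) 0 = lift t 0"
      using lift_subst_le[of 0 k q' "FV x"] by simp
    then have "t = subst q' (FV x) k" by simp
    with q q' show ?thesis using eta_redex by blast
  next
    case (abs r)
    with Abs.IH show ?thesis by (metis e_abs lift.simps(1) subst.simps(3))
  qed
next
  case (App s1 s2)
  from App.prems have "eta (App (subst s1 (FV x) k) (subst s2 (FV x) k)) t" by simp
  then show ?case
  proof (cases rule: eta_AppE)
    case (left r)
    with App.IH(1) show ?thesis by (metis e_appL subst.simps(4))
  next
    case (right r)
    with App.IH(2) show ?thesis by (metis e_appR subst.simps(4))
  qed
qed (auto elim: eta_FVE eta_BVE split: if_splits)


section \<open>Confluence\<close>

lemma rtranclp_map: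
  assumes "r\<^sup>*\<^sup>* x y" "\<And>x y. r x y \<Longrightarrow> q (f x) (f y)"
  shows "q\<^sup>*\<^sup>* (f x) (f y)"
  using assms(1) by induction (auto intro: rtranclp.rtrancl_into_rtrancl assms(2))

text \<open>Parallel reduction of Tait and Martin-Loef: its reflexive transitive closure is that of
  \<open>beta\<close>, but it has the diamond property.\<close>

inductive pbeta :: "lterm \<Rightarrow> lterm \<Rightarrow> bool" where
  pb_FV: "pbeta (FV x) (FV x)"
| pb_BV: "pbeta (BV i) (BV i)"
| pb_Abs: "pbeta s t \<Longrightarrow> pbeta (Abs s) (Abs t)"
| pb_App: "pbeta s s' \<Longrightarrow> pbeta t t' \<Longrightarrow> pbeta (App s t) (App s' t')"
| pb_redex: "pbeta s s' \<Longrightarrow> pbeta t t' \<Longrightarrow> pbeta (App (Abs s) t) (subst s' t' 0)"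

inductive_cases pbeta_AbsE: "pbeta (Abs s) t"

lemma pbeta_refl [simp]: "pbeta s s"
  by (induction s) (auto intro: pbeta.intros)

lemma beta_imp_pbeta: "beta s t \<Longrightarrow> pbeta s t"
  by (induction rule: beta.induct) (auto intro: pbeta.intros)

lemma beta_rtranclp_Abs: "beta\<^sup>*\<^sup>* s t \<Longrightarrow> beta\<^sup>*\<^sup>* (Abs s) (Abs t)"
  by (rule rtranclp_map[of beta]) (auto intro: beta.intros)

lemma beta_rtranclp_App:
  assumes "beta\<^sup>*\<^sup>* s s'" "beta\<^sup>*\<^sup>* t t'" shows "beta\<^sup>*\<^sup>* (App s t) (App s' t')"
proof -
  have "beta\<^sup>*\<^sup>* (App s t) (App s' t)"
    using assms(1) by (rule rtranclp_map[of beta _ _ _ "\<lambda>s. App s t"]) (rule b_appL)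
  also have "beta\<^sup>*\<^sup>* (App s' t) (App s' t')"
    using assms(2) by (rule rtranclp_map) (rule b_appR)
  finally show ?thesis .
qed

lemma pbeta_imp_beta: "pbeta s t \<Longrightarrow> beta\<^sup>*\<^sup>* s t"
proof (induction rule: pbeta.induct)
  case (pb_redex s s' t t')
  have "beta\<^sup>*\<^sup>* (App (Abs s) t) (App (Abs s') t')"
    by (intro beta_rtranclp_App beta_rtranclp_Abs pb_redex.IH)
  then show ?case by (rule rtranclp.rtrancl_into_rtrancl) (rule b_redex)
qed (auto intro: beta_rtranclp_App beta_rtranclp_Abs)

lemma pbeta_lift: "pbeta s t \<Longrightarrow> pbeta (lift s k) (lift t k)"
  by (induction arbitrary: k rule: pbeta.induct) (auto simp: lift_subst intro: pbeta.intros)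

lemma pbeta_subst: "pbeta s s' \<Longrightarrow> pbeta t t' \<Longrightarrow> pbeta (subst s t k) (subst s' t' k)"
proof (induction arbitrary: t t' k rule: pbeta.induct)
  case (pb_redex s s' u u')
  have "pbeta (subst (App (Abs s) u) t k)
      (subst (subst s' (lift t' 0) (Suc k)) (subst u' t' k) 0)"
    using pb_redex by (auto intro!: pbeta.pb_redex pbeta_lift)
  then show ?case by (simp add: subst_subst)
qed (auto intro: pbeta.intros simp: pbeta_lift)

text \<open>Takahashi's complete development: all redexes present in the term are contracted at
  once.\<close>

fun complete_dev :: "lterm \<Rightarrow> lterm" where
  "complete_dev (FV x) = FV x"
| "complete_dev (BV i) = BV i"
| "complete_dev (Abs s) = Abs (complete_dev s)"
| "complete_dev (App (Abs s) t) = subst (complete_dev s) (complete_dev t) 0"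
| "complete_dev (App s t) = App (complete_dev s) (complete_dev t)"

text \<open>Triangle property: the target depends on \<open>s\<close> alone, so any two parallel
  reducts of \<open>s\<close> meet there.\<close>

lemma pbeta_complete_dev: "pbeta s t \<Longrightarrow> pbeta t (complete_dev s)"
proof (induction rule: pbeta.induct)
  case (pb_App s s' t t')
  show ?case
  proof (cases s)
    case (Abs r)
    with pb_App.hyps(1) obtain r' where r': "s' = Abs r'" by (auto elim: pbeta_AbsE)
    with pb_App.IH(1) Abs have "pbeta r' (complete_dev r)" by (auto elim: pbeta_AbsE)
    with r' Abs pb_App.IH(2) show ?thesis by (auto intro: pbeta.pb_redex)
  qed (use pb_App.IH in \<open>auto intro: pbeta.pb_App\<close>)
qed (auto intro: pbeta.intros pbeta_subst)

lemma confluentp_beta: "confluentp beta"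
proof -
  have "strong_confluentp pbeta"
    using pbeta_complete_dev by (metis strong_confluentpI r_into_rtranclp sup2CI)
  then have "confluentp pbeta" by (rule strong_confluentp_imp_confluentp)
  moreover have "pbeta\<^sup>*\<^sup>* = beta\<^sup>*\<^sup>*"
    using rtranclp_subset[of beta pbeta] beta_imp_pbeta pbeta_imp_beta by blast
  ultimately show ?thesis by (metis confluentp_conv_strong_confluentp_rtranclp)
qed

text \<open>The only genuine overlap is an eta redex with a step inside its function part. As eta
  copies nothing, at most one step closes each side, which gives strong confluence.\<close>

lemma eta_square:
  "eta s t \<Longrightarrow> eta s u \<Longrightarrow> \<exists>v. eta\<^sup>=\<^sup>= t v \<and> eta\<^sup>=\<^sup>= u v"
proof (induction s arbitrary: t u)
  case (Abs s)
  have redex_abs: "\<exists>v. eta\<^sup>=\<^sup>= p v \<and> eta\<^sup>=\<^sup>= (Abs s') v"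
    if "s = App (lift p 0) (BV 0)" "eta s s'" for p s'
  proof -
    from that have "eta (App (lift p 0) (BV 0)) s'" by simp
    then obtain p' where "s' = App (lift p' 0) (BV 0)" "eta p p'"
      by (auto elim!: eta_AppE eta_BVE dest: eta_lift_inv)
    then show ?thesis using eta_redex by blast
  qed
  from Abs.prems(1) show ?case
  proof (cases rule: eta_AbsE)
    case t: redex
    from Abs.prems(2) show ?thesis
    proof (cases rule: eta_AbsE)
      case redex
      with t show ?thesis by auto
    next
      case (abs s')
      with t redex_abs show ?thesis by blast
    qed
  next
    case t: (abs s')
    from Abs.prems(2) show ?thesis
    proof (cases rule: eta_AbsE)
      case redex
      with t redex_abs show ?thesis by blast
    next
      case (abs s'')
      with t Abs.IH obtain v where "eta\<^sup>=\<^sup>= s' v" "eta\<^sup>=\<^sup>= s'' v" by blast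
      then have "eta\<^sup>=\<^sup>= (Abs s') (Abs v)" "eta\<^sup>=\<^sup>= (Abs s'') (Abs v)" by (auto intro: e_abs)
      with t abs show ?thesis by blast
    qed
  qed
next
  case (App s1 s2)
  from App.prems(1) show ?case
  proof (cases rule: eta_AppE)
    case (left t1)
    note t = this
    from App.prems(2) show ?thesis
    proof (cases rule: eta_AppE)
      case (left u1)
      with t App.IH(1) obtain v where "eta\<^sup>=\<^sup>= t1 v" "eta\<^sup>=\<^sup>= u1 v" by blast
      then have "eta\<^sup>=\<^sup>= (App t1 s2) (App v s2)" "eta\<^sup>=\<^sup>= (App u1 s2) (App v s2)"
        by (auto intro: e_appL)
      with t left show ?thesis by blast
    next
      case (right u2)
      with t show ?thesis by (metis e_appL e_appR sup2CI)
    qed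
  next
    case (right t2)
    note t = this
    from App.prems(2) show ?thesis
    proof (cases rule: eta_AppE)
      case (left u1)
      with t show ?thesis by (metis e_appL e_appR sup2CI)
    next
      case (right u2)
      with t App.IH(2) obtain v where "eta\<^sup>=\<^sup>= t2 v" "eta\<^sup>=\<^sup>= u2 v" by blast
      then have "eta\<^sup>=\<^sup>= (App s1 t2) (App s1 v)" "eta\<^sup>=\<^sup>= (App s1 u2) (App s1 v)"
        by (auto intro: e_appR)
      with t right show ?thesis by blast
    qed
  qed
qed (auto elim: eta_FVE eta_BVE)

lemma confluentp_eta: "confluentp eta"
proof (rule strong_confluentp_imp_confluentp, rule strong_confluentpI)
  fix s t u assume "eta s t" "eta s u"
  then obtain v where "eta\<^sup>=\<^sup>= t v" "eta\<^sup>=\<^sup>= u v" using eta_square by blast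
  then show "\<exists>v. eta\<^sup>*\<^sup>* t v \<and> eta\<^sup>=\<^sup>= u v" by blast
qed

lemma eta_rtranclp_Abs: "eta\<^sup>*\<^sup>* s t \<Longrightarrow> eta\<^sup>*\<^sup>* (Abs s) (Abs t)"
  by (rule rtranclp_map[of eta]) (auto intro: eta.intros)

lemma eta_rtranclp_App:
  assumes "eta\<^sup>*\<^sup>* s s'" "eta\<^sup>*\<^sup>* t t'" shows "eta\<^sup>*\<^sup>* (App s t) (App s' t')"
proof -
  have "eta\<^sup>*\<^sup>* (App s t) (App s' t)"
    using assms(1) by (rule rtranclp_map[of eta _ _ _ "\<lambda>s. App s t"]) (rule e_appL)
  also have "eta\<^sup>*\<^sup>* (App s' t) (App s' t')"
    using assms(2) by (rule rtranclp_map) (rule e_appR)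
  finally show ?thesis .
qed

text \<open>The substituted term may occur any number of times, hence many steps.\<close>

lemma eta_subst_arg: "eta t t' \<Longrightarrow> eta\<^sup>*\<^sup>* (subst s t k) (subst s t' k)"
proof (induction s arbitrary: t t' k)
  case (Abs s)
  then show ?case by (simp add: eta_rtranclp_Abs eta_lift)
qed (auto intro: eta_rtranclp_App)

text \<open>Beta may copy or erase an eta redex, but eta never copies a beta redex; hence many eta
  steps on one side and at most one beta step on the other. Where the two redexes overlap, both
  contractions give the same term.\<close>

lemma beta_eta_square:
  "beta s t \<Longrightarrow> eta s u \<Longrightarrow> \<exists>v. eta\<^sup>*\<^sup>* t v \<and> beta\<^sup>=\<^sup>= u v"
proof (induction arbitrary: u rule: beta.induct)
  case (b_redex s t)
  from b_redex.prems show ?case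
  proof (cases rule: eta_AppE)
    case (left r)
    from left(2) show ?thesis
    proof (cases rule: eta_AbsE)
      case redex
      with left show ?thesis by auto
    next
      case (abs s')
      have "eta (subst s t 0) (subst s' t 0)" using abs(2) by (rule eta_subst)
      with left abs show ?thesis using beta.b_redex by blast
    qed
  next
    case (right t')
    then have "eta\<^sup>*\<^sup>* (subst s t 0) (subst s t' 0)" by (auto intro: eta_subst_arg)
    with right show ?thesis using beta.b_redex by blast
  qed
next
  case (b_appL s t w)
  from b_appL.prems show ?case
  proof (cases rule: eta_AppE)
    case (left s')
    with b_appL.IH obtain v where "eta\<^sup>*\<^sup>* t v" "beta\<^sup>=\<^sup>= s' v" by blast
    then have "eta\<^sup>*\<^sup>* (App t w) (App v w)" "beta\<^sup>=\<^sup>= (App s' w) (App v w)"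
      by (auto intro: eta_rtranclp_App beta.b_appL)
    with left show ?thesis by blast
  next
    case (right w')
    then have "eta\<^sup>*\<^sup>* (App t w) (App t w')" "beta\<^sup>=\<^sup>= (App s w') (App t w')"
      using b_appL.hyps by (auto intro: eta_rtranclp_App beta.b_appL)
    with right show ?thesis by blast
  qed
next
  case (b_appR s t w)
  from b_appR.prems show ?case
  proof (cases rule: eta_AppE)
    case (right s')
    with b_appR.IH obtain v where "eta\<^sup>*\<^sup>* t v" "beta\<^sup>=\<^sup>= s' v" by blast
    then have "eta\<^sup>*\<^sup>* (App w t) (App w v)" "beta\<^sup>=\<^sup>= (App w s') (App w v)"
      by (auto intro: eta_rtranclp_App beta.b_appR)
    with right show ?thesis by blast
  next
    case (left w')
    then have "eta\<^sup>*\<^sup>* (App w t) (App w' t)" "beta\<^sup>=\<^sup>= (App w' s) (App w' t)"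
      using b_appR.hyps by (auto intro: eta_rtranclp_App beta.b_appR)
    with left show ?thesis by blast
  qed
next
  case (b_abs s t)
  from b_abs.prems show ?case
  proof (cases rule: eta_AbsE)
    case redex
    with b_abs.hyps have "beta (App (lift u 0) (BV 0)) t" by simp
    then show ?thesis
    proof (cases rule: beta_AppE)
      \<comment> \<open>The overlap \<lambda>x. (\<lambda>y. q) x: contracting either redex yields
        \<lambda>y. q.\<close>
      case (redex p)
      then obtain q where "u = Abs q" "p = lift q (Suc 0)" by (metis lift_eq_Abs)
      moreover have "subst (lift q (Suc 0)) (BV 0) 0 = q" for q
      proof -
        have "subst (lift q (Suc k)) (BV k) k = q" for k
          by (induction q arbitrary: k) auto
        then show ?thesis .
      qed
      ultimately show ?thesis using redex by auto
    next
      case (left r)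
      then obtain u' where "r = lift u' 0" "beta u u'" using beta_lift_inv by blast
      with left show ?thesis using eta_redex by blast
    qed (auto elim: beta_BVE)
  next
    case (abs s')
    with b_abs.IH obtain v where "eta\<^sup>*\<^sup>* t v" "beta\<^sup>=\<^sup>= s' v" by blast
    then have "eta\<^sup>*\<^sup>* (Abs t) (Abs v)" "beta\<^sup>=\<^sup>= (Abs s') (Abs v)"
      by (auto intro: eta_rtranclp_Abs beta.b_abs)
    with abs show ?thesis by blast
  qed
qed

lemma beta_eta_commute:
  assumes "beta\<^sup>*\<^sup>* s t" "eta\<^sup>*\<^sup>* s u"
  shows "\<exists>v. eta\<^sup>*\<^sup>* t v \<and> beta\<^sup>*\<^sup>* u v"
proof -
  \<comment> \<open>A beta step carried across many eta steps remains at most one beta step, so a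
    second induction over the beta steps finishes the proof.\<close>
  have strip: "\<exists>v. eta\<^sup>*\<^sup>* t v \<and> beta\<^sup>=\<^sup>= u v" if "eta\<^sup>*\<^sup>* s u" "beta s t" for s t u
    using that
  proof (induction rule: rtranclp_induct)
    case base
    then show ?case by blast
  next
    case (step u u')
    then obtain v where v: "eta\<^sup>*\<^sup>* t v" "beta\<^sup>=\<^sup>= u v" by blast
    show ?case
    proof (cases "u = v")
      case True
      with v step.hyps(2) have "eta\<^sup>*\<^sup>* t u'" by auto
      then show ?thesis by blast
    next
      case False
      with v have "beta u v" by blast
      with step.hyps(2) obtain w where "eta\<^sup>*\<^sup>* v w" "beta\<^sup>=\<^sup>= u' w" using beta_eta_square by blast
      with v show ?thesis by (meson rtranclp_trans)
    qed
  qed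
  from assms(1,2) show ?thesis
  proof (induction rule: rtranclp_induct)
    case base
    then show ?case by blast
  next
    case (step t t')
    then obtain v where v: "eta\<^sup>*\<^sup>* t v" "beta\<^sup>*\<^sup>* u v" by blast
    with step.hyps(2) strip obtain w where "eta\<^sup>*\<^sup>* t' w" "beta\<^sup>=\<^sup>= v w" by blast
    moreover from this have "beta\<^sup>*\<^sup>* v w" by auto
    ultimately show ?case using v by (meson rtranclp_trans)
  qed
qed

text \<open>Hindley-Rosen: the union of the two reflexive transitive closures has the diamond
  property, since each relation is confluent and the two commute.\<close>

lemma confluentp_beta_eta: "confluentp (sup beta eta)"
proof -
  define Q where "Q s t \<longleftrightarrow> beta\<^sup>*\<^sup>* s t \<or> eta\<^sup>*\<^sup>* s t" for s t
  have "strong_confluentp Q"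
  proof (rule strong_confluentpI)
    fix s t u assume "Q s t" "Q s u"
    then have "\<exists>v. Q t v \<and> Q u v"
      using confluentpD[OF confluentp_beta] confluentpD[OF confluentp_eta] beta_eta_commute
      unfolding Q_def by meson
    then show "\<exists>v. Q\<^sup>*\<^sup>* t v \<and> Q\<^sup>=\<^sup>= u v" by blast
  qed
  then have "confluentp Q" by (rule strong_confluentp_imp_confluentp)
  moreover have "Q\<^sup>*\<^sup>* = (sup beta eta)\<^sup>*\<^sup>*"
  proof (rule rtranclp_subset)
    show "sup beta eta \<le> Q" by (auto simp: Q_def)
    show "Q \<le> (sup beta eta)\<^sup>*\<^sup>*"
      unfolding Q_def using rtranclp_mono[of beta "sup beta eta"] rtranclp_mono[of eta "sup beta eta"]
      by auto
  qed
  ultimately show ?thesis by (metis confluentp_conv_strong_confluentp_rtranclp)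
qed


section \<open>Conversion and normal forms\<close>

text \<open>With the empty relation for \<open>Syn\<close>, all three conversions are equivalence
  closures of confluent relations and can be treated uniformly; under \<open>Syn\<close> every term
  is normal.\<close>

fun step :: "eqrel \<Rightarrow> lterm \<Rightarrow> lterm \<Rightarrow> bool" where
  "step Syn = (\<lambda>s t. False)"
| "step Beta = beta"
| "step BetaEta = sup beta eta"

lemma confluentp_step: "confluentp (step R)"
proof (cases R)
  case Syn
  have "strong_confluentp (\<lambda>s t :: lterm. False)" by (rule strong_confluentpI) simp
  with Syn show ?thesis by (simp add: strong_confluentp_imp_confluentp)
qed (simp_all add: confluentp_beta confluentp_beta_eta)

lemma rel_holds_iff: "rel_holds R s t \<longleftrightarrow> equivclp (step R) s t"
proof (cases R)
  case Syn
  have "equivclp (\<lambda>s t :: lterm. False) s t \<Longrightarrow> s = t"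
    by (induction rule: equivclp_induct) auto
  with Syn show ?thesis by auto
qed simp_all

lemma rel_holds_refl [simp]: "rel_holds R s s"
  by (simp add: rel_holds_iff)

lemma rel_holds_sym: "rel_holds R s t \<Longrightarrow> rel_holds R t s"
  by (simp add: rel_holds_iff equivclp_sym)

lemma rel_holds_trans [trans]: "rel_holds R s t \<Longrightarrow> rel_holds R t u \<Longrightarrow> rel_holds R s u"
  unfolding rel_holds_iff by (rule equivclp_trans)

definition normal :: "eqrel \<Rightarrow> lterm \<Rightarrow> bool" where
  "normal R s \<longleftrightarrow> (\<nexists>t. step R s t)"

definition normal_form :: "eqrel \<Rightarrow> lterm \<Rightarrow> lterm \<Rightarrow> bool" where
  "normal_form R s t \<longleftrightarrow> (step R)\<^sup>*\<^sup>* s t \<and> normal R t"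

lemma normal_rtranclp: "normal R s \<Longrightarrow> (step R)\<^sup>*\<^sup>* s t \<Longrightarrow> t = s"
  by (metis converse_rtranclpE normal_def)

text \<open>By confluence \<open>u\<close> and \<open>t\<close> have a common reduct;
  \<open>u\<close> is normal, so this reduct is \<open>u\<close> itself.\<close>

lemma rel_holds_normal_form:
  assumes "rel_holds R s t" "normal_form R s u" shows "normal_form R t u"
proof -
  have conf: "semiconfluentp (step R)"
    using confluentp_step by (rule confluentp_imp_semiconfluentp)
  have "equivclp (step R) u s"
    using assms(2) by (auto simp: normal_form_def intro: converse_rtranclp_into_equivclp)
  then have "equivclp (step R) u t"
    using assms(1) unfolding rel_holds_iff by (rule equivclp_trans)
  then obtain v where "(step R)\<^sup>*\<^sup>* u v" "(step R)\<^sup>*\<^sup>* t v"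
    unfolding semiconfluentp_equivclp[OF conf] by (auto simp: rtranclp_conversep)
  with assms(2) show ?thesis using normal_rtranclp unfolding normal_form_def by metis
qed

lemma normal_form_unique: "normal_form R s t \<Longrightarrow> normal_form R s u \<Longrightarrow> t = u"
  by (metis confluentpD[OF confluentp_step] normal_form_def normal_rtranclp)

lemma rel_holds_iff_normal_form:
  assumes "normal_form R s s'" "normal_form R t t'"
  shows "rel_holds R s t \<longleftrightarrow> s' = t'"
proof
  assume "rel_holds R s t"
  then show "s' = t'" using assms rel_holds_normal_form normal_form_unique by metis
next
  assume "s' = t'"
  with assms show "rel_holds R s t"
    unfolding rel_holds_iff normal_form_def
    by (metis converse_rtranclp_into_equivclp equivclp_trans rtranclp_into_equivclp)
qed

lemma step_cong:
  assumes "step R s t"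
  shows "step R (Abs s) (Abs t)" "step R (App s u) (App t u)" "step R (App u s) (App u t)"
  using assms by (cases R; auto intro: beta.intros eta.intros)+

lemma equivclp_map:
  assumes "equivclp r x y" "\<And>x y. r x y \<Longrightarrow> r (f x) (f y)"
  shows "equivclp r (f x) (f y)"
  using assms(1)
  by (induction rule: equivclp_induct) (auto intro: equivclp_into_equivclp assms(2))

lemma rel_holds_App:
  assumes "rel_holds R s s'" "rel_holds R t t'" shows "rel_holds R (App s t) (App s' t')"
proof -
  have "rel_holds R (App s t) (App s' t)"
    using assms(1) unfolding rel_holds_iff
    by (rule equivclp_map[of _ _ _ "\<lambda>s. App s t"]) (rule step_cong)
  also have "rel_holds R (App s' t) (App s' t')"
    using assms(2) unfolding rel_holds_iff by (rule equivclp_map) (rule step_cong)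
  finally show ?thesis .
qed

lemma rel_holds_beta: "R \<noteq> Syn \<Longrightarrow> beta s t \<Longrightarrow> rel_holds R s t"
  unfolding rel_holds_iff by (cases R) auto


section \<open>Normalisation of typable terms\<close>

text \<open>Weak normalisation is enough because all reducts get searched, and it is invariant under
  conversion, which strong normalisation is not.\<close>

definition WN :: "eqrel \<Rightarrow> lterm \<Rightarrow> bool" where
  "WN R s \<longleftrightarrow> (\<exists>t. normal_form R s t)"

lemma WN_conv: "rel_holds R s t \<Longrightarrow> WN R s \<Longrightarrow> WN R t"
  unfolding WN_def using rel_holds_normal_form by blast

lemma step_subst_FV_inv: "step R (subst s (FV x) k) t \<Longrightarrow> \<exists>t'. t = subst t' (FV x) k \<and> step R s t'"
  by (cases R) (auto dest: beta_subst_FV_inv eta_subst_FV_inv)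

lemma step_subst: "step R s t \<Longrightarrow> step R (subst s u k) (subst t u k)"
  by (cases R) (auto dest: beta_subst eta_subst)

lemma step_lift: "step R s t \<Longrightarrow> step R (lift s k) (lift t k)"
  by (cases R) (auto dest: beta_lift eta_lift)

lemma WN_subst_FV:
  assumes "WN R (subst s (FV x) k)" shows "WN R s"
proof -
  obtain t where t: "(step R)\<^sup>*\<^sup>* (subst s (FV x) k) t" "normal R t"
    using assms by (auto simp: WN_def normal_form_def)
  from t(1) have "\<exists>t'. t = subst t' (FV x) k \<and> (step R)\<^sup>*\<^sup>* s t'"
    by induction (blast dest: step_subst_FV_inv intro: rtranclp.rtrancl_into_rtrancl)+
  then obtain t' where t': "t = subst t' (FV x) k" "(step R)\<^sup>*\<^sup>* s t'" by blast
  with t(2) have "normal R t'" using step_subst unfolding normal_def by blast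
  with t' show ?thesis by (auto simp: WN_def normal_form_def)
qed

lemma step_AbsE:
  assumes "step R (Abs s) t"
  obtains s' where "t = Abs s'" "step R s s'" | "R = BetaEta" "s = App (lift t 0) (BV 0)"
  using assms by (cases R) (auto elim: beta_AbsE eta_AbsE)

lemma step_AppE:
  assumes "step R (App s u) t"
  obtains s' where "t = App s' u" "step R s s'" | u' where "t = App s u'" "step R u u'"
    | p where "s = Abs p"
  using assms by (cases R) (auto elim: beta_AppE eta_AppE)

text \<open>With eta, an abstraction over a normal body may itself be a redex. Its contract is then
  the function part of that body and hence normal.\<close>

lemma WN_Abs:
  assumes "WN R s" shows "WN R (Abs s)"
proof -
  obtain t where t: "(step R)\<^sup>*\<^sup>* s t" "normal R t"
    using assms by (auto simp: WN_def normal_form_def)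
  then have red: "(step R)\<^sup>*\<^sup>* (Abs s) (Abs t)"
    by (auto intro: rtranclp_map[of "step R"] step_cong)
  show ?thesis
  proof (cases "normal R (Abs t)")
    case True
    with red show ?thesis by (auto simp: WN_def normal_form_def)
  next
    case False
    then obtain u where u: "step R (Abs t) u" by (auto simp: normal_def)
    then have tu: "t = App (lift u 0) (BV 0)"
      using t(2) by (auto simp: normal_def elim: step_AbsE)
    have "normal R u"
      using t(2) unfolding tu normal_def by (blast dest: step_lift step_cong(2))
    with red u show ?thesis
      by (auto simp: WN_def normal_form_def intro: rtranclp.rtrancl_into_rtrancl)
  qed
qed

inductive neutral :: "eqrel \<Rightarrow> lterm \<Rightarrow> bool" where
  neutral_FV: "neutral R (FV x)"
| neutral_App: "neutral R s \<Longrightarrow> WN R t \<Longrightarrow> neutral R (App s t)"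

lemma step_FV: "\<not> step R (FV x) t"
  by (cases R) (auto elim: beta_FVE eta_FVE)

text \<open>The induction needs that the normal form is no abstraction: only then does applying it
  to a normal argument create no redex.\<close>

lemma neutral_normal_form: "neutral R s \<Longrightarrow> \<exists>s'. normal_form R s s' \<and> (\<forall>p. s' \<noteq> Abs p)"
proof (induction rule: neutral.induct)
  case (neutral_FV R x)
  have "normal_form R (FV x) (FV x)" by (simp add: normal_form_def normal_def step_FV)
  then show ?case by blast
next
  case (neutral_App R s t)
  then obtain s' t' where st: "normal_form R s s'" "\<forall>p. s' \<noteq> Abs p" "normal_form R t t'"
    by (auto simp: WN_def)
  have "(step R)\<^sup>*\<^sup>* (App s t) (App s' t)"
    using st(1) by (auto simp: normal_form_def intro: rtranclp_map[of "step R" _ _ _ "\<lambda>s. App s t"] step_cong)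
  also have "(step R)\<^sup>*\<^sup>* (App s' t) (App s' t')"
    using st(3) by (auto simp: normal_form_def intro: rtranclp_map[of "step R"] step_cong)
  finally have "normal_form R (App s t) (App s' t')"
    using st by (auto simp: normal_form_def normal_def elim!: step_AppE)
  then show ?case by blast
qed

lemma neutral_WN: "neutral R s \<Longrightarrow> WN R s"
  using neutral_normal_form unfolding WN_def by blast

text \<open>Reducibility candidates closed under conversion rather than under head expansion: the rule
  for intersection introduction only relates the two essences by conversion.\<close>

fun interp :: "eqrel \<Rightarrow> ty \<Rightarrow> lterm set" where
  "interp R (Atom a) = {M. WN R M}"
| "interp R (Arr s t) = {M. WN R M \<and> (\<forall>N \<in> interp R s. App M N \<in> interp R t)}"
| "interp R (Inter s t) = interp R s \<inter> interp R t"

lemma interp_WN: "M \<in> interp R s \<Longrightarrow> WN R M"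
  by (induction s) auto

lemma interp_neutral: "neutral R M \<Longrightarrow> M \<in> interp R s"
  by (induction s arbitrary: M) (auto intro: neutral_WN neutral_App dest: interp_WN)

lemma interp_conv: "rel_holds R M N \<Longrightarrow> M \<in> interp R s \<Longrightarrow> N \<in> interp R s"
proof (induction s arbitrary: M N)
  case (Arr s t)
  have "App N P \<in> interp R t" if "P \<in> interp R s" for P
    using Arr.prems that by (intro Arr.IH(2)[of "App M P" "App N P"] rel_holds_App) auto
  with Arr.prems show ?case by (auto intro: WN_conv)
qed (auto intro: WN_conv)

lemma leq_interp: "leq T s t \<Longrightarrow> \<not> has_omega T \<Longrightarrow> interp R s \<subseteq> interp R t"
  by (induction rule: leq.induct) (auto simp: has_omega_def)

section \<open>Soundness of the reducibility model\<close>

fun psubst :: "(nat \<Rightarrow> lterm) \<Rightarrow> lterm \<Rightarrow> lterm" where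
  "psubst \<rho> (FV x) = \<rho> x"
| "psubst \<rho> (BV i) = BV i"
| "psubst \<rho> (Abs s) = Abs (psubst (\<lambda>y. lift (\<rho> y) 0) s)"
| "psubst \<rho> (App s t) = App (psubst \<rho> s) (psubst \<rho> t)"

lemma psubst_FV: "psubst FV s = s"
  by (induction s) auto

lemma psubst_lift: "psubst (\<lambda>y. lift (\<rho> y) k) (lift s k) = lift (psubst \<rho> s) k"
proof (induction s arbitrary: \<rho> k)
  case (Abs s)
  show ?case using Abs.IH[of "\<lambda>y. lift (\<rho> y) 0" "Suc k"] by (simp add: lift_lift)
qed auto

lemma psubst_subst:
  "psubst \<rho> (subst s t k) = subst (psubst (\<lambda>y. lift (\<rho> y) k) s) (psubst \<rho> t) k"
proof (induction s arbitrary: \<rho> t k)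
  case (Abs s)
  show ?case using Abs.IH[of "\<lambda>y. lift (\<rho> y) 0" "lift t 0" "Suc k"]
    by (simp add: lift_lift psubst_lift)
qed auto

text \<open>Bridges the named binder of \<open>Lam\<close> and the index in the essence: filling the
  abstracted variable with \<open>N\<close> amounts to assigning \<open>N\<close> to
  \<open>x\<close>. The hypothesis ensures that index \<open>k\<close> stands for \<open>x\<close>
  only.\<close>

lemma psubst_abst:
  "(\<And>i. i \<ge> k \<Longrightarrow> \<not> loose s i) \<Longrightarrow>
   subst (psubst (\<lambda>y. lift (\<rho> y) k) (abst x k s)) N k = psubst (\<rho>(x := N)) s"
proof (induction s arbitrary: \<rho> N k)
  case (BV i)
  from BV[of i] have "i < k" by (cases "k \<le> i") auto
  then show ?case by simp
next
  case (Abs s)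
  have "\<not> loose s i" if "i \<ge> Suc k" for i
    using Abs.prems[of "i - 1"] that by (cases i) auto
  then have IH: "subst (psubst (\<lambda>y. lift (lift (\<rho> y) 0) (Suc k)) (abst x (Suc k) s)) (lift N 0) (Suc k) =
      psubst ((\<lambda>y. lift (\<rho> y) 0)(x := lift N 0)) s"
    by (rule Abs.IH)
  have "(\<lambda>y. lift (\<rho> y) 0)(x := lift N 0) = (\<lambda>y. lift ((\<rho>(x := N)) y) 0)" by auto
  with IH show ?case by (simp add: lift_lift)
qed auto

lemma step_psubst: "step R s t \<Longrightarrow> step R (psubst \<rho> s) (psubst \<rho> t)"
proof -
  have "beta s t \<Longrightarrow> beta (psubst \<rho> s) (psubst \<rho> t)" for s t
  proof (induction arbitrary: \<rho> rule: beta.induct)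
    case (b_redex s t)
    show ?case using beta.b_redex[of "psubst (\<lambda>y. lift (\<rho> y) 0) s" "psubst \<rho> t"]
      by (simp add: psubst_subst)
  qed (auto intro: beta.intros)
  moreover have "eta s t \<Longrightarrow> eta (psubst \<rho> s) (psubst \<rho> t)" for s t
  proof (induction arbitrary: \<rho> rule: eta.induct)
    case (e_redex s)
    then obtain p where p: "s = lift p 0" by (metis not_loose_imp_lift)
    show ?case using eta_redex[of "psubst \<rho> p"] by (simp add: p psubst_lift)
  qed (auto intro: eta.intros)
  ultimately show "step R s t \<Longrightarrow> step R (psubst \<rho> s) (psubst \<rho> t)"
    by (cases R) auto
qed

lemma loose_abst: "loose (abst x k s) i \<Longrightarrow> i = k \<or> loose s i"
  by (induction s arbitrary: k i) (auto split: if_splits)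

lemma not_loose_ess: "\<not> loose (ess D) i"
  by (induction D arbitrary: i) (auto dest!: loose_abst)

text \<open>The fundamental lemma of the reducibility argument. \<open>Syn\<close> is excluded
  because the abstraction case passes from the contracted body to the redex by beta
  conversion.\<close>

lemma typing_interp:
  assumes "typing T R B D s" "\<not> has_omega T" "R \<noteq> Syn"
    and "\<And>x t. map_of B x = Some t \<Longrightarrow> \<rho> x \<in> interp R t"
  shows "psubst \<rho> (ess D) \<in> interp R s"
  using assms
proof (induction arbitrary: \<rho> rule: typing.induct)
  case (t_absI T s R x B D t)
  let ?P = "psubst (\<lambda>y. lift (\<rho> y) 0) (abst x 0 (ess D))"
  have P: "subst ?P N 0 = psubst (\<rho>(x := N)) (ess D)" for N
    by (rule psubst_abst) (simp add: not_loose_ess)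
  have body: "subst ?P N 0 \<in> interp R t" if "N \<in> interp R s" for N
    unfolding P using t_absI.prems that by (intro t_absI.IH) (auto split: if_splits)
  \<comment> \<open>Every variable, fresh or not, lies in every candidate. The body instantiated by
    one therefore normalises, and this is pulled back to the body itself.\<close>
  have "WN R (subst ?P (FV 0) 0)"
    by (rule interp_WN, rule body, rule interp_neutral, rule neutral_FV)
  then have "WN R (Abs ?P)" by (blast intro: WN_Abs WN_subst_FV)
  moreover have "App (Abs ?P) N \<in> interp R t" if "N \<in> interp R s" for N
    by (rule interp_conv[OF _ body[OF that]])
      (rule rel_holds_sym, rule rel_holds_beta[OF t_absI.prems(2) b_redex])
  ultimately show ?case by simp
next
  case (t_interI T R B D1 s D2 t)
  have "rel_holds R (psubst \<rho> (ess D1)) (psubst \<rho> (ess D2))"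
    using t_interI.hyps(3) unfolding rel_holds_iff by (rule equivclp_map) (rule step_psubst)
  moreover have "psubst \<rho> (ess D1) \<in> interp R s" "psubst \<rho> (ess D2) \<in> interp R t"
    using t_interI by blast+
  ultimately show ?case by (auto intro: interp_conv rel_holds_sym)
next
  case (t_leq T R B D s t)
  then show ?case using leq_interp by fastforce
qed auto

theorem typing_WN:
  assumes "typing T R B D s" "R = Syn \<or> \<not> has_omega T"
  shows "WN R (ess D)"
proof (cases "R = Syn")
  case True
  then show ?thesis by (auto simp: WN_def normal_form_def normal_def)
next
  case False
  \<comment> \<open>The identity environment is admissible since variables are neutral.\<close>
  then have "psubst FV (ess D) \<in> interp R s"
    using assms by (intro typing_interp[OF assms(1)]) (auto intro: interp_neutral neutral_FV)
  then show ?thesis by (simp add: psubst_FV interp_WN)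
qed


section \<open>Deciding the subtype relation\<close>

lemma leq_wf: "leq T s t \<Longrightarrow> wf_ty T s \<and> wf_ty T t"
  by (induction rule: leq.induct) (auto simp: has_omega_def)

text \<open>Without arrow rules an arrow type is as inert as an atom, so only the members of the two
  intersections are compared.\<close>

fun component_le :: "ty \<Rightarrow> ty \<Rightarrow> bool" where
  "component_le s (Inter t1 t2) \<longleftrightarrow> component_le s t1 \<and> component_le s t2"
| "component_le s (Atom Omega) \<longleftrightarrow> True"
| "component_le (Inter s1 s2) t \<longleftrightarrow> component_le s1 t \<or> component_le s2 t"
| "component_le s t \<longleftrightarrow> s = t"

lemma component_le_Inter: "component_le s t \<or> component_le s' t \<Longrightarrow> component_le (Inter s s') t"
  by (induction s t rule: component_le.induct) auto

lemma component_le_refl: "component_le s s"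
proof (induction s)
  case (Atom a)
  then show ?case by (cases a) auto
qed (auto intro: component_le_Inter)

lemma component_le_trans: "component_le s t \<Longrightarrow> component_le t r \<Longrightarrow> component_le s r"
proof (induction r)
  case (Atom a)
  show ?case
  proof (cases a)
    case (At i)
    with Atom show ?thesis by (induction t) (auto split: if_splits)
  qed simp
next
  case (Arr r1 r2)
  from Arr.prems show ?case
  proof (induction t)
    case (Atom a)
    then show ?case by (cases a) auto
  qed auto
qed auto

lemma leq_imp_component_le: "leq T s t \<Longrightarrow> \<not> has_arrow_rules T \<Longrightarrow> component_le s t"
proof (induction rule: leq.induct)
  case (trans T s t r)
  then show ?case by (blast intro: component_le_trans)
qed (simp_all add: has_arrow_rules_def component_le_refl component_le_Inter)

lemma component_le_imp_leq: "component_le s t \<Longrightarrow> wf_ty T s \<Longrightarrow> wf_ty T t \<Longrightarrow> leq T s t"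
proof (induction s t rule: component_le.induct)
  case ("3_1" s1 s2 v)
  then show ?case using leq.trans[OF leq.incl1] leq.trans[OF leq.incl2] by (metis component_le.simps(3) wf_ty.simps(4))
next
  case ("3_2" s1 s2 v)
  then show ?case using leq.trans[OF leq.incl1] leq.trans[OF leq.incl2] by (metis component_le.simps(4) wf_ty.simps(4))
qed (simp_all add: leq.refl leq.glb leq.omega_top)

text \<open>\<open>arrow_le s [c1, \<dots>, cn] t\<close> decides \<open>s \<le> c1 \<rightarrow> \<dots> \<rightarrow> cn \<rightarrow> t\<close>: the target is
  unfolded down to its atoms, after which a single component of \<open>s\<close> has to be responsible.\<close>

function arrow_le :: "ty \<Rightarrow> ty list \<Rightarrow> ty \<Rightarrow> bool" where
  "arrow_le s cs (Inter t1 t2) \<longleftrightarrow> arrow_le s cs t1 \<and> arrow_le s cs t2"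
| "arrow_le s cs (Arr c d) \<longleftrightarrow> arrow_le s (cs @ [c]) d"
| "arrow_le s cs (Atom Omega) \<longleftrightarrow> True"
| "arrow_le (Inter s1 s2) cs (Atom (At a)) \<longleftrightarrow>
     arrow_le s1 cs (Atom (At a)) \<or> arrow_le s2 cs (Atom (At a))"
| "arrow_le (Atom b) cs (Atom (At a)) \<longleftrightarrow> cs = [] \<and> b = At a"
| "arrow_le (Arr c d) [] (Atom (At a)) \<longleftrightarrow> False"
| "arrow_le (Arr c d) (c' # cs) (Atom (At a)) \<longleftrightarrow> arrow_le c' [] c \<and> arrow_le d cs (Atom (At a))"
  by pat_completeness auto
termination
  by (relation "measure (\<lambda>(s, cs, t). size s + (\<Sum>c\<leftarrow>cs. size c) + size t)") auto

text \<open>A type of the form \<open>d1 \<rightarrow> \<dots> \<rightarrow> dn \<rightarrow> a\<close> with \<open>a\<close> an atom other than \<open>\<omega>\<close> is prime: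
  an intersection is below it only if one of its members is.\<close>

fun primes :: "ty \<Rightarrow> (ty list \<times> nat) list" where
  "primes (Atom Omega) = []"
| "primes (Atom (At a)) = [([], a)]"
| "primes (Arr c d) = map (\<lambda>(cs, a). (c # cs, a)) (primes d)"
| "primes (Inter s t) = primes s @ primes t"

lemma arrow_le_iff_primes:
  "arrow_le s cs t \<longleftrightarrow> (\<forall>(ds, a) \<in> set (primes t). arrow_le s (cs @ ds) (Atom (At a)))"
proof (induction t arbitrary: cs)
  case (Atom a)
  then show ?case by (cases a) auto
next
  case (Arr t1 t2)
  then show ?case by fastforce
next
  case (Inter t1 t2)
  show ?case using Inter.IH[of cs] by (simp add: ball_Un)
qed

lemma arrow_le_At:
  "arrow_le s cs (Atom (At a)) \<longleftrightarrow>
    (\<exists>fs. (fs, a) \<in> set (primes s) \<and> list_all2 (\<lambda>c f. arrow_le c [] f) cs fs)"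
proof (induction s arbitrary: cs)
  case (Atom b)
  then show ?case by (cases b) auto
next
  case (Arr c d)
  show ?case
  proof (cases cs)
    case (Cons c' cs')
    with Arr.IH(2)[of cs'] show ?thesis by force
  qed auto
qed auto

text \<open>A type acts as the set of its primes: each prime of \<open>t\<close> must be dominated
  by a prime of \<open>s\<close>, arguments being compared contravariantly. \<open>Omega\<close> and
  every arrow into it have no primes, which makes them greatest. Reflexivity and transitivity are
  proved on this form rather than on the recursive one.\<close>

lemma arrow_le_primes:
  "arrow_le s [] t \<longleftrightarrow> (\<forall>(ds, a) \<in> set (primes t). \<exists>fs. (fs, a) \<in> set (primes s) \<and>
     list_all2 (\<lambda>c f. arrow_le c [] f) ds fs)"
  by (simp add: arrow_le_iff_primes[of s "[]" t] arrow_le_At)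

lemma primes_size: "(ds, a) \<in> set (primes t) \<Longrightarrow> d \<in> set ds \<Longrightarrow> size d < size t"
proof (induction t arbitrary: ds)
  case (Atom b)
  then show ?case by (cases b) auto
next
  case (Arr t1 t2)
  then show ?case by (fastforce simp: less_Suc_eq)
qed fastforce+

lemma arrow_le_refl: "arrow_le s [] s"
proof (induction s rule: measure_induct_rule[of size])
  case (less s)
  have "list_all2 (\<lambda>c f. arrow_le c [] f) ds ds" if "(ds, a) \<in> set (primes s)" for ds a
    using less primes_size[OF that] by (simp add: list.rel_refl_strong)
  then show ?case unfolding arrow_le_primes[of s] by fast
qed

text \<open>Contravariance exchanges the roles of the outer types when arguments are compared, so
  the induction is on the sum of all three sizes.\<close>

lemma arrow_le_trans: "arrow_le s [] t \<Longrightarrow> arrow_le t [] r \<Longrightarrow> arrow_le s [] r"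
proof (induction "size s + size t + size r" arbitrary: s t r rule: less_induct)
  case less
  show ?case unfolding arrow_le_primes[of s]
  proof clarify
    fix ds a assume ds: "(ds, a) \<in> set (primes r)"
    with less.prems(2) obtain fs where fs: "(fs, a) \<in> set (primes t)"
      "list_all2 (\<lambda>c f. arrow_le c [] f) ds fs"
      unfolding arrow_le_primes[of t] by fast
    with less.prems(1) obtain gs where gs: "(gs, a) \<in> set (primes s)"
      "list_all2 (\<lambda>c f. arrow_le c [] f) fs gs"
      unfolding arrow_le_primes[of s] by fast
    have "arrow_le (ds ! i) [] (gs ! i)" if i: "i < length ds" for i
    proof (rule less.hyps[of _ "fs ! i"])
      have len: "i < length fs" "i < length gs"
        using i list_all2_lengthD[OF fs(2)] list_all2_lengthD[OF gs(2)] by simp_all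
      show "size (ds ! i) + size (fs ! i) + size (gs ! i) < size s + size t + size r"
        using primes_size[OF ds, of "ds ! i"] primes_size[OF fs(1), of "fs ! i"]
          primes_size[OF gs(1), of "gs ! i"] i len by simp
      show "arrow_le (ds ! i) [] (fs ! i)" "arrow_le (fs ! i) [] (gs ! i)"
        using fs(2) gs(2) i len by (auto dest: list_all2_nthD)
    qed
    then have "list_all2 (\<lambda>c f. arrow_le c [] f) ds gs"
      using fs(2) gs(2) by (auto simp: list_all2_conv_all_nth)
    with gs(1) show "\<exists>fs. (fs, a) \<in> set (primes s) \<and> list_all2 (\<lambda>c f. arrow_le c [] f) ds fs"
      by blast
  qed
qed

lemma arrow_le_subset: "set (primes t) \<subseteq> set (primes s) \<Longrightarrow> arrow_le s [] t"
  using arrow_le_refl[of t] unfolding arrow_le_primes[of s t] arrow_le_primes[of t t] by fast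

text \<open>\<open>arrow_le\<close> does not mention \<open>T\<close>: it respects the rules of all
  four theories at once.\<close>

lemma leq_imp_arrow_le: "leq T s t \<Longrightarrow> arrow_le s [] t"
proof (induction rule: leq.induct)
  case (arr T s2 s1 t1 t2)
  show ?case unfolding arrow_le_primes[of "Arr s1 t1"]
  proof clarify
    fix ds a assume "(ds, a) \<in> set (primes (Arr s2 t2))"
    then obtain es where es: "ds = s2 # es" "(es, a) \<in> set (primes t2)" by auto
    with arr.IH(2) obtain fs where "(fs, a) \<in> set (primes t1)"
      "list_all2 (\<lambda>c f. arrow_le c [] f) es fs"
      unfolding arrow_le_primes[of t1] by fast
    then have "(s1 # fs, a) \<in> set (primes (Arr s1 t1))"
      "list_all2 (\<lambda>c f. arrow_le c [] f) ds (s1 # fs)"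
      using es arr.IH(1) by auto
    then show "\<exists>fs. (fs, a) \<in> set (primes (Arr s1 t1)) \<and> list_all2 (\<lambda>c f. arrow_le c [] f) ds fs"
      by blast
  qed
next
  case (arr_inter T s t r)
  show ?case by (rule arrow_le_subset) auto
next
  case (trans T s t r)
  then show ?case by (blast intro: arrow_le_trans)
qed (simp_all add: arrow_le_refl arrow_le_subset)


lemma leq_foldr_Arr_Inter:
  assumes "has_arrow_rules T" "list_all (wf_ty T) cs" "wf_ty T s" "wf_ty T t"
  shows "leq T (Inter (foldr Arr cs s) (foldr Arr cs t)) (foldr Arr cs (Inter s t))"
  using assms(2)
proof (induction cs)
  case (Cons c cs)
  have wf: "wf_ty T (foldr Arr cs s)" if "wf_ty T s" for s
    using that Cons.prems by (induction cs) auto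
  have "leq T (Inter (Arr c (foldr Arr cs s)) (Arr c (foldr Arr cs t)))
      (Arr c (Inter (foldr Arr cs s) (foldr Arr cs t)))"
    using Cons.prems assms wf by (intro leq.arr_inter) auto
  also have "leq T \<dots> (Arr c (foldr Arr cs (Inter s t)))"
    using Cons assms by (intro leq.arr leq.refl) auto
  finally (leq.trans) show ?case by simp
qed (use assms in \<open>auto intro: leq.refl\<close>)

lemma leq_foldr_Arr_Omega:
  assumes "T = BCD" "list_all (wf_ty T) cs"
  shows "leq T om (foldr Arr cs om)"
  using assms(2)
proof (induction cs)
  case Nil
  then show ?case using assms by (auto intro: leq.refl simp: has_omega_def)
next
  case (Cons c cs)
  have "leq T om (Arr c om)" using assms Cons.prems by (auto intro: leq.omega_arr)
  also have "leq T (Arr c om) (Arr c (foldr Arr cs om))"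
    using assms Cons by (auto intro!: leq.arr leq.refl simp: has_arrow_rules_def)
  finally (leq.trans) show ?case by simp
qed

lemma arrow_le_imp_leq:
  "arrow_le s cs t \<Longrightarrow> has_arrow_rules T \<Longrightarrow> wf_ty T s \<Longrightarrow> list_all (wf_ty T) cs \<Longrightarrow> wf_ty T t \<Longrightarrow>
   leq T s (foldr Arr cs t)"
proof (induction s cs t rule: arrow_le.induct)
  case (1 s cs t1 t2)
  then have "leq T s (Inter (foldr Arr cs t1) (foldr Arr cs t2))" by (auto intro: leq.glb)
  then show ?case by (rule leq.trans, intro leq_foldr_Arr_Inter) (use 1 in auto)
next
  case (3 s cs)
  \<comment> \<open>Well-formedness of \<open>om\<close> requires a theory with the universal type,
    and among these only \<open>BCD\<close> has the arrow rules.\<close>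
  then have "T = BCD" by (auto simp: has_omega_def has_arrow_rules_def)
  moreover from this 3 have "leq T s om" by (auto intro: leq.omega_top simp: has_omega_def)
  ultimately show ?case using 3 leq_foldr_Arr_Omega leq.trans by metis
next
  case (4 s1 s2 cs a)
  then show ?case using leq.trans[OF leq.incl1] leq.trans[OF leq.incl2] by auto
qed (auto intro: leq.refl leq.arr)

text \<open>\<open>leq\<close> relates well-formed types only, whereas both comparisons ignore
  well-formedness.\<close>

definition leq_dec :: "tth \<Rightarrow> ty \<Rightarrow> ty \<Rightarrow> bool" where
  "leq_dec T s t \<longleftrightarrow> wf_ty T s \<and> wf_ty T t \<and>
     (if has_arrow_rules T then arrow_le s [] t else component_le s t)"

lemma leq_iff_leq_dec: "leq T s t \<longleftrightarrow> leq_dec T s t"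
proof
  assume st: "leq T s t"
  show "leq_dec T s t"
    using leq_wf[OF st] leq_imp_arrow_le[OF st] leq_imp_component_le[OF st] by (simp add: leq_dec_def)
next
  assume st: "leq_dec T s t"
  show "leq T s t"
  proof (cases "has_arrow_rules T")
    case True
    with st show ?thesis using arrow_le_imp_leq[of s "[]" t T] by (simp add: leq_dec_def)
  next
    case False
    with st show ?thesis using component_le_imp_leq[of s t T] by (simp add: leq_dec_def)
  qed
qed


section \<open>Computability of the operations on terms and types\<close>

text \<open>The pattern of the recursions below: \<open>calls\<close> decides between
  \<open>base\<close> and \<open>comb\<close>, so each of these may be arbitrary where the other
  applies. A binder makes its one call twice.\<close>

lemma computable_lift [computable_intros]:
  assumes "computable f" "computable g" shows "computable (\<lambda>x. lift (f x) (g x))"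
proof -
  have "computable (\<lambda>p. lift (fst p) (snd p))"
    by (rule computable_recursion[where m = "\<lambda>p. size (fst p)"
        and calls = "\<lambda>p. case fst p of FV x \<Rightarrow> None | BV i \<Rightarrow> None
          | Abs s \<Rightarrow> Some ((s, Suc (snd p)), (s, Suc (snd p)))
          | App s t \<Rightarrow> Some ((s, snd p), (t, snd p))"
        and base = "\<lambda>p. case fst p of FV x \<Rightarrow> FV x
          | BV i \<Rightarrow> if i < snd p then BV i else BV (Suc i) | Abs s \<Rightarrow> undefined | App s t \<Rightarrow> undefined"
        and comb = "\<lambda>p v1 v2. case fst p of FV x \<Rightarrow> undefined | BV i \<Rightarrow> undefined
          | Abs s \<Rightarrow> Abs v1 | App s t \<Rightarrow> App v1 v2"])
      ((intro computable_intros)?; auto split: lterm.splits)+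
  from computable_comp[OF this, of "\<lambda>x. (f x, g x)"] show ?thesis
    by (simp add: computable_Pair assms)
qed

lemma computable_subst [computable_intros]:
  assumes "computable f" "computable g" "computable h" shows "computable (\<lambda>x. subst (f x) (g x) (h x))"
proof -
  have "computable (\<lambda>p. subst (fst p) (fst (snd p)) (snd (snd p)))"
    by (rule computable_recursion[where m = "\<lambda>p. size (fst p)"
        and calls = "\<lambda>p. case fst p of FV x \<Rightarrow> None | BV i \<Rightarrow> None
          | Abs s \<Rightarrow> Some ((s, lift (fst (snd p)) 0, Suc (snd (snd p))), (s, lift (fst (snd p)) 0, Suc (snd (snd p))))
          | App s t \<Rightarrow> Some ((s, snd p), (t, snd p))"
        and base = "\<lambda>p. case fst p of FV x \<Rightarrow> FV x
          | BV i \<Rightarrow> (if snd (snd p) < i then BV (i - 1) else if i = snd (snd p) then fst (snd p) else BV i)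
          | Abs s \<Rightarrow> undefined | App s t \<Rightarrow> undefined"
        and comb = "\<lambda>p v1 v2. case fst p of FV x \<Rightarrow> undefined | BV i \<Rightarrow> undefined
          | Abs s \<Rightarrow> Abs v1 | App s t \<Rightarrow> App v1 v2"])
      ((intro computable_intros)?; auto split: lterm.splits)+
  from computable_comp[OF this, of "\<lambda>x. (f x, g x, h x)"] show ?thesis
    by (simp add: computable_Pair assms)
qed

lemma computable_loose [computable_intros]:
  assumes "computable f" "computable g" shows "computable (\<lambda>x. loose (f x) (g x))"
proof -
  have "computable (\<lambda>p. loose (fst p) (snd p))"
    by (rule computable_recursion[where m = "\<lambda>p. size (fst p)"
        and calls = "\<lambda>p. case fst p of FV x \<Rightarrow> None | BV i \<Rightarrow> None
          | Abs s \<Rightarrow> Some ((s, Suc (snd p)), (s, Suc (snd p)))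
          | App s t \<Rightarrow> Some ((s, snd p), (t, snd p))"
        and base = "\<lambda>p. fst p = BV (snd p)" and comb = "\<lambda>p v1 v2. v1 \<or> v2"])
      ((intro computable_intros)?; auto split: lterm.splits)+
  from computable_comp[OF this, of "\<lambda>x. (f x, g x)"] show ?thesis
    by (simp add: computable_Pair assms)
qed

lemma computable_abst [computable_intros]:
  assumes "computable f" "computable g" "computable h" shows "computable (\<lambda>x. abst (f x) (g x) (h x))"
proof -
  have "computable (\<lambda>p. abst (fst (snd p)) (snd (snd p)) (fst p))"
    by (rule computable_recursion[where m = "\<lambda>p. size (fst p)"
        and calls = "\<lambda>p. case fst p of FV x \<Rightarrow> None | BV i \<Rightarrow> None
          | Abs s \<Rightarrow> Some ((s, fst (snd p), Suc (snd (snd p))), (s, fst (snd p), Suc (snd (snd p))))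
          | App s t \<Rightarrow> Some ((s, snd p), (t, snd p))"
        and base = "\<lambda>p. if fst p = FV (fst (snd p)) then BV (snd (snd p)) else fst p"
        and comb = "\<lambda>p v1 v2. case fst p of FV x \<Rightarrow> undefined | BV i \<Rightarrow> undefined
          | Abs s \<Rightarrow> Abs v1 | App s t \<Rightarrow> App v1 v2"])
      ((intro computable_intros)?; auto split: lterm.splits)+
  from computable_comp[OF this, of "\<lambda>x. (h x, f x, g x)"] show ?thesis
    by (simp add: computable_Pair assms)
qed

lemma computable_ess [computable_intros]:
  assumes "computable f" shows "computable (\<lambda>x. ess (f x))"
proof -
  have "computable ess"
    by (rule computable_recursion[where m = size
        and calls = "\<lambda>D. case D of U D \<Rightarrow> Some (D, D) | Var x \<Rightarrow> None | Lam x s D \<Rightarrow> Some (D, D)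
          | Ap D E \<Rightarrow> Some (D, E) | dterm.Pair D E \<Rightarrow> Some (D, E) | Pr1 D \<Rightarrow> Some (D, D)
          | Pr2 D \<Rightarrow> Some (D, D) | Coer D s \<Rightarrow> Some (D, D)"
        and base = "\<lambda>D. case D of U D \<Rightarrow> undefined | Var x \<Rightarrow> FV x | Lam x s D \<Rightarrow> undefined
          | Ap D E \<Rightarrow> undefined | dterm.Pair D E \<Rightarrow> undefined | Pr1 D \<Rightarrow> undefined
          | Pr2 D \<Rightarrow> undefined | Coer D s \<Rightarrow> undefined"
        and comb = "\<lambda>D v1 v2. case D of U D \<Rightarrow> v1 | Var x \<Rightarrow> undefined
          | Lam x s D \<Rightarrow> Abs (abst x 0 v1) | Ap D E \<Rightarrow> App v1 v2 | dterm.Pair D E \<Rightarrow> v1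
          | Pr1 D \<Rightarrow> v1 | Pr2 D \<Rightarrow> v1 | Coer D s \<Rightarrow> v1"])
      ((intro computable_intros)?; auto split: dterm.splits)+
  then show ?thesis using assms by (rule computable_comp)
qed

lemma computable_wf_ty [computable_intros]:
  assumes "computable f" shows "computable (\<lambda>x. wf_ty T (f x))"
proof -
  have atom: "wf_ty T (Atom a) \<longleftrightarrow> a \<noteq> Omega \<or> has_omega T" for a
    by (cases a) auto
  have "computable (wf_ty T)"
    by (rule computable_recursion[where m = size
        and calls = "\<lambda>s. case s of Atom a \<Rightarrow> None | Arr s t \<Rightarrow> Some (s, t) | Inter s t \<Rightarrow> Some (s, t)"
        and base = "\<lambda>s. s \<noteq> om \<or> has_omega T" and comb = "\<lambda>s v1 v2. v1 \<and> v2"])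
      ((intro computable_intros)?; auto simp: atom simp del: wf_ty.simps(1) split: ty.splits)+
  then show ?thesis using assms by (rule computable_comp)
qed

lemma computable_component_le:
  assumes "computable f" "computable g" shows "computable (\<lambda>x. component_le (f x) (g x))"
proof -
  have atom: "component_le (Atom b) (Atom a) \<longleftrightarrow> a = Omega \<or> b = a"
    and arr: "component_le (Arr c d) (Atom a) \<longleftrightarrow> a = Omega"
    and inter: "component_le (Inter s1 s2) (Atom a) \<longleftrightarrow>
      a = Omega \<or> component_le s1 (Atom a) \<or> component_le s2 (Atom a)" for a b c d s1 s2
    by (cases a; simp)+
  have "computable (\<lambda>p. component_le (fst p) (snd p))"
  proof (rule computable_recursion[where m = "\<lambda>p. size (fst p) + size (snd p)"
        and calls = "\<lambda>p. case snd p of Inter t1 t2 \<Rightarrow> Some ((fst p, t1), (fst p, t2))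
          | Atom a \<Rightarrow> if a = Omega then None else (case fst p of
              Inter s1 s2 \<Rightarrow> Some ((s1, snd p), (s2, snd p)) | Atom a \<Rightarrow> None | Arr c d \<Rightarrow> None)
          | Arr c d \<Rightarrow> (case fst p of
              Inter s1 s2 \<Rightarrow> Some ((s1, snd p), (s2, snd p)) | Atom a \<Rightarrow> None | Arr c d \<Rightarrow> None)"
        and base = "\<lambda>p. snd p = om \<or> fst p = snd p"
        and comb = "\<lambda>p v1 v2. case snd p of Inter t1 t2 \<Rightarrow> v1 \<and> v2 | Atom a \<Rightarrow> v1 \<or> v2
          | Arr c d \<Rightarrow> v1 \<or> v2"], goal_cases)
    case (5 p)
    then show ?case by (cases p) (auto simp: atom arr split: ty.splits if_splits)
  next
    case (6 p y z)
    then show ?case by (cases p) (auto simp: inter split: ty.splits if_splits)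
  qed ((intro computable_intros)?; auto split: ty.splits if_splits)+
  from computable_comp[OF this, of "\<lambda>x. (f x, g x)"] show ?thesis
    by (simp add: computable_Pair assms)
qed

lemma computable_arrow_le:
  assumes "computable f" "computable g" "computable h"
  shows "computable (\<lambda>x. arrow_le (f x) (g x) (h x))"
proof -
  have om: "arrow_le s cs (Atom a) \<longleftrightarrow> True" if "a = Omega" for s cs a
    using that by simp
  have inter: "arrow_le (Inter s1 s2) cs (Atom a) \<longleftrightarrow> arrow_le s1 cs (Atom a) \<or> arrow_le s2 cs (Atom a)"
    for s1 s2 cs a by (cases a) auto
  have atom: "arrow_le (Atom b) cs (Atom a) \<longleftrightarrow> a = Omega \<or> cs = [] \<and> b = a" for a b cs
    by (cases a) auto
  have nil: "arrow_le (Arr c d) [] (Atom a) \<longleftrightarrow> a = Omega" for c d a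
    by (cases a) auto
  have cons: "arrow_le (Arr c d) (c' # cs) (Atom a) \<longleftrightarrow> arrow_le c' [] c \<and> arrow_le d cs (Atom a)"
    if "a \<noteq> Omega" for c d c' cs a
    using that by (cases a) auto
  have "computable (\<lambda>p. arrow_le (fst p) (fst (snd p)) (snd (snd p)))"
  proof (rule computable_recursion[
        where m = "\<lambda>p. size (fst p) + (\<Sum>c\<leftarrow>fst (snd p). size c) + size (snd (snd p))"
        and calls = "\<lambda>p. case snd (snd p) of
            Inter t1 t2 \<Rightarrow> Some ((fst p, fst (snd p), t1), (fst p, fst (snd p), t2))
          | Arr c d \<Rightarrow> Some ((fst p, fst (snd p) @ [c], d), (fst p, fst (snd p) @ [c], d))
          | Atom a \<Rightarrow> if a = Omega then None else (case fst p of
              Inter s1 s2 \<Rightarrow> Some ((s1, snd p), (s2, snd p))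
            | Atom a \<Rightarrow> None
            | Arr c d \<Rightarrow> (case fst (snd p) of [] \<Rightarrow> None
                | c' # cs \<Rightarrow> Some ((c', [], c), (d, cs, snd (snd p)))))"
        and base = "\<lambda>p. snd (snd p) = om \<or> fst (snd p) = [] \<and> fst p = snd (snd p)"
        and comb = "\<lambda>p v1 v2. case snd (snd p) of Inter t1 t2 \<Rightarrow> v1 \<and> v2 | Arr c d \<Rightarrow> v1
          | Atom a \<Rightarrow> (case fst p of Inter s1 s2 \<Rightarrow> v1 \<or> v2 | Atom a \<Rightarrow> v1 | Arr c d \<Rightarrow> v1 \<and> v2)"], goal_cases)
    case (5 p)
    then show ?case by (cases p) (auto simp: atom nil split: ty.splits if_splits list.splits)
  next
    case (6 p y z)
    then show ?case by (cases p) (auto simp: inter cons split: ty.splits if_splits list.splits)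
  qed ((intro computable_intros)?; auto split: ty.splits if_splits list.splits)+
  from computable_comp[OF this, of "\<lambda>x. (f x, g x, h x)"] show ?thesis
    by (simp add: computable_Pair assms)
qed

lemma computable_leq [computable_intros]:
  assumes "computable f" "computable g" shows "computable (\<lambda>x. leq T (f x) (g x))"
  unfolding leq_iff_leq_dec leq_dec_def
  by (intro computable_intros computable_arrow_le computable_component_le assms)


section \<open>Searching for normal forms\<close>

fun beta_reducts :: "lterm \<Rightarrow> lterm list" where
  "beta_reducts (FV x) = []"
| "beta_reducts (BV i) = []"
| "beta_reducts (Abs s) = map Abs (beta_reducts s)"
| "beta_reducts (App s t) = (case s of Abs p \<Rightarrow> [subst p t 0] | _ \<Rightarrow> []) @
     map (\<lambda>s'. App s' t) (beta_reducts s) @ map (\<lambda>t'. App s t') (beta_reducts t)"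

fun eta_reducts :: "lterm \<Rightarrow> lterm list" where
  "eta_reducts (FV x) = []"
| "eta_reducts (BV i) = []"
| "eta_reducts (Abs s) =
     (case s of App p q \<Rightarrow> if q = BV 0 \<and> \<not> loose p 0 then [subst p (BV 0) 0] else [] | _ \<Rightarrow> []) @
     map Abs (eta_reducts s)"
| "eta_reducts (App s t) =
     map (\<lambda>s'. App s' t) (eta_reducts s) @ map (\<lambda>t'. App s t') (eta_reducts t)"

fun reducts :: "eqrel \<Rightarrow> lterm \<Rightarrow> lterm list" where
  "reducts Syn s = []"
| "reducts Beta s = beta_reducts s"
| "reducts BetaEta s = beta_reducts s @ eta_reducts s"

lemma set_beta_reducts: "t \<in> set (beta_reducts s) \<longleftrightarrow> beta s t"
proof
  show "t \<in> set (beta_reducts s) \<Longrightarrow> beta s t"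
    by (induction s arbitrary: t) (auto intro: beta.intros split: lterm.splits)
  show "beta s t \<Longrightarrow> t \<in> set (beta_reducts s)"
    by (induction rule: beta.induct) auto
qed

lemma set_eta_reducts: "t \<in> set (eta_reducts s) \<longleftrightarrow> eta s t"
proof
  show "t \<in> set (eta_reducts s) \<Longrightarrow> eta s t"
    by (induction s arbitrary: t) (auto intro: eta.intros split: lterm.splits if_splits)
  show "eta s t \<Longrightarrow> t \<in> set (eta_reducts s)"
    by (induction rule: eta.induct) auto
qed

lemma set_reducts: "t \<in> set (reducts R s) \<longleftrightarrow> step R s t"
  by (cases R) (auto simp: set_beta_reducts set_eta_reducts)

lemma computable_reducts [computable_intros]:
  assumes "computable f" shows "computable (\<lambda>x. reducts R (f x))"
proof -
  have beta: "computable beta_reducts"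
    by (rule computable_recursion[where m = size
        and calls = "\<lambda>s. case s of FV x \<Rightarrow> None | BV i \<Rightarrow> None | Abs s \<Rightarrow> Some (s, s) | App s t \<Rightarrow> Some (s, t)"
        and base = "\<lambda>s. []"
        and comb = "\<lambda>s v1 v2. case s of FV x \<Rightarrow> [] | BV i \<Rightarrow> [] | Abs s \<Rightarrow> map (\<lambda>s'. Abs s') v1
          | App s t \<Rightarrow> (case s of FV x \<Rightarrow> [] | BV i \<Rightarrow> [] | Abs p \<Rightarrow> [subst p t 0] | App p q \<Rightarrow> []) @
              map (\<lambda>s'. App s' t) v1 @ map (\<lambda>t'. App s t') v2"])
      ((intro computable_intros)?; auto split: lterm.splits)+
  have eta: "computable eta_reducts"
    by (rule computable_recursion[where m = size
        and calls = "\<lambda>s. case s of FV x \<Rightarrow> None | BV i \<Rightarrow> None | Abs s \<Rightarrow> Some (s, s) | App s t \<Rightarrow> Some (s, t)"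
        and base = "\<lambda>s. []"
        and comb = "\<lambda>s v1 v2. case s of FV x \<Rightarrow> [] | BV i \<Rightarrow> []
          | Abs s \<Rightarrow> (case s of FV x \<Rightarrow> [] | BV i \<Rightarrow> [] | Abs p \<Rightarrow> []
              | App p q \<Rightarrow> if q = BV 0 \<and> \<not> loose p 0 then [subst p (BV 0) 0] else []) @ map (\<lambda>s'. Abs s') v1
          | App s t \<Rightarrow> map (\<lambda>s'. App s' t) v1 @ map (\<lambda>t'. App s t') v2"])
      ((intro computable_intros)?; auto split: lterm.splits)+
  show ?thesis
    by (cases R) (simp_all add: computable_intros computable_comp[OF beta] computable_comp[OF eta] assms)
qed

text \<open>Breadth-first search in which each stage keeps the earlier terms, so that membership is
  monotone in \<open>n\<close>. The form with \<open>rec_nat\<close> makes computability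
  immediate.\<close>

definition reachable :: "eqrel \<Rightarrow> nat \<Rightarrow> lterm \<Rightarrow> lterm list" where
  "reachable R n s = rec_nat [s] (\<lambda>_ l. l @ concat (map (\<lambda>t. reducts R t) l)) n"

lemma reachable_0 [simp]: "reachable R 0 s = [s]"
  and reachable_Suc [simp]:
    "reachable R (Suc n) s = reachable R n s @ concat (map (reducts R) (reachable R n s))"
  by (simp_all add: reachable_def)

lemma reachable_sound: "t \<in> set (reachable R n s) \<Longrightarrow> (step R)\<^sup>*\<^sup>* s t"
  by (induction n arbitrary: t) (auto simp: set_reducts intro: rtranclp.rtrancl_into_rtrancl)

lemma reachable_complete:
  assumes "(step R)\<^sup>*\<^sup>* s t" shows "\<exists>n. \<forall>m\<ge>n. t \<in> set (reachable R m s)"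
proof -
  have mono: "m \<ge> n \<Longrightarrow> set (reachable R n s) \<subseteq> set (reachable R m s)" for m n
    by (induction m) (auto simp: le_Suc_eq)
  have "\<exists>n. t \<in> set (reachable R n s)"
    using assms
  proof induction
    case base
    have "s \<in> set (reachable R 0 s)" by simp
    then show ?case by blast
  next
    case (step t u)
    then obtain n where "t \<in> set (reachable R n s)" by blast
    with step.hyps(2) have "u \<in> set (reachable R (Suc n) s)" by (auto simp: set_reducts)
    then show ?case by blast
  qed
  with mono show ?thesis by blast
qed

definition find_nf :: "eqrel \<Rightarrow> nat \<Rightarrow> lterm \<Rightarrow> lterm option" where
  "find_nf R n s = (case filter (\<lambda>t. reducts R t = []) (reachable R n s) of [] \<Rightarrow> None | t # _ \<Rightarrow> Some t)"

lemma normal_iff_reducts: "normal R t \<longleftrightarrow> reducts R t = []"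
  unfolding normal_def by (metis last_in_set list.set(1) empty_iff set_reducts)

lemma find_nf_sound:
  assumes "find_nf R n s = Some t" shows "normal_form R s t"
proof -
  from assms obtain ts where "filter (\<lambda>t. reducts R t = []) (reachable R n s) = t # ts"
    unfolding find_nf_def by (auto split: list.splits)
  then have "t \<in> set (filter (\<lambda>t. reducts R t = []) (reachable R n s))"
    by (metis list.set_intros(1))
  then show ?thesis by (auto simp: normal_form_def normal_iff_reducts dest: reachable_sound)
qed

text \<open>By uniqueness the first normal term found is \<open>t\<close>. The answer persists at
  later stages, so that finitely many searches can share one stage.\<close>

lemma find_nf_complete:
  assumes "normal_form R s t" shows "\<exists>n. \<forall>m\<ge>n. find_nf R m s = Some t"
proof -
  obtain n where n: "\<And>m. m \<ge> n \<Longrightarrow> t \<in> set (reachable R m s)"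
    using assms reachable_complete unfolding normal_form_def by blast
  have "find_nf R m s = Some t" if "m \<ge> n" for m
  proof -
    have "t \<in> set (filter (\<lambda>t. reducts R t = []) (reachable R m s))"
      using n[OF that] assms by (simp add: normal_form_def normal_iff_reducts)
    then have "filter (\<lambda>t. reducts R t = []) (reachable R m s) \<noteq> []"
      by (metis empty_iff list.set(1))
    then obtain u where "find_nf R m s = Some u"
      by (cases "filter (\<lambda>t. reducts R t = []) (reachable R m s)") (simp_all add: find_nf_def)
    with find_nf_sound normal_form_unique assms show ?thesis by metis
  qed
  then show ?thesis by blast
qed

text \<open>Three-valued: \<open>None\<close> means that stage \<open>n\<close> is too early for a
  verdict.\<close>

definition conv_test :: "eqrel \<Rightarrow> nat \<Rightarrow> lterm \<times> lterm \<Rightarrow> bool option" where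
  "conv_test R n p = (case find_nf R n (fst p) of None \<Rightarrow> None
     | Some a \<Rightarrow> (case find_nf R n (snd p) of None \<Rightarrow> None | Some b \<Rightarrow> Some (a = b)))"

lemma conv_test_sound: "conv_test R n p = Some b \<Longrightarrow> rel_holds R (fst p) (snd p) \<longleftrightarrow> b"
  unfolding conv_test_def
  by (auto split: option.splits dest!: find_nf_sound simp: rel_holds_iff_normal_form)

lemma conv_test_complete:
  assumes "WN R (fst p)" "WN R (snd p)"
  shows "\<exists>n. \<forall>m\<ge>n. conv_test R m p = Some (rel_holds R (fst p) (snd p))"
proof -
  obtain a b where ab: "normal_form R (fst p) a" "normal_form R (snd p) b"
    using assms unfolding WN_def by blast
  then obtain n1 n2 where "\<forall>m\<ge>n1. find_nf R m (fst p) = Some a" "\<forall>m\<ge>n2. find_nf R m (snd p) = Some b"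
    by (meson find_nf_complete)
  then have "\<forall>m\<ge>max n1 n2. conv_test R m p = Some (rel_holds R (fst p) (snd p))"
    using rel_holds_iff_normal_form[OF ab] by (simp add: conv_test_def)
  then show ?thesis by blast
qed

lemma computable_conv_test [computable_intros]:
  assumes "computable f" "computable g" shows "computable (\<lambda>x. conv_test R (f x) (g x))"
  unfolding conv_test_def find_nf_def reachable_def
  by (intro computable_intros computable_comp[OF assms(1)] computable_comp[OF assms(2)])


section \<open>Decidability\<close>

text \<open>The side conditions on essences are collected separately, since the search for a normal form
  may diverge on the essence of an untypable term.\<close>

fun skeleton_type :: "tth \<Rightarrow> basis \<Rightarrow> dterm \<Rightarrow> ty option" where
  "skeleton_type T B (U D) = (if has_omega T then Some om else None)"
| "skeleton_type T B (Var x) = map_of B x"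
| "skeleton_type T B (Lam x s D) = (if wf_ty T s then
     (case skeleton_type T ((x, s) # B) D of None \<Rightarrow> None | Some t \<Rightarrow> Some (Arr s t)) else None)"
| "skeleton_type T B (Ap D E) = (case skeleton_type T B D of None \<Rightarrow> None
     | Some u \<Rightarrow> (case u of Atom a \<Rightarrow> None | Inter s t \<Rightarrow> None
         | Arr s t \<Rightarrow> (if skeleton_type T B E = Some s then Some t else None)))"
| "skeleton_type T B (dterm.Pair D E) = (case skeleton_type T B D of None \<Rightarrow> None
     | Some s \<Rightarrow> (case skeleton_type T B E of None \<Rightarrow> None | Some t \<Rightarrow> Some (Inter s t)))"
| "skeleton_type T B (Pr1 D) = (case skeleton_type T B D of None \<Rightarrow> None
     | Some u \<Rightarrow> (case u of Atom a \<Rightarrow> None | Inter s t \<Rightarrow> Some s | Arr s t \<Rightarrow> None))"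
| "skeleton_type T B (Pr2 D) = (case skeleton_type T B D of None \<Rightarrow> None
     | Some u \<Rightarrow> (case u of Atom a \<Rightarrow> None | Inter s t \<Rightarrow> Some t | Arr s t \<Rightarrow> None))"
| "skeleton_type T B (Coer D t) = (case skeleton_type T B D of None \<Rightarrow> None
     | Some s \<Rightarrow> if leq T s t then Some t else None)"

text \<open>\<open>U D\<close> contributes nothing, since its typing rule does not look into
  \<open>D\<close>.\<close>

fun side_conditions :: "dterm \<Rightarrow> (lterm \<times> lterm) list" where
  "side_conditions (U D) = []"
| "side_conditions (Var x) = []"
| "side_conditions (Lam x s D) = side_conditions D"
| "side_conditions (Ap D E) = side_conditions D @ side_conditions E"
| "side_conditions (dterm.Pair D E) = (ess D, ess E) # side_conditions D @ side_conditions E"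
| "side_conditions (Pr1 D) = side_conditions D"
| "side_conditions (Pr2 D) = side_conditions D"
| "side_conditions (Coer D s) = side_conditions D"


text \<open>Each term constructor has exactly one typing rule, so typability splits into a computed
  type, which is unique, and a list of conversion problems.\<close>

lemma typing_imp_skeleton:
  "typing T R B D s \<Longrightarrow> skeleton_type T B D = Some s \<and> (\<forall>p \<in> set (side_conditions D). rel_holds R (fst p) (snd p))"
  by (induction rule: typing.induct) auto

lemma skeleton_imp_typing:
  "skeleton_type T B D = Some s \<Longrightarrow> \<forall>p \<in> set (side_conditions D). rel_holds R (fst p) (snd p) \<Longrightarrow>
   typing T R B D s"
  by (induction D arbitrary: B s)
    (fastforce intro: typing.intros split: if_splits option.splits ty.splits)+

definition refuted :: "eqrel \<Rightarrow> nat \<Rightarrow> dterm \<Rightarrow> bool" where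
  "refuted R n D \<longleftrightarrow> list_ex (\<lambda>p. conv_test R n p = Some False) (side_conditions D)"

definition confirmed :: "eqrel \<Rightarrow> nat \<Rightarrow> dterm \<Rightarrow> bool" where
  "confirmed R n D \<longleftrightarrow> list_all (\<lambda>p. conv_test R n p = Some True) (side_conditions D)"

text \<open>The key to termination. If nothing is ever refuted, the components of a pair are typable
  by induction, so their essences normalise and the comparison reaches a verdict, which must be
  positive. On other conditions the search may run forever.\<close>

lemma refuted_or_typing:
  assumes "R = Syn \<or> \<not> has_omega T"
  shows "skeleton_type T B D = Some s \<Longrightarrow> (\<exists>n. refuted R n D) \<or> typing T R B D s"
proof (induction D arbitrary: B s)
  case (Pair D E)
  from Pair.prems obtain t u where tu: "skeleton_type T B D = Some t" "skeleton_type T B E = Some u"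
    "s = Inter t u" by (auto split: option.splits)
  show ?case
  proof (cases "\<exists>n. refuted R n (dterm.Pair D E)")
    case False
    \<comment> \<open>The side conditions of a component are among those of the pair.\<close>
    then have "\<nexists>n. refuted R n D" "\<nexists>n. refuted R n E" by (auto simp: refuted_def)
    with Pair.IH tu have well: "typing T R B D t" "typing T R B E u" by blast+
    then obtain n where "conv_test R n (ess D, ess E) = Some (rel_holds R (ess D) (ess E))"
      using conv_test_complete[of R "(ess D, ess E)"] typing_WN[OF _ assms] by auto
    moreover from this False have "rel_holds R (ess D) (ess E)"
      by (cases "rel_holds R (ess D) (ess E)") (auto simp: refuted_def)
    ultimately show ?thesis using well tu by (auto intro: typing.intros)
  qed blast
next
  case (Ap D E)
  then obtain t where t: "skeleton_type T B D = Some (Arr t s)" "skeleton_type T B E = Some t"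
    by (auto split: option.splits ty.splits if_splits)
  then show ?case using Ap.IH(1)[OF t(1)] Ap.IH(2)[OF t(2)]
    by (auto simp: refuted_def intro: typing.intros)
qed (fastforce simp: refuted_def intro: typing.intros split: if_splits option.splits ty.splits)+

text \<open>A confirmation needs all conditions settled at the same stage; as verdicts persist, the
  maximum of the individual stages will do.\<close>

lemma typing_confirmed:
  assumes "typing T R B D s" "R = Syn \<or> \<not> has_omega T"
  shows "\<exists>n. \<forall>m\<ge>n. confirmed R m D"
  using assms
proof (induction rule: typing.induct)
  case (t_appE T R B D1 s t D2)
  then obtain n1 n2 where "\<forall>m\<ge>n1. confirmed R m D1" "\<forall>m\<ge>n2. confirmed R m D2" by blast
  then have "\<forall>m\<ge>max n1 n2. confirmed R m (Ap D1 D2)" by (simp add: confirmed_def)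
  then show ?case by blast
next
  case (t_interI T R B D1 s D2 t)
  then obtain n1 n2 where "\<forall>m\<ge>n1. confirmed R m D1" "\<forall>m\<ge>n2. confirmed R m D2" by blast
  moreover obtain n3 where "\<forall>m\<ge>n3. conv_test R m (ess D1, ess D2) = Some True"
    using conv_test_complete[of R "(ess D1, ess D2)"] typing_WN t_interI by auto
  ultimately have "\<forall>m\<ge>max n1 (max n2 n3). confirmed R m (dterm.Pair D1 D2)"
    by (simp add: confirmed_def)
  then show ?case by blast
qed (auto simp: confirmed_def)

section \<open>The decision procedure\<close>

definition decided :: "tth \<Rightarrow> eqrel \<Rightarrow> basis \<Rightarrow> dterm \<Rightarrow> nat \<Rightarrow> bool" where
  "decided T R B D n \<longleftrightarrow> skeleton_type T B D = None \<or> refuted R n D \<or> confirmed R n D"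

lemma ex_decided:
  assumes "R = Syn \<or> \<not> has_omega T" shows "\<exists>n. decided T R B D n"
  using refuted_or_typing[OF assms] typing_confirmed[OF _ assms] unfolding decided_def
  by (metis not_None_eq order_refl)

text \<open>A missing skeleton type needs no test of its own: both branches then give
  \<open>None\<close>.\<close>

definition infer :: "tth \<Rightarrow> eqrel \<Rightarrow> basis \<Rightarrow> dterm \<Rightarrow> ty option" where
  "infer T R B D = (if confirmed R (LEAST n. decided T R B D n) D then skeleton_type T B D else None)"

lemma infer_iff_typing:
  assumes "R = Syn \<or> \<not> has_omega T"
  shows "infer T R B D = Some s \<longleftrightarrow> typing T R B D s"
proof -
  let ?n = "LEAST n. decided T R B D n"
  have n: "decided T R B D ?n" using ex_decided[OF assms] by (rule LeastI_ex)
  show ?thesis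
  proof
    assume "infer T R B D = Some s"
    then have "skeleton_type T B D = Some s" "confirmed R ?n D"
      by (auto simp: infer_def split: if_splits)
    then show "typing T R B D s"
      by (intro skeleton_imp_typing) (auto simp: confirmed_def list_all_iff dest!: conv_test_sound)
  next
    assume "typing T R B D s"
    then have s: "skeleton_type T B D = Some s"
      "\<forall>p \<in> set (side_conditions D). rel_holds R (fst p) (snd p)"
      by (simp_all add: typing_imp_skeleton)
    then have "\<not> refuted R ?n D" by (auto simp: refuted_def list_ex_iff dest!: conv_test_sound)
    with s n show "infer T R B D = Some s" by (simp add: infer_def decided_def)
  qed
qed

lemma computable_side_conditions:
  assumes "computable f" shows "computable (\<lambda>x. side_conditions (f x))"
proof -
  have "computable side_conditions"
    by (rule computable_recursion[where m = size
        and calls = "\<lambda>D. case D of U D \<Rightarrow> None | Var x \<Rightarrow> None | Lam x s D \<Rightarrow> Some (D, D)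
          | Ap D E \<Rightarrow> Some (D, E) | dterm.Pair D E \<Rightarrow> Some (D, E) | Pr1 D \<Rightarrow> Some (D, D)
          | Pr2 D \<Rightarrow> Some (D, D) | Coer D s \<Rightarrow> Some (D, D)"
        and base = "\<lambda>D. []"
        and comb = "\<lambda>D v1 v2. case D of U D \<Rightarrow> [] | Var x \<Rightarrow> [] | Lam x s D \<Rightarrow> v1
          | Ap D E \<Rightarrow> v1 @ v2 | dterm.Pair D E \<Rightarrow> (ess D, ess E) # v1 @ v2
          | Pr1 D \<Rightarrow> v1 | Pr2 D \<Rightarrow> v1 | Coer D s \<Rightarrow> v1"])
      ((intro computable_intros)?; auto split: dterm.splits)+
  then show ?thesis using assms by (rule computable_comp)
qed

lemma computable_skeleton_type:
  assumes "computable f" "computable g" shows "computable (\<lambda>x. skeleton_type T (f x) (g x))"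
proof -
  have "computable (\<lambda>p. skeleton_type T (fst p) (snd p))"
    by (rule computable_recursion[where m = "\<lambda>p. size (snd p)"
        and calls = "\<lambda>p. case snd p of U D \<Rightarrow> None | Var x \<Rightarrow> None
          | Lam x s D \<Rightarrow> Some (((x, s) # fst p, D), ((x, s) # fst p, D))
          | Ap D E \<Rightarrow> Some ((fst p, D), (fst p, E)) | dterm.Pair D E \<Rightarrow> Some ((fst p, D), (fst p, E))
          | Pr1 D \<Rightarrow> Some ((fst p, D), (fst p, D)) | Pr2 D \<Rightarrow> Some ((fst p, D), (fst p, D))
          | Coer D s \<Rightarrow> Some ((fst p, D), (fst p, D))"
        and base = "\<lambda>p. case snd p of U D \<Rightarrow> if has_omega T then Some om else None
          | Var x \<Rightarrow> map_of (fst p) x | Lam x s D \<Rightarrow> None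
          | Ap D E \<Rightarrow> None | dterm.Pair D E \<Rightarrow> None | Pr1 D \<Rightarrow> None | Pr2 D \<Rightarrow> None | Coer D s \<Rightarrow> None"
        and comb = "\<lambda>p v1 v2. case snd p of U D \<Rightarrow> None | Var x \<Rightarrow> None
          | Lam x s D \<Rightarrow> (if wf_ty T s then (case v1 of None \<Rightarrow> None | Some t \<Rightarrow> Some (Arr s t)) else None)
          | Ap D E \<Rightarrow> (case v1 of None \<Rightarrow> None | Some u \<Rightarrow> (case u of Atom a \<Rightarrow> None
              | Arr s t \<Rightarrow> (if v2 = Some s then Some t else None) | Inter s t \<Rightarrow> None))
          | dterm.Pair D E \<Rightarrow> (case v1 of None \<Rightarrow> None | Some s \<Rightarrow>
              (case v2 of None \<Rightarrow> None | Some t \<Rightarrow> Some (Inter s t)))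
          | Pr1 D \<Rightarrow> (case v1 of None \<Rightarrow> None | Some u \<Rightarrow> (case u of Atom a \<Rightarrow> None
              | Arr s t \<Rightarrow> None | Inter s t \<Rightarrow> Some s))
          | Pr2 D \<Rightarrow> (case v1 of None \<Rightarrow> None | Some u \<Rightarrow> (case u of Atom a \<Rightarrow> None
              | Arr s t \<Rightarrow> None | Inter s t \<Rightarrow> Some t))
          | Coer D t \<Rightarrow> (case v1 of None \<Rightarrow> None | Some s \<Rightarrow> if leq T s t then Some t else None)"])
      ((intro computable_intros)?; auto split: dterm.splits option.splits ty.splits)+
  from computable_comp[OF this, of "\<lambda>x. (f x, g x)"] show ?thesis
    by (simp add: computable_Pair assms)
qed

lemma computable_confirmed:
  assumes "computable f" "computable g" shows "computable (\<lambda>x. confirmed R (f x) (g x))"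
  unfolding confirmed_def
  by (intro computable_intros computable_side_conditions computable_comp[OF assms(1)] assms)

lemma computable_refuted:
  assumes "computable f" "computable g" shows "computable (\<lambda>x. refuted R (f x) (g x))"
  unfolding refuted_def
  by (intro computable_intros computable_side_conditions computable_comp[OF assms(1)] assms)

lemma computable_infer:
  assumes "R = Syn \<or> \<not> has_omega T" "computable f" "computable g"
  shows "computable (\<lambda>x. infer T R (f x) (g x))"
proof -
  have "computable (\<lambda>q. decided T R (fst (fst q)) (snd (fst q)) (snd q))"
    unfolding decided_def
    by (intro computable_intros computable_skeleton_type computable_confirmed computable_refuted)
  then have "computable (\<lambda>p. LEAST n. decided T R (fst p) (snd p) n)"
    using ex_decided[OF assms(1)] by (rule computable_Least)
  then have "computable (\<lambda>p. infer T R (fst p) (snd p))"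
    unfolding infer_def
    by (intro computable_if computable_confirmed computable_skeleton_type computable_intros)
  from computable_comp[OF this, of "\<lambda>x. (f x, g x)"] show ?thesis
    by (simp add: computable_Pair assms)
qed

theorem decidable_type_checking:
  assumes "R = Syn \<or> \<not> has_omega T" shows "type_checking_decidable T R"
proof -
  have "computable (\<lambda>p. infer T R (fst p) (fst (snd p)) = Some (snd (snd p)))"
    by (intro computable_intros computable_infer assms)
  then obtain r where "\<And>B D s. eval r [enc (B, D, s)] (enc (infer T R B D = Some s))"
    unfolding computable_def by fastforce
  then show ?thesis
    unfolding type_checking_decidable_def infer_iff_typing[OF assms]
    by (intro exI[of _ r] allI impI) (simp add: enc_basis_eq)
qed

theorem decidable_type_reconstruction:
  assumes "R = Syn \<or> \<not> has_omega T" shows "type_reconstruction_decidable T R"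
proof -
  let ?typable = "\<lambda>p. \<not> infer T R (fst p) (snd p) = None"
  \<comment> \<open>\<open>om\<close> is a mere default for untypable terms, where the
    reconstruction program may return anything.\<close>
  let ?type = "\<lambda>p. case infer T R (fst p) (snd p) of None \<Rightarrow> om | Some s \<Rightarrow> s"
  have "computable ?typable" "computable ?type"
    by (intro computable_intros computable_infer assms)+
  then obtain f g where fg: "\<And>B D. eval f [enc (B, D)] (enc (?typable (B, D)))"
    "\<And>B D. eval g [enc (B, D)] (enc (?type (B, D)))"
    unfolding computable_def by blast
  have iff: "(\<exists>s. typing T R B D s) \<longleftrightarrow> infer T R B D \<noteq> None" for B D
    using infer_iff_typing[OF assms] by (metis not_None_eq)
  have well: "typing T R B D (?type (B, D))" if ok: "infer T R B D \<noteq> None" for B D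
  proof -
    obtain s where s: "infer T R B D = Some s" using ok by blast
    then have "typing T R B D s" using infer_iff_typing[OF assms] by blast
    with s show ?thesis by simp
  qed
  have "eval f [prod_encode (enc_basis B, enc_dterm D)] (if \<exists>s. typing T R B D s then 1 else 0)" for B D
    using fg(1)[of B D] unfolding iff by (simp add: enc_basis_eq)
  moreover have "\<exists>s. eval g [prod_encode (enc_basis B, enc_dterm D)] (enc_ty s) \<and> typing T R B D s"
    if "\<exists>s. typing T R B D s" for B D
    using that fg(2)[of B D] well[of B D] unfolding iff by (auto simp: enc_basis_eq)
  ultimately show ?thesis unfolding type_reconstruction_decidable_def by blast
qed


section \<open>Representing recursive functions by lambda terms\<close>

definition lc :: "lterm \<Rightarrow> bool" where
  "lc s \<longleftrightarrow> (\<forall>i. \<not> loose s i)"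

lemma lc_loose [simp]: "lc s \<Longrightarrow> \<not> loose s i"
  by (simp add: lc_def)

lemma lift_not_loose: "(\<And>i. i \<ge> k \<Longrightarrow> \<not> loose s i) \<Longrightarrow> lift s k = s"
proof (induction s arbitrary: k)
  case (BV i)
  from BV[of i] show ?case by (cases "k \<le> i") auto
next
  case (Abs s)
  have "\<not> loose s i" if "i \<ge> Suc k" for i
    using Abs.prems[of "i - 1"] that by (cases i) auto
  then show ?case using Abs.IH by simp
qed auto

lemma lift_lc [simp]: "lc s \<Longrightarrow> lift s k = s"
  by (simp add: lift_not_loose)

lemma subst_lc [simp]: "lc s \<Longrightarrow> subst s t k = s"
  using subst_lift[of s k t] by simp

definition conv :: "lterm \<Rightarrow> lterm \<Rightarrow> bool" (infix "\<approx>" 50) where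
  "s \<approx> t \<longleftrightarrow> rel_holds Beta s t"

lemma conv_refl [simp]: "s \<approx> s"
  by (simp add: conv_def del: rel_holds.simps)


lemma conv_trans [trans]: "s \<approx> t \<Longrightarrow> t \<approx> u \<Longrightarrow> s \<approx> u"
  unfolding conv_def by (rule rel_holds_trans)

lemma conv_App: "s \<approx> s' \<Longrightarrow> t \<approx> t' \<Longrightarrow> App s t \<approx> App s' t'"
  unfolding conv_def by (rule rel_holds_App)

lemma conv_App_left: "s \<approx> s' \<Longrightarrow> App s t \<approx> App s' t"
  by (simp add: conv_App)

lemma conv_App_right: "t \<approx> t' \<Longrightarrow> App s t \<approx> App s t'"
  by (simp add: conv_App)

lemma conv_beta: "App (Abs s) t \<approx> subst s t 0"
  unfolding conv_def by (intro rel_holds_beta b_redex) simp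

lemma conv_beta2: "App (App (Abs (Abs s)) t) u \<approx> subst (subst s (lift t 0) (Suc 0)) u 0"
  by (rule conv_trans[OF conv_App_left[OF conv_beta]]) (simp add: conv_beta)

text \<open>Curry's fixed point combinator applied to \<open>F\<close> and contracted once, so that
  unfolding is a single beta step.\<close>

definition fixp :: "lterm \<Rightarrow> lterm" where
  "fixp F = App (Abs (App F (App (BV 0) (BV 0)))) (Abs (App F (App (BV 0) (BV 0))))"

lemma lc_fixp [simp]: "lc F \<Longrightarrow> lc (fixp F)"
  by (simp add: lc_def fixp_def)

lemma fixp_conv: "lc F \<Longrightarrow> fixp F \<approx> App F (fixp F)"
  unfolding fixp_def by (rule conv_trans[OF conv_beta]) simp

text \<open>Scott encodings: \<open>0 = \<lambda>s z. z\<close>, \<open>n + 1 = \<lambda>s z. s n\<close>, \<open>[] = \<lambda>c n. n\<close>,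
  \<open>a # l = \<lambda>c n. c a l\<close>.\<close>

fun num :: "nat \<Rightarrow> lterm" where
  "num 0 = Abs (Abs (BV 0))"
| "num (Suc n) = Abs (Abs (App (BV 1) (num n)))"

fun lst :: "nat list \<Rightarrow> lterm" where
  "lst [] = Abs (Abs (BV 0))"
| "lst (a # l) = Abs (Abs (App (App (BV 1) (num a)) (lst l)))"

lemma lc_num [simp]: "lc (num n)"
  by (induction n) (simp_all add: lc_def)

lemma lc_lst [simp]: "lc (lst l)"
  by (induction l) (simp_all add: lc_def lc_num[unfolded lc_def])

lemma num_0_conv: "App (App (num 0) s) z \<approx> z"
  by (simp, rule conv_trans[OF conv_beta2]) simp

lemma num_Suc_conv: "App (App (num (Suc n)) s) z \<approx> App s (num n)"
  by (simp, rule conv_trans[OF conv_beta2]) simp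

lemma lst_Cons_conv: "App (App (lst (a # l)) c) n \<approx> App (App c (num a)) (lst l)"
  by (simp, rule conv_trans[OF conv_beta2]) simp

definition SUC :: lterm where
  "SUC = Abs (Abs (Abs (App (BV 1) (BV 2))))"

definition CONS :: lterm where
  "CONS = Abs (Abs (Abs (Abs (App (App (BV 1) (BV 3)) (BV 2)))))"

lemma lc_SUC [simp]: "lc SUC" and lc_CONS [simp]: "lc CONS"
  by (simp_all add: lc_def SUC_def CONS_def)

lemma SUC_conv: "App SUC (num n) \<approx> num (Suc n)"
  unfolding SUC_def by (rule conv_trans[OF conv_beta]) simp

lemma CONS_conv: "App (App CONS (num a)) (lst l) \<approx> lst (a # l)"
  unfolding CONS_def by (rule conv_trans[OF conv_beta2]) (simp add: eval_nat_numeral)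

declare num.simps [simp del] lst.simps [simp del]

text \<open>A Scott list performs its own case analysis; \<open>num 0\<close> is the answer for the
  empty list, which an index in range never meets.\<close>

fun nth_rep :: "nat \<Rightarrow> lterm" where
  "nth_rep 0 = Abs (App (App (BV 0) (Abs (Abs (BV 1)))) (num 0))"
| "nth_rep (Suc i) = Abs (App (App (BV 0) (Abs (Abs (App (nth_rep i) (BV 0))))) (num 0))"

lemma lc_nth_rep [simp]: "lc (nth_rep i)"
  by (induction i) (simp_all add: lc_def lc_num[unfolded lc_def])

lemma lst_Cons_beta_conv:
  "App (App (lst (a # l)) (Abs (Abs c))) n \<approx> subst (subst c (num a) (Suc 0)) (lst l) 0"
  using conv_trans[OF lst_Cons_conv conv_beta2] by simp

lemma nth_rep_conv: "i < length xs \<Longrightarrow> App (nth_rep i) (lst xs) \<approx> num (xs ! i)"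
proof (induction i arbitrary: xs)
  case 0
  then obtain x l where xs: "xs = x # l" by (cases xs) auto
  show ?case unfolding xs nth_rep.simps
    by (rule conv_trans[OF conv_beta], simp, rule conv_trans[OF lst_Cons_beta_conv], simp)
next
  case (Suc i)
  then obtain x l where xs: "xs = x # l" "i < length l" by (cases xs) auto
  have "App (nth_rep (Suc i)) (lst xs) \<approx> App (nth_rep i) (lst l)" unfolding xs nth_rep.simps
    by (rule conv_trans[OF conv_beta], simp, rule conv_trans[OF lst_Cons_beta_conv], simp)
  also have "\<dots> \<approx> num (l ! i)" using xs(2) by (rule Suc.IH)
  finally show ?case using xs by simp
qed

fun tuple_rep :: "lterm list \<Rightarrow> lterm \<Rightarrow> lterm" where
  "tuple_rep [] l = lst []"
| "tuple_rep (g # gs) l = App (App CONS (App g l)) (tuple_rep gs l)"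

lemma subst_tuple_rep: "\<forall>g \<in> set gs. lc g \<Longrightarrow> subst (tuple_rep gs l) t k = tuple_rep gs (subst l t k)"
  by (induction gs) auto

lemma loose_tuple_rep: "\<forall>g \<in> set gs. lc g \<Longrightarrow> loose (tuple_rep gs l) i \<Longrightarrow> loose l i"
  by (induction gs) auto

lemma tuple_rep_conv:
  "length ys = length gs \<Longrightarrow> \<forall>i<length gs. App (gs ! i) l \<approx> num (ys ! i) \<Longrightarrow> tuple_rep gs l \<approx> lst ys"
proof (induction ys gs rule: list_induct2)
  case (Cons y ys g gs)
  have "App (gs ! i) l \<approx> num (ys ! i)" if "i < length gs" for i
    using Cons.prems[rule_format, of "Suc i"] that by simp
  then have "tuple_rep gs l \<approx> lst ys" using Cons.IH by blast
  moreover have "App g l \<approx> num y" using Cons.prems[rule_format, of 0] by simp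
  ultimately have "tuple_rep (g # gs) l \<approx> App (App CONS (num y)) (lst ys)"
    by (simp add: conv_App)
  also have "\<dots> \<approx> lst (y # ys)" by (rule CONS_conv)
  finally show ?case .
qed simp

text \<open>With names, the fixed point of \<open>\<lambda>p l. l (\<lambda>n t. n (\<lambda>m. G (m
  # p (m # t) # t)) (F t)) 0\<close>: the list is split first, then its head into zero and
  successor.\<close>

definition rec_rep :: "lterm \<Rightarrow> lterm \<Rightarrow> lterm" where
  "rec_rep F G = fixp (Abs (Abs (App (App (BV 0) (Abs (Abs (App (App (BV 1)
     (Abs (App G (App (App CONS (BV 0))
       (App (App CONS (App (BV 4) (App (App CONS (BV 0)) (BV 1)))) (BV 1))))))
     (App F (BV 0)))))) (num 0))))"

text \<open>With names, the fixed point of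
  \<open>\<lambda>s n l. F (n # l) (\<lambda>y. s (n + 1) l) n\<close>: the numeral computed by
  \<open>F\<close> continues the search if it is a successor and returns \<open>n\<close> if it is
  zero.\<close>

definition search_rep :: "lterm \<Rightarrow> lterm" where
  "search_rep F = fixp (Abs (Abs (Abs (App (App (App F (App (App CONS (BV 1)) (BV 0)))
     (Abs (App (App (BV 3) (App SUC (BV 2))) (BV 1)))) (BV 1)))))"

lemma lc_rec_rep [simp]: "lc F \<Longrightarrow> lc G \<Longrightarrow> lc (rec_rep F G)"
  unfolding rec_rep_def by (rule lc_fixp) (simp add: lc_def[of "Abs _"])

lemma lc_search_rep [simp]: "lc F \<Longrightarrow> lc (search_rep F)"
  unfolding search_rep_def by (rule lc_fixp) (simp add: lc_def[of "Abs _"])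

lemma rec_rep_0:
  assumes "lc F" "lc G" shows "App (rec_rep F G) (lst (0 # xs)) \<approx> App F (lst xs)"
  unfolding rec_rep_def
  by (rule conv_trans[OF conv_App_left[OF fixp_conv]], simp add: lc_def[of "Abs _"] assms,
      fold rec_rep_def, rule conv_trans[OF conv_beta2], simp add: assms eval_nat_numeral,
      rule conv_trans[OF lst_Cons_beta_conv], simp add: assms, rule num_0_conv)

lemma rec_rep_Suc:
  assumes "lc F" "lc G"
  shows "App (rec_rep F G) (lst (Suc n # xs)) \<approx>
    App G (App (App CONS (num n)) (App (App CONS (App (rec_rep F G) (App (App CONS (num n)) (lst xs)))) (lst xs)))"
  unfolding rec_rep_def
  by (rule conv_trans[OF conv_App_left[OF fixp_conv]], simp add: lc_def[of "Abs _"] assms,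
      fold rec_rep_def, rule conv_trans[OF conv_beta2], simp add: assms eval_nat_numeral,
      rule conv_trans[OF lst_Cons_beta_conv], simp add: assms, rule conv_trans[OF num_Suc_conv],
      rule conv_trans[OF conv_beta], simp add: assms)

lemma search_rep_conv:
  assumes "lc F"
  shows "App (App (search_rep F) (num n)) (lst xs) \<approx>
    App (App (App F (App (App CONS (num n)) (lst xs)))
      (Abs (App (App (search_rep F) (App SUC (num n))) (lst xs)))) (num n)"
  unfolding search_rep_def
  by (rule conv_trans[OF conv_App_left[OF conv_App_left[OF fixp_conv]]], simp add: lc_def[of "Abs _"] assms,
      fold search_rep_def, rule conv_trans[OF conv_App_left[OF conv_beta2]],
      simp add: assms eval_nat_numeral, rule conv_trans[OF conv_beta], simp add: assms)

fun rep :: "recf \<Rightarrow> lterm" where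
  "rep Z = Abs (num 0)"
| "rep S = Abs (App (App (BV 0) (Abs (Abs (App SUC (BV 1))))) (num 0))"
| "rep (Id i) = nth_rep i"
| "rep (Cn f gs) = Abs (App (rep f) (tuple_rep (map rep gs) (BV 0)))"
| "rep (Pr f g) = rec_rep (rep f) (rep g)"
| "rep (Mn f) = Abs (App (App (search_rep (rep f)) (num 0)) (BV 0))"

lemma lc_rep [simp]: "lc (rep r)"
proof (induction r rule: rep.induct)
  case (4 f gs)
  then show ?case using loose_tuple_rep[of "map rep gs" "BV 0"] by (auto simp: lc_def[of "Abs _"])
qed (simp_all add: lc_def[of "Abs _"])

text \<open>Nothing is claimed where \<open>eval\<close> yields no value. This suffices, because the
  program to be represented is a total decider.\<close>

lemma rep_conv: "eval r xs y \<Longrightarrow> App (rep r) (lst xs) \<approx> num y"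
proof (induction rule: eval.induct)
  case (ev_Z xs)
  show ?case by (simp, rule conv_trans[OF conv_beta]) simp
next
  case (ev_S x xs)
  show ?case
    by (simp, rule conv_trans[OF conv_beta], simp, rule conv_trans[OF lst_Cons_beta_conv], simp add: SUC_conv)
next
  case (ev_Id i xs)
  then show ?case by (simp add: nth_rep_conv)
next
  case (ev_Cn ys gs xs f z)
  have "App (rep (Cn f gs)) (lst xs) \<approx> App (rep f) (tuple_rep (map rep gs) (lst xs))"
    by (simp, rule conv_trans[OF conv_beta]) (simp add: subst_tuple_rep)
  also have "\<dots> \<approx> App (rep f) (lst ys)"
    using ev_Cn by (intro conv_App_right tuple_rep_conv) auto
  also have "\<dots> \<approx> num z" by fact
  finally show ?case .
next
  case (ev_Pr0 f xs y g)
  then show ?case by (simp add: conv_trans[OF rec_rep_0])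
next
  case (ev_PrS f g n xs y z)
  let ?P = "rec_rep (rep f) (rep g)"
  have "App ?P (App (App CONS (num n)) (lst xs)) \<approx> App ?P (lst (n # xs))"
    by (intro conv_App_right CONS_conv)
  also have "\<dots> \<approx> num y" using ev_PrS.IH(1) by simp
  finally have "App (App CONS (App ?P (App (App CONS (num n)) (lst xs)))) (lst xs) \<approx>
      App (App CONS (num y)) (lst xs)" by (intro conv_App_left conv_App_right)
  also have "\<dots> \<approx> lst (y # xs)" by (rule CONS_conv)
  finally have "App (App CONS (num n)) (App (App CONS (App ?P (App (App CONS (num n)) (lst xs)))) (lst xs))
      \<approx> App (App CONS (num n)) (lst (y # xs))" by (rule conv_App_right)
  also have "\<dots> \<approx> lst (n # y # xs)" by (rule CONS_conv)
  finally have "App ?P (lst (Suc n # xs)) \<approx> App (rep g) (lst (n # y # xs))"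
    by (intro conv_trans[OF rec_rep_Suc] conv_App_right) simp_all
  also have "\<dots> \<approx> num z" by fact
  finally show ?case by simp
next
  case (ev_Mn f n xs)
  let ?M = "search_rep (rep f)"
  have F: "App (rep f) (App (App CONS (num m)) (lst xs)) \<approx> num y"
    if "App (rep f) (lst (m # xs)) \<approx> num y" for m y
    using conv_App_right[OF CONS_conv] that by (rule conv_trans)
  \<comment> \<open>Induction on the distance \<open>k\<close> from the zero at \<open>n\<close>:
    the search is followed backwards from its end to its start at 0.\<close>
  have "App (App ?M (num (n - k))) (lst xs) \<approx> num n" if "k \<le> n" for k
    using that
  proof (induction k)
    case 0
    have "App (App ?M (num n)) (lst xs) \<approx>
        App (App (num 0) (Abs (App (App ?M (App SUC (num n))) (lst xs)))) (num n)"
      using F[OF ev_Mn.IH(1)] by (intro conv_trans[OF search_rep_conv] conv_App_left) simp_all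
    also have "\<dots> \<approx> num n" by (rule num_0_conv)
    finally show ?case by simp
  next
    case (Suc k)
    let ?m = "n - Suc k"
    from Suc.prems have m: "?m < n" "Suc ?m = n - k" by auto
    then obtain y where y: "App (rep f) (lst (?m # xs)) \<approx> num (Suc y)"
      using ev_Mn.IH(2) by (metis not0_implies_Suc)
    have "App (App ?M (num ?m)) (lst xs) \<approx>
        App (App (num (Suc y)) (Abs (App (App ?M (App SUC (num ?m))) (lst xs)))) (num ?m)"
      using F[OF y] by (intro conv_trans[OF search_rep_conv] conv_App_left) simp_all
    also have "\<dots> \<approx> App (Abs (App (App ?M (App SUC (num ?m))) (lst xs))) (num y)"
      by (rule num_Suc_conv)
    also have "\<dots> \<approx> App (App ?M (App SUC (num ?m))) (lst xs)"
      by (rule conv_trans[OF conv_beta]) simp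
    also have "\<dots> \<approx> App (App ?M (num (Suc ?m))) (lst xs)"
      by (intro conv_App_left conv_App_right SUC_conv)
    also have "\<dots> \<approx> num n" using Suc m by simp
    finally show ?case .
  qed
  from this[of n] have "App (App ?M (num 0)) (lst xs) \<approx> num n" by simp
  then show ?case by (simp, intro conv_trans[OF conv_beta]) simp
qed


section \<open>Undecidability\<close>

fun fvs :: "lterm \<Rightarrow> nat set" where
  "fvs (FV x) = {x}"
| "fvs (BV i) = {}"
| "fvs (Abs s) = fvs s"
| "fvs (App s t) = fvs s \<union> fvs t"

lemma finite_fvs [simp]: "finite (fvs s)"
  by (induction s) auto

lemma abst_fresh [simp]: "x \<notin> fvs s \<Longrightarrow> abst x k s = s"
  by (induction s arbitrary: k) auto

lemma abst_subst_FV: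
  "x \<notin> fvs s \<Longrightarrow> (\<And>i. i > k \<Longrightarrow> \<not> loose s i) \<Longrightarrow> abst x k (subst s (FV x) k) = s"
proof (induction s arbitrary: k)
  case (BV i)
  from BV(2)[of i] show ?case by (cases "k < i") auto
next
  case (Abs s)
  have "\<not> loose s i" if "i > Suc k" for i
    using Abs.prems(2)[of "i - 1"] that by (cases i) auto
  with Abs.prems Abs.IH show ?case by simp
qed auto

lemma not_loose_subst_FV:
  "(\<And>i. i > k \<Longrightarrow> \<not> loose s i) \<Longrightarrow> \<not> loose (subst s (FV x) k) j \<or> j < k"
proof (induction s arbitrary: k j)
  case (BV i)
  from BV[of i] show ?case by (cases "k < i") auto
next
  case (Abs s)
  have "\<not> loose s i" if "i > Suc k" for i
    using Abs.prems[of "i - 1"] that by (cases i) auto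
  with Abs.IH[of "Suc k" "Suc j"] show ?case by simp
next
  case (App s t)
  have "\<not> loose s i" "\<not> loose t i" if "i > k" for i
    using App.prems[OF that] by simp_all
  with App.IH(1)[of k j] App.IH(2)[of k j] show ?case by (metis loose.simps(4) subst.simps(4))
qed auto

lemma size_subst_FV: "size (subst s (FV x) k) = size s"
  by (induction s arbitrary: k) auto

text \<open>The diagonal term is pure, while the decider takes typed terms; this is the passage
  between them. Any annotation will do, here \<open>om\<close>. Opening an abstraction with a fresh
  variable keeps the size but leaves the subterms, hence the induction on size.\<close>

lemma ex_dterm: "lc s \<Longrightarrow> \<exists>D. ess D = s"
proof (induction s rule: measure_induct_rule[of size])
  case (less s)
  show ?case
  proof (cases s)
    case (FV x)
    then show ?thesis by (metis ess.simps(2))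
  next
    case (BV i)
    with less.prems show ?thesis by (simp add: lc_def)
  next
    case (Abs r)
    with less.prems have r: "\<not> loose r (Suc i)" for i by (simp add: lc_def)
    obtain x where x: "x \<notin> fvs r" using ex_new_if_finite[OF infinite_UNIV_nat] finite_fvs by blast
    have lift: "r = abst x 0 (subst r (FV x) 0)"
      using x r by (intro abst_subst_FV[symmetric]) (auto simp: gr0_conv_Suc)
    have "\<not> loose (subst r (FV x) 0) i" for i
      using not_loose_subst_FV[of 0 r x i] r by (auto simp: gr0_conv_Suc)
    then have "lc (subst r (FV x) 0)" by (simp add: lc_def)
    moreover have "size (subst r (FV x) 0) < size s" by (simp add: size_subst_FV Abs)
    ultimately obtain D where "ess D = subst r (FV x) 0" using less.IH by blast
    then have "ess (Lam x om D) = s" using lift Abs by simp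
    then show ?thesis by blast
  next
    case (App r t)
    with less.prems have "lc r" "lc t" by (auto simp: lc_def)
    with less.IH App obtain D E where "ess D = r" "ess E = t" by fastforce
    with App have "ess (Ap D E) = s" by simp
    then show ?thesis by blast
  qed
qed

text \<open>Quotation has to be effective, so numerals are given as explicit typed terms instead of
  being drawn from \<open>ex_dterm\<close>.\<close>

definition num_dterm :: "nat \<Rightarrow> dterm" where
  "num_dterm n = rec_nat (Lam 0 om (Lam 1 om (Var 1))) (\<lambda>_ D. Lam 0 om (Lam 1 om (Ap (Var 0) D))) n"

lemma ess_num_dterm: "ess (num_dterm n) = num n"
proof (induction n)
  case 0
  then show ?case by (simp add: num_dterm_def num.simps)
next
  case (Suc n)
  have "fvs (num n) = {}" by (induction n) (simp_all add: num.simps)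
  with Suc show ?case by (simp add: num_dterm_def num.simps)
qed

lemma computable_num_dterm [computable_intros]:
  assumes "computable f" shows "computable (\<lambda>x. num_dterm (f x))"
  unfolding num_dterm_def by (intro computable_intros assms)

lemma conv_imp_rel_holds: "s \<approx> t \<Longrightarrow> R \<noteq> Syn \<Longrightarrow> rel_holds R s t"
  unfolding conv_def rel_holds_iff
  by (induction rule: equivclp_induct) (cases R; auto intro: equivclp_into_equivclp)+

text \<open>Consistency of conversion: both numerals are normal, even for eta, and they
  differ.\<close>

lemma num_0_1_not_rel_holds: "\<not> rel_holds R (num 0) (num 1)"
proof -
  have "normal R (num 0)" "normal R (num 1)"
    unfolding normal_def
    by (cases R; auto simp: num.simps elim!: beta_AbsE beta_AppE eta_AbsE eta_AppE beta_BVE eta_BVE)+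
  then have "normal_form R (num 0) (num 0)" "normal_form R (num 1) (num 1)"
    by (simp_all add: normal_form_def)
  then show ?thesis using rel_holds_iff_normal_form by (fastforce simp: num.simps)
qed

text \<open>Diagonalisation: a decision function yields a term \<open>W\<close> with \<open>W n\<close> convertible to
  \<open>1\<close> if \<open>n\<close> encodes a term \<open>D\<close> with \<open>D n\<close> convertible to \<open>0\<close>, and to \<open>0\<close> otherwise.
  Apply it to its own code.\<close>

lemma conversion_undecidable:
  assumes "R \<noteq> Syn" shows "\<not> computable (\<lambda>D. rel_holds R (ess D) (num 0))"
proof
  assume dec: "computable (\<lambda>D. rel_holds R (ess D) (num 0))"
  let ?self = "\<lambda>D. Ap D (num_dterm (enc D))"
  have "computable (\<lambda>D :: dterm. enc D)"
    by (rule computable_by_code[where g = "\<lambda>n. n"]) (auto intro: computable_intros)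
  then have "computable ?self" by (intro computable_intros)
  from computable_comp[OF dec this] obtain r where
    r: "\<And>D. eval r [enc D] (if rel_holds R (ess (?self D)) (num 0) then 1 else 0)"
    unfolding computable_def enc_bool_def by blast
  \<comment> \<open>The numeral returned by \<open>r\<close> acts as a conditional: 1 hands its
    predecessor to the constant function \<open>Abs (num 1)\<close>, while 0 selects
    \<open>num 0\<close>.\<close>
  define W where "W = Abs (App (App (App (rep r) (App (App CONS (BV 0)) (lst []))) (Abs (num 1))) (num 0))"
  have "lc W" by (simp add: W_def lc_def[of "Abs _"])
  then obtain D where D: "ess D = W" using ex_dterm by blast
  let ?b = "rel_holds R (ess (?self D)) (num 0)"
  have "ess (?self D) = App W (num (enc D))" by (simp only: ess.simps D ess_num_dterm)
  also have "\<dots> \<approx> App (App (App (rep r) (App (App CONS (num (enc D))) (lst []))) (Abs (num 1))) (num 0)"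
    unfolding W_def by (rule conv_trans[OF conv_beta]) simp
  also have "\<dots> \<approx> App (App (App (rep r) (lst [enc D])) (Abs (num 1))) (num 0)"
    by (intro conv_App_left conv_App_right CONS_conv)
  also have "\<dots> \<approx> App (App (num (if ?b then 1 else 0)) (Abs (num 1))) (num 0)"
    by (intro conv_App_left rep_conv r)
  also have "\<dots> \<approx> num (if ?b then 1 else 0)"
  proof (cases ?b)
    case True
    have "App (App (num 1) (Abs (num 1))) (num 0) \<approx> num 1"
      using num_Suc_conv[of 0] by (simp, intro conv_trans[OF num_Suc_conv[of 0]] conv_trans[OF conv_beta]) simp
    with True show ?thesis by simp
  next
    case False
    then show ?thesis by (simp add: num_0_conv)
  qed
  finally have W: "rel_holds R (ess (?self D)) (num (if ?b then 1 else 0))"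
    using assms by (rule conv_imp_rel_holds)
  show False
  proof (cases ?b)
    case True
    with W have "rel_holds R (ess (?self D)) (num 1)" by (simp only: if_True)
    with rel_holds_sym[OF True] have "rel_holds R (num 0) (num 1)" by (rule rel_holds_trans)
    then show False using num_0_1_not_rel_holds by blast
  next
    case False
    with W show False by (simp only: if_False)
  qed
qed

lemma typing_Pair_U:
  assumes "has_omega T"
  shows "typing T R B (dterm.Pair (U D) (U E)) s \<longleftrightarrow> s = Inter om om \<and> rel_holds R (ess D) (ess E)"
proof
  assume "typing T R B (dterm.Pair (U D) (U E)) s"
  then obtain t u where "s = Inter t u" "typing T R B (U D) t" "typing T R B (U E) u"
    "rel_holds R (ess (U D)) (ess (U E))" by (auto elim: typing.cases)
  then show "s = Inter om om \<and> rel_holds R (ess D) (ess E)" by (auto elim: typing.cases)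
next
  assume "s = Inter om om \<and> rel_holds R (ess D) (ess E)"
  then show "typing T R B (dterm.Pair (U D) (U E)) s"
    using assms by (auto intro!: typing.intros)
qed

definition query :: "dterm \<Rightarrow> dterm" where
  "query D = dterm.Pair (U D) (U (num_dterm 0))"

lemma typing_query: "has_omega T \<Longrightarrow> typing T R [] (query D) s \<longleftrightarrow> s = Inter om om \<and> rel_holds R (ess D) (num 0)"
  by (simp add: query_def typing_Pair_U ess_num_dterm del: rel_holds.simps)

lemma computable_query: "computable query"
  unfolding query_def by (intro computable_intros)

theorem undecidable_type_checking:
  assumes "has_omega T" "R \<noteq> Syn" shows "\<not> type_checking_decidable T R"
proof
  assume "type_checking_decidable T R"
  then obtain r where "\<And>B D s. valid_basis T B \<Longrightarrow>
      eval r [prod_encode (enc_basis B, prod_encode (enc_dterm D, enc_ty s))]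
        (if typing T R B D s then 1 else 0)"
    unfolding type_checking_decidable_def by blast
  from this[of "[]"] have r: "eval r [enc ([] :: basis, D, s)] (enc (typing T R [] D s))" for D s
    by (simp add: valid_basis_def)
  have "computable (\<lambda>D. ([] :: basis, query D, Inter om om))"
    by (intro computable_intros computable_query)
  then obtain q where q: "\<And>D. eval q [enc D] (enc ([] :: basis, query D, Inter om om))"
    unfolding computable_def by blast
  have "eval (Cn r [q]) [enc D] (enc (rel_holds R (ess D) (num 0)))" for D
    using eval_comp1[OF q r] by (simp add: typing_query assms del: rel_holds.simps)
  then show False using conversion_undecidable[OF assms(2)] unfolding computable_def by blast
qed

text \<open>Already the decision part is impossible: a query can only have the type
  \<open>Inter om om\<close>, so the existence of a type is again the conversion problem.\<close>

theorem undecidable_type_reconstruction: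
  assumes "has_omega T" "R \<noteq> Syn" shows "\<not> type_reconstruction_decidable T R"
proof
  assume "type_reconstruction_decidable T R"
  then obtain r where "\<And>B D. valid_basis T B \<Longrightarrow>
      eval r [prod_encode (enc_basis B, enc_dterm D)] (if \<exists>s. typing T R B D s then 1 else 0)"
    unfolding type_reconstruction_decidable_def by blast
  from this[of "[]"] have r: "eval r [enc ([] :: basis, D)] (enc (\<exists>s. typing T R [] D s))" for D
    by (simp add: valid_basis_def)
  have "computable (\<lambda>D. ([] :: basis, query D))"
    by (intro computable_intros computable_query)
  then obtain q where q: "\<And>D. eval q [enc D] (enc ([] :: basis, query D))"
    unfolding computable_def by blast
  have "eval (Cn r [q]) [enc D] (enc (rel_holds R (ess D) (num 0)))" for D
    using eval_comp1[OF q r] by (simp add: typing_query assms del: rel_holds.simps)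
  then show False using conversion_undecidable[OF assms(2)] unfolding computable_def by blast
qed


theorem mainTheorem16:
  shows "(\<forall>(T, R) \<in> {(CD, Syn), (CDV, Syn), (CDS, Syn), (BCD, Syn), (CD, Beta), (CDV, Beta), (CDV, BetaEta)}.
            type_checking_decidable T R \<and> type_reconstruction_decidable T R) \<and>
         (\<forall>(T, R) \<in> {(CDS, Beta), (BCD, Beta), (BCD, BetaEta)}.
            \<not> type_checking_decidable T R \<and> \<not> type_reconstruction_decidable T R)"
  using decidable_type_checking decidable_type_reconstruction
    undecidable_type_checking undecidable_type_reconstruction
  by (simp add: has_omega_def)

end
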